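(* Let $n\in\mathbb N$ and let $X_1,\dots,X_n$ be independent identically distributed random variables with symmetric distribution and $0<{\sf E}X_1^2<\infty$. Assume $L_n(1)>0$ and put $\gamma=M_n(1)/L_n(1)$. Then for each pair $(\gamma_0,c)$ in the list $(0,\,1.5645)$, $(0.1,\,1.5534)$, $(0.5,\,1.4018)$, $(1,\,1.2388)$, $(2,\,1.0373)$, $(5,\,0.7915)$, $(10,\,0.6591)$, $(100,\,0.4923)$, if $\gamma\ge\gamma_0$ then $\Delta_n\le(1+\gamma)\,c\,L_n(1)=c\,(L_n(1)+M_n(1))$.
   Context: $B_n^2=\sum_{i=1}^n{\sf E}X_i^2$, $S_n=X_1+\dots+X_n$, $\Phi$ is the standard normal distribution function, $\Delta_n=\sup_{x}|{\sf P}(S_n<xB_n)-\Phi(x)|$. For $\varepsilon>0$, $L_n(\varepsilon)=B_n^{-2}\sum_{i=1}^n{\sf E}X_i^2\mathbb I(|X_i|\ge\varepsilon B_n)$, $M_n(\varepsilon)=B_n^{-3}\sum_{i=1}^n{\sf E}|X_i|^3\mathbb I(|X_i|<\varepsilon B_n)$. *)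

theory Defs
  imports "HOL-Probability.Probability"
begin

definition Phi :: "real \<Rightarrow> real" where
  "Phi x = measure (density lborel std_normal_density) {..<x}"

text \<open>Variables are X 0, ..., X (n-1) (i.e. X_1,...,X_n of the paper, shifted).\<close>
definition Bsq :: "'a measure \<Rightarrow> (nat \<Rightarrow> 'a \<Rightarrow> real) \<Rightarrow> nat \<Rightarrow> real" where
  "Bsq M X n = (\<Sum>i<n. integral\<^sup>L M (\<lambda>\<omega>. (X i \<omega>)\<^sup>2))"

definition Bn :: "'a measure \<Rightarrow> (nat \<Rightarrow> 'a \<Rightarrow> real) \<Rightarrow> nat \<Rightarrow> real" where
  "Bn M X n = sqrt (Bsq M X n)"

definition Sn :: "(nat \<Rightarrow> 'a \<Rightarrow> real) \<Rightarrow> nat \<Rightarrow> 'a \<Rightarrow> real" where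
  "Sn X n \<omega> = (\<Sum>i<n. X i \<omega>)"

definition Delta :: "'a measure \<Rightarrow> (nat \<Rightarrow> 'a \<Rightarrow> real) \<Rightarrow> nat \<Rightarrow> real" where
  "Delta M X n = (SUP x. \<bar>measure M {\<omega> \<in> space M. Sn X n \<omega> < x * Bn M X n} - Phi x\<bar>)"

definition Ln :: "'a measure \<Rightarrow> (nat \<Rightarrow> 'a \<Rightarrow> real) \<Rightarrow> nat \<Rightarrow> real \<Rightarrow> real" where
  "Ln M X n \<epsilon> = (\<Sum>i<n. integral\<^sup>L M (\<lambda>\<omega>. (X i \<omega>)\<^sup>2 *
       indicator {t. \<bar>t\<bar> \<ge> \<epsilon> * Bn M X n} (X i \<omega>))) / Bsq M X n"

definition Mn :: "'a measure \<Rightarrow> (nat \<Rightarrow> 'a \<Rightarrow> real) \<Rightarrow> nat \<Rightarrow> real \<Rightarrow> real" where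
  "Mn M X n \<epsilon> = (\<Sum>i<n. integral\<^sup>L M (\<lambda>\<omega>. \<bar>X i \<omega>\<bar> ^ 3 *
       indicator {t. \<bar>t\<bar> < \<epsilon> * Bn M X n} (X i \<omega>))) / (Bn M X n ^ 3)"

end

theory Submission
  imports Defs
begin

text \<open>
  Let \<open>S\<close> be the sum and \<open>B\<close> its standard deviation. By symmetry only \<open>P(S \<le> x B) - Phi x\<close> has to be
  bounded from above. Beurling's majorant \<open>G\<close> of \<open>sgn / 2\<close>, given by the kernel
  \<open>(1 - s) cot (pi s) + 1 / pi\<close>, bounds \<open>P(S \<le> x B) - 1 / 2\<close> by an integral of the characteristic function
  over a bounded interval. The majorant property follows from the sign of
  \<open>G (y + 1) - G y = - sin\<^sup>2 (pi y) / (pi\<^sup>2 y (y + 1)\<^sup>2)\<close> and the values \<open>\<plusminus>1/2\<close> of \<open>G\<close> at the integers.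

  For symmetric summands with finite third moment and Lyapunov ratio \<open>l\<close>, the characteristic function of the
  normalised sum is \<open>g\<^sup>n\<close> with a real \<open>g\<close> satisfying
  \<open>cos (t / sqrt n) \<le> g t \<le> 1 - t\<^sup>2 / (2 n) + l t\<^sup>3 / (10 n)\<close>. Comparison with \<open>exp (- t\<^sup>2 / 2)\<close> gives the
  Berry--Esseen bound \<open>0.4786 l\<close> for \<open>n \<ge> 3\<close>.

  In general the summands are truncated at \<open>B\<close>. This costs \<open>L\<close> for the probability that some summand is
  truncated, and a multiple of \<open>L\<close> for the change of the variance from \<open>B\<^sup>2\<close> to \<open>(1 - L) B\<^sup>2\<close>.
  For \<open>n \<le> 2\<close> Lyapunov's inequality makes \<open>L + M\<close> so large that either the trivial bound \<open>1/2\<close> or elementary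
  concentration estimates suffice.
\<close>

section \<open>Elementary inequalities\<close>

text \<open>The table fixes how sharp each ingredient must be. The tight row is
  \<open>(100, 0.4923)\<close>: truncation divides the Berry--Esseen constant by \<open>s^3\<close>
  with \<open>s = 0.9949\<close>, and the quotient may hardly exceed \<open>0.486\<close>; this
  demands \<open>0.4786\<close>. The main part \<open>1 / sqrt (2 * pi) = 0.3989...\<close> of that
  constant is unavoidable, since symmetric two-point summands attain it asymptotically. It is the
  leading term of the smoothing error at the cut-off \<open>pi / l\<close>, which is why an extremal
  majorant is used instead of a cruder kernel. Only about \<open>0.08 * l\<close> is left for
  comparing characteristic functions. Two-point summands are the obstacle there as well:
  \<open>cos (t / sqrt n) ^ n\<close> returns to modulus one at \<open>t = pi * sqrt n\<close>, so
  instead of decay near the cut-off the vanishing of the kernel at \<open>s = 1\<close> has to be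
  exploited. The restriction \<open>n >= 3\<close> stems from the inequality
  \<open>exp (v^3 / 10) ^ n + (cos v * exp (v^2 / 2)) ^ n >= 2\<close>, which fails for
  \<open>n = 2\<close> at \<open>v = 1.2\<close>.\<close>

lemma nonneg_from_deriv:
  fixes f f' :: "real \<Rightarrow> real"
  assumes "a \<le> x" "f a \<ge> 0"
    and "\<And>y. a \<le> y \<Longrightarrow> y \<le> x \<Longrightarrow> (f has_real_derivative f' y) (at y)"
    and "\<And>y. a \<le> y \<Longrightarrow> y \<le> x \<Longrightarrow> f' y \<ge> 0"
  shows "f x \<ge> 0"
  using DERIV_nonneg_imp_nondecreasing[of a x f] assms by (meson order_trans)

section \<open>Taylor bounds for sine, cosine and exponential\<close>

lemma cos_ge_poly2: "cos x \<ge> 1 - x\<^sup>2 / 2" for x :: real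
proof -
  have "(sin (x/2))\<^sup>2 \<le> (x/2)\<^sup>2"
    using abs_sin_x_le_abs_x[of "x/2"] by (meson abs_le_square_iff)
  moreover have "cos x = 1 - 2 * (sin (x/2))\<^sup>2"
    using cos_double_sin[of "x/2"] by simp
  ultimately show ?thesis by (simp add: power_divide)
qed

lemma sin_ge_poly3: "0 \<le> x \<Longrightarrow> sin x \<ge> x - x^3 / 6" for x :: real
  using nonneg_from_deriv[of 0 x "\<lambda>x. sin x - x + x^3/6" "\<lambda>x. cos x - 1 + x\<^sup>2/2"] cos_ge_poly2
  by (fastforce intro!: derivative_eq_intros simp: algebra_simps)

lemma cos_le_poly4: "cos x \<le> 1 - x\<^sup>2 / 2 + x^4 / 24" for x :: real
proof -
  have "cos x \<le> 1 - x\<^sup>2 / 2 + x^4 / 24" if "0 \<le> x" for x :: real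
    using nonneg_from_deriv[of 0 x "\<lambda>x. 1 - x\<^sup>2/2 + x^4/24 - cos x" "\<lambda>x. - x + x^3/6 + sin x"] sin_ge_poly3 that
    by (fastforce intro!: derivative_eq_intros simp: algebra_simps)
  from this[of "\<bar>x\<bar>"] show ?thesis by simp
qed

lemma sin_le_poly5: "0 \<le> x \<Longrightarrow> sin x \<le> x - x^3 / 6 + x^5 / 120" for x :: real
  using nonneg_from_deriv[of 0 x "\<lambda>x. x - x^3/6 + x^5/120 - sin x" "\<lambda>x. 1 - x\<^sup>2/2 + x^4/24 - cos x"] cos_le_poly4
  by (fastforce intro!: derivative_eq_intros simp: algebra_simps)

lemma cos_ge_poly6: "cos x \<ge> 1 - x\<^sup>2 / 2 + x^4 / 24 - x^6 / 720" for x :: real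
proof -
  have "cos x \<ge> 1 - x\<^sup>2 / 2 + x^4 / 24 - x^6 / 720" if "0 \<le> x" for x :: real
    using nonneg_from_deriv[of 0 x "\<lambda>x. cos x - 1 + x\<^sup>2/2 - x^4/24 + x^6/720"
      "\<lambda>x. - sin x + x - x^3/6 + x^5/120"] sin_le_poly5 that
    by (fastforce intro!: derivative_eq_intros simp: algebra_simps)
  from this[of "\<bar>x\<bar>"] show ?thesis by simp
qed

lemma exp_ge_taylor: "0 \<le> x \<Longrightarrow> exp x \<ge> (\<Sum>i\<le>n. x^i / fact i)" for x :: real
proof (induction n arbitrary: x)
  case (Suc n)
  have "((\<lambda>x. \<Sum>i\<le>Suc n. x^i / fact i) has_real_derivative (\<Sum>i\<le>n. y^i / fact i)) (at y)" for y :: real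
  proof -
    have "((\<lambda>x. \<Sum>i\<le>n. x^Suc i / fact (Suc i)) has_real_derivative (\<Sum>i\<le>n. y^i / fact i)) (at y)"
    proof (rule DERIV_sum)
      fix i
      show "((\<lambda>x. x^Suc i / fact (Suc i)) has_real_derivative y^i / fact i) (at y)"
        using DERIV_cdivide[OF DERIV_pow[of "Suc i" y], of "fact (Suc i)"]
        by (simp add: fact_Suc del: of_nat_Suc)
    qed
    moreover have "(\<lambda>x. \<Sum>i\<le>Suc n. x^i / fact i) = (\<lambda>x::real. 1 + (\<Sum>i\<le>n. x^Suc i / fact (Suc i)))"
      by (simp only: sum.atMost_Suc_shift) simp
    ultimately show ?thesis using DERIV_add[OF DERIV_const, of _ "\<Sum>i\<le>n. y^i / fact i" y UNIV 1] by simp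
  qed
  then have "0 \<le> exp x - (\<Sum>i\<le>Suc n. x^i / fact i)"
    using Suc
    by (intro nonneg_from_deriv[of 0 x "\<lambda>x. exp x - (\<Sum>i\<le>Suc n. x^i / fact i)"
      "\<lambda>x. exp x - (\<Sum>i\<le>n. x^i / fact i)"])
       (auto intro!: DERIV_diff DERIV_exp simp: sum.atMost_Suc_shift simp del: sum.atMost_Suc)
  then show ?case by simp
qed simp

section \<open>Cosine inequalities behind the estimates of characteristic functions\<close>

lemma pi_bounds: "3.14159 < pi" "pi < 3.1416"
  using pi_approx by simp_all

text \<open>The best constant is about \<open>0.0992\<close>, reached near \<open>x = 4\<close>, so
  \<open>1 / 10\<close> leaves little room. The fourth-order Taylor bound serves up to
  \<open>2.4 = 24 / 10\<close>; beyond that the cosine is dominated by the parabola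
  \<open>- 1 + (x - pi)^2 / 2\<close> around its minimum.\<close>

lemma cos_le_cubic: "cos x \<le> 1 - x\<^sup>2 / 2 + \<bar>x\<bar>^3 / 10" for x :: real
proof -
  have "cos x \<le> 1 - x\<^sup>2 / 2 + x^3 / 10" if "0 \<le> x" for x :: real
  proof (cases "x \<le> 2.4")
    case True
    have "x^4 / 24 = x^3 * (x / 24)" by (simp add: power_def eval_nat_numeral)
    also have "\<dots> \<le> x^3 * (1/10)" using True that by (intro mult_left_mono) auto
    finally show ?thesis using cos_le_poly4[of x] by simp
  next
    case False
    have "cos x = - cos (x - pi)" by (simp add: cos_diff)
    then have 1: "cos x \<le> - 1 + (x - pi)\<^sup>2 / 2" using cos_ge_poly2[of "x - pi"] by simp
    \<comment> \<open>The difference to be bounded is a cubic with coefficients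
      \<open>1 / 10\<close> and \<open>- 1\<close> in degrees 3 and 2 and a local minimum near
      \<open>4.14\<close>. A double root there forces the factor \<open>x / 10 - 0.172\<close>, and
      the linear coefficient stays just below \<open>pi\<close>.\<close>
    have "0 \<le> (x - 4.14)\<^sup>2 * (x / 10 - 0.172)" using False by (intro mult_nonneg_nonneg) auto
    also have "\<dots> = x^3 / 10 - x\<^sup>2 + 3.13812 * x - 2.9480112"
      by (simp add: power2_eq_square power3_eq_cube field_simps)
    also have "\<dots> \<le> x^3 / 10 - x\<^sup>2 + pi * x - 2.9480112"
      using pi_bounds False by (simp add: mult_right_mono)
    finally have "0 \<le> x^3 / 10 - x\<^sup>2 + pi * x - 2.9480112" .
    moreover have "pi * pi \<le> 3.1416 * 3.1416" using pi_bounds by (intro mult_mono) auto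
    ultimately show ?thesis using 1 by (simp add: power2_eq_square algebra_simps)
  qed
  from this[of "\<bar>x\<bar>"] show ?thesis by simp
qed

text \<open>On \<open>[-pi, pi]\<close> the cosine is a convex function of \<open>y\<^sup>2\<close>; this is its tangent line at \<open>u\<^sup>2\<close>.\<close>
lemma cos_ge_parabola:
  assumes "0 < u" "u \<le> pi"
  shows "cos y \<ge> cos u + sin u / (2 * u) * (u\<^sup>2 - y\<^sup>2)"
proof -
  have sinc_mono: "sin b / b \<le> sin a / a" if "0 < a" "a \<le> b" "b \<le> pi" for a b :: real
  proof -
    have "((\<lambda>x. - (sin x / x)) has_real_derivative (sin x - x * cos x) / x\<^sup>2) (at x)" if "a \<le> x" for x
      using that \<open>0 < a\<close> by (auto intro!: derivative_eq_intros simp: power2_eq_square divide_simps)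
    moreover have "(sin x - x * cos x) / x\<^sup>2 \<ge> 0" if "a \<le> x" "x \<le> b" for x
    proof -
      have "0 \<le> sin x - x * cos x"
        using that \<open>0 < a\<close> \<open>b \<le> pi\<close>
        by (intro nonneg_from_deriv[of 0 x "\<lambda>x. sin x - x * cos x" "\<lambda>x. x * sin x"])
           (auto intro!: derivative_eq_intros sin_ge_zero mult_nonneg_nonneg)
      then show ?thesis by simp
    qed
    ultimately have "- (sin a / a) \<le> - (sin b / b)"
      using that by (intro DERIV_nonneg_imp_nondecreasing[of a b "\<lambda>x. - (sin x / x)"]) auto
    then show ?thesis by simp
  qed
  define h where "h = (\<lambda>y. cos y - cos u - sin u / (2 * u) * (u\<^sup>2 - y\<^sup>2))"
  have dh: "(h has_real_derivative (sin u / u * z - sin z)) (at z)" for z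
    unfolding h_def using assms by (auto intro!: derivative_eq_intros)
  have hu: "h u = 0" by (simp add: h_def)
  have su: "sin u \<ge> 0" using assms by (intro sin_ge_zero) auto
  have main: "h y \<ge> 0" if y: "0 \<le> y" "y \<le> pi" for y
  proof (cases "y \<le> u")
    case True
    have "h u \<le> h y"
    proof (rule DERIV_nonpos_imp_nonincreasing[OF True])
      fix z assume z: "y \<le> z" "z \<le> u"
      have "sin u / u * z - sin z \<le> 0"
      proof (cases "z = 0")
        case False
        then have "sin u / u \<le> sin z / z" using z y assms by (intro sinc_mono) auto
        then show ?thesis using False z y by (simp add: field_simps)
      qed simp
      then show "\<exists>d. DERIV h z :> d \<and> d \<le> 0" using dh by blast
    qed
    then show ?thesis using hu by simp
  next
    case False
    have "h u \<le> h y"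
    proof (rule DERIV_nonneg_imp_nondecreasing[of u y h])
      show "u \<le> y" using False by simp
      fix z assume z: "u \<le> z" "z \<le> y"
      have "sin z / z \<le> sin u / u" using z y assms by (intro sinc_mono) auto
      then have "sin u / u * z - sin z \<ge> 0" using z assms by (simp add: field_simps)
      then show "\<exists>d. DERIV h z :> d \<and> 0 \<le> d" using dh by blast
    qed
    then show ?thesis using hu by simp
  qed
  have main': "h y \<ge> 0" if "0 \<le> y" for y
  proof (cases "y \<le> pi")
    case False
    \<comment> \<open>Convexity in \<open>y^2\<close> is lost beyond \<open>pi\<close>, but there
      the parabola lies below its value at \<open>pi\<close>, which is at most
      \<open>- 1\<close>.\<close>
    have "sin u / (2 * u) * (u\<^sup>2 - y\<^sup>2) \<le> sin u / (2 * u) * (u\<^sup>2 - pi\<^sup>2)"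
      using False su assms by (intro mult_left_mono) (auto simp: power_mono)
    moreover have "h pi \<ge> 0" by (intro main) auto
    ultimately show ?thesis using cos_ge_minus_one[of y] unfolding h_def cos_pi by linarith
  qed (use main that in auto)
  from main'[of "\<bar>y\<bar>"] show ?thesis by (simp add: h_def)
qed

text \<open>Multiplies Taylor polynomials in \<open>z = v^2\<close>. The coefficients
  \<open>1 / 12\<close> and \<open>1 / 45\<close> are exact; \<open>1 / 240\<close> absorbs
  everything of order \<open>z^4\<close> and higher for \<open>z <= 16/9\<close>. The range ends at
  \<open>4/3\<close> because beyond it the term \<open>exp (v^3 / 10) ^ 3\<close> alone exceeds
  \<open>2\<close>.\<close>

lemma cos_exp_ge:
  fixes v :: real
  assumes "0 \<le> v" "v \<le> 4/3"
  shows "cos v * exp (v\<^sup>2 / 2) \<ge> 1 - v^4 / 12 - v^6 / 45 - v^8 / 240"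
proof -
  define z where "z = v\<^sup>2"
  have z: "0 \<le> z" "z \<le> 16/9"
    using power_mono[of v "4/3" 2] assms by (auto simp: z_def power_divide)
  have "0 \<le> 1 - z/2 + z^2/24 - z^3/720"
  proof -
    have "z^3 / 720 \<le> z\<^sup>2 / 24" using z mult_left_mono[of z 30 "z\<^sup>2"]
      by (simp add: power3_eq_cube power2_eq_square)
    then show ?thesis using z by linarith
  qed
  moreover have "exp (z/2) \<ge> 1 + z/2 + z^2/8 + z^3/48 + z^4/384 + z^5/3840"
    using exp_ge_taylor[of "z/2" 5] z by (simp add: eval_nat_numeral field_simps)
  moreover have "cos v \<ge> 1 - z/2 + z^2/24 - z^3/720"
    using cos_ge_poly6[of v] by (simp add: z_def flip: power_mult)
  ultimately have "cos v * exp (z/2) \<ge> (1 - z/2 + z^2/24 - z^3/720) * (1 + z/2 + z^2/8 + z^3/48 + z^4/384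
    + z^5/3840)"
    using z by (intro mult_mono) auto
  also have "(1 - z/2 + z^2/24 - z^3/720) * (1 + z/2 + z^2/8 + z^3/48 + z^4/384 + z^5/3840)
      = 1 - z^2/12 - z^3/45 - z^4 * (19/5760 + z/2880 + 7/138240*z^2 - z^3/138240 + z^4/2764800)"
    by (simp add: field_simps eval_nat_numeral)
  finally have "1 - z^2/12 - z^3/45 - z^4 * (19/5760 + z/2880 + 7/138240*z^2 - z^3/138240 + z^4/2764800)
      \<le> cos v * exp (z/2)" .
  moreover have "z^4 * (19/5760 + z/2880 + 7/138240*z^2 - z^3/138240 + z^4/2764800) \<le> z^4 * (1/240)"
  proof (intro mult_left_mono)
    have "z^2 \<le> 256/81" "z^4 \<le> 65536/6561"
      using z power_mono[of z "16/9" 2] power_mono[of z "16/9" 4] by (simp_all add: power_divide)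
    moreover have "z^3 \<ge> 0" using z by simp
    ultimately show "19/5760 + z/2880 + 7/138240*z^2 - z^3/138240 + z^4/2764800 \<le> 1/240"
      using z by linarith
  qed (use z in auto)
  ultimately have "1 - z^2/12 - z^3/45 - z^4 * (1/240) \<le> cos v * exp (z/2)" by linarith
  then show ?thesis by (simp add: z_def flip: power_mult)
qed

text \<open>With \<open>power_sum_ge_2\<close> this propagates from exponent 3 to all exponents \<open>n \<ge> 3\<close>.\<close>
lemma exp_cos_cube_sum_ge_2:
  assumes "0 \<le> v" "v \<le> pi / 2"
  shows "exp (v^3 / 10) ^ 3 + (cos v * exp (v\<^sup>2 / 2)) ^ 3 \<ge> 2"
proof -
  have cos0: "0 \<le> cos v * exp (v\<^sup>2 / 2)" using assms by (intro mult_nonneg_nonneg cos_ge_zero) auto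
  have pe: "exp (v^3 / 10) ^ 3 = exp (3/10 * v^3)" by (simp flip: exp_of_nat_mult)
  show ?thesis
  proof (cases "v \<le> 4/3")
    case False
    then have "v^3 \<ge> (4/3)^3" by (intro power_mono) auto
    then have "0.71 \<le> 3/10 * v^3" by (simp add: power_divide)
    then have "exp 0.71 \<le> exp (3/10 * v^3)" by simp
    moreover have "exp (0.71::real) \<ge> 2"
      using exp_ge_taylor[of "0.71" 3] by (simp add: eval_nat_numeral)
    ultimately show ?thesis using zero_le_power[OF cos0, of 3] unfolding pe by linarith
  next
    case True
    define e where "e = v/12 + v^3/45 + v^5/240"
    define y where "y = v^3"
    have pe': "exp (y / 10) ^ 3 = exp (3/10*y)" using pe by (simp add: y_def)
    have y0: "0 \<le> y" and e0: "0 \<le> e" using assms by (auto simp: y_def e_def)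
    have q: "1 - y * e \<le> cos v * exp (v\<^sup>2 / 2)"
      using cos_exp_ge[OF assms(1) True] by (simp add: y_def e_def field_simps eval_nat_numeral)
    have emono: "e \<le> c/12 + c^3/45 + c^5/240" if "v \<le> c" for c
      unfolding e_def using that assms by (intro add_mono divide_right_mono power_mono) auto
    have ymono: "y \<ge> c^3" if "c \<le> v" "0 \<le> c" for c
      unfolding y_def using that by (intro power_mono) auto
    have e1: "e \<le> 0.187" using emono[OF True] by (simp add: power_divide)
    have y1: "y \<le> 2.371" unfolding y_def using power_mono[OF True assms(1), of 3] by (simp add: power_divide)
    have ye: "y * e \<le> 1"
      using mult_mono[OF y1 e1] y0 e0 by simp
    have "e^3 \<le> 0.187^3" using e1 e0 by (intro power_mono) auto
    then have "y * e^3 \<le> 2.371 * 0.187^3" by (rule mult_mono[OF y1]) (use e0 in auto)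
    then have "y\<^sup>2 * (y * e^3) \<le> y\<^sup>2 * (39/2500)" by (intro mult_left_mono) (auto simp: power_divide)
    then have E: "y^3 * e^3 \<le> 39/2500 * y\<^sup>2" by (simp add: power3_eq_cube power2_eq_square mult_ac)
    \<comment> \<open>This is the sum minus \<open>2\<close>, divided by \<open>y\<close>, with the
      first factor expanded to second order and \<open>cos v * exp (v^2 / 2)\<close> replaced by
      \<open>1 - y * e\<close>. Here \<open>147/5000 = 9/200 - 39/2500\<close>: the quadratic Taylor
      coefficient minus the share that pays for \<open>y^3 * e^3\<close> in
      \<open>E\<close>.\<close>
    have key: "3/10 - 3*e + y * (147/5000 + 3 * e\<^sup>2) \<ge> 0"
    proof -
      \<comment> \<open>On \<open>[c, d]\<close> the worst case is \<open>y = c^3\<close> together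
        with \<open>e = E\<close>: the condition \<open>2 * c^3 * E <= 1\<close> makes the quadratic
        in \<open>e\<close> decreasing up to \<open>E\<close>. The intervals below are chosen just
        fine enough for the last condition to hold.\<close>
      have step: ?thesis
        if "c \<le> v" "v \<le> d" "0 \<le> c" "d/12 + d^3/45 + d^5/240 \<le> E" "2 * c^3 * E \<le> 1"
          "3/10 - 3*E + c^3 * (147/5000 + 3 * E\<^sup>2) \<ge> 0" for c d E
      proof -
        have eE: "e \<le> E" using emono[OF that(2)] that(4) by simp
        have "c^3 * (e + E) \<le> 2 * c^3 * E"
          using eE mult_left_mono[of "e + E" "2 * E" "c^3"] that(3) by (simp add: algebra_simps)
        then have "0 \<le> (E - e) * (3 - 3 * (c^3 * (e + E)))"
          using eE that(5) by (intro mult_nonneg_nonneg) auto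
        then have "3/10 - 3*e + c^3 * (147/5000 + 3 * e\<^sup>2) \<ge> 0"
          using that(6) by (simp add: algebra_simps power2_eq_square)
        moreover have "c^3 * (147/5000 + 3 * e\<^sup>2) \<le> y * (147/5000 + 3 * e\<^sup>2)"
          using ymono[OF that(1,3)] by (intro mult_right_mono) auto
        ultimately show ?thesis by linarith
      qed
      consider "v \<le> 0.9" | "0.9 \<le> v" "v \<le> 1" | "1 \<le> v" "v \<le> 1.08" | "1.08 \<le> v" "v \<le> 1.13"
        | "1.13 \<le> v" "v \<le> 1.17" | "1.17 \<le> v" "v \<le> 1.21" | "1.21 \<le> v" "v \<le> 1.26" | "1.26 \<le> v"
        by linarith
      then show ?thesis
      proof cases
        case 1 show ?thesis by (rule step[of 0 "0.9" "0.0938"]) (use 1 assms in \<open>auto simp: power_divide\<close>)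
      next
        case 2 then show ?thesis by (intro step[of "0.9" 1 "0.1098"]) (auto simp: power_divide)
      next
        case 3 then show ?thesis by (intro step[of 1 "1.08" "0.1242"]) (auto simp: power_divide)
      next
        case 4 then show ?thesis by (intro step[of "1.08" "1.13" "0.134"]) (auto simp: power_divide)
      next
        case 5 then show ?thesis by (intro step[of "1.13" "1.17" "0.1423"]) (auto simp: power_divide)
      next
        case 6 then show ?thesis by (intro step[of "1.17" "1.21" "0.1511"]) (auto simp: power_divide)
      next
        case 7 then show ?thesis by (intro step[of "1.21" "1.26" "0.1627"]) (auto simp: power_divide)
      next
        case 8 then show ?thesis using True by (intro step[of "1.26" "4/3" "0.1814"]) (auto simp: power_divide)
      qed
    qed
    have "exp (3/10 * y) \<ge> 1 + 3/10*y + 9/200*y\<^sup>2"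
      using exp_ge_taylor[of "3/10*y" 2] y0 by (simp add: eval_nat_numeral)
    moreover have "(cos v * exp (v\<^sup>2 / 2))^3 \<ge> (1 - y * e)^3"
      using q ye by (intro power_mono) auto
    moreover have "(1 - y * e)^3 = 1 - 3 * y * e + 3 * y\<^sup>2 * e\<^sup>2 - y^3 * e^3"
      by (simp add: power3_eq_cube power2_eq_square algebra_simps)
    moreover have "0 \<le> y * (3/10 - 3*e + y * (147/5000 + 3 * e\<^sup>2))"
      using key y0 by simp
    moreover have "y * (3/10 - 3*e + y * (147/5000 + 3 * e\<^sup>2)) = 3/10 * y - 3 * y * e + 147/5000 * y\<^sup>2
      + 3 * y\<^sup>2 * e\<^sup>2"
      by (simp add: field_simps power2_eq_square)
    ultimately show ?thesis using E unfolding y_def[symmetric] pe' by linarith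
  qed
qed

text \<open>Passing from \<open>n\<close> to \<open>n + 1\<close> is harmless if the gain
  \<open>p^n * (p - 1)\<close> exceeds the loss \<open>q^n * (1 - q)\<close>. The case of exponent 3
  says \<open>(p - 1) * (1 + p + p^2) >= (1 - q) * (1 + q + q^2)\<close>; the quadratic factors are
  exchanged at the cost of two powers,
  \<open>q^2 * (1 + p + p^2) <= p^2 * (1 + q + q^2)\<close>.\<close>

lemma power_sum_ge_2:
  fixes p q :: real
  assumes "p \<ge> 1" "0 \<le> q" "q \<le> 1" "p^3 + q^3 \<ge> 2" "n \<ge> 3"
  shows "p^n + q^n \<ge> 2"
  using \<open>n \<ge> 3\<close>
proof (induction n rule: dec_induct)
  case (step n)
  have "(p - 1) * (1 + p + p\<^sup>2) \<ge> (1 - q) * (1 + q + q\<^sup>2)"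
    using assms by (simp add: algebra_simps power2_eq_square power3_eq_cube)
  then have "p^n * ((p - 1) * (1 + p + p\<^sup>2)) \<ge> p^n * ((1 - q) * (1 + q + q\<^sup>2))"
    using assms by (intro mult_left_mono) auto
  moreover have "(1 - q) * (p^n * (1 + q + q\<^sup>2)) \<ge> (1 - q) * (q^n * (1 + p + p\<^sup>2))"
  proof (intro mult_left_mono)
    have pq: "q \<le> p" "q * p \<ge> 0" using assms by auto
    have "q\<^sup>2 \<le> p\<^sup>2" "q * p * q \<le> q * p * p"
      using assms pq by (auto intro!: power_mono mult_left_mono)
    then have "q\<^sup>2 * (1 + p + p\<^sup>2) \<le> p\<^sup>2 * (1 + q + q\<^sup>2)"
      by (simp add: algebra_simps power2_eq_square)
    moreover have "q^(n-2) \<le> p^(n-2)" using assms by (intro power_mono) auto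
    ultimately have 1: "q^(n-2) \<le> p^(n-2)" "q\<^sup>2 * (1 + p + p\<^sup>2) \<le> p\<^sup>2 * (1 + q + q\<^sup>2)" by auto
    have "q^(n-2) * (q\<^sup>2 * (1 + p + p\<^sup>2)) \<le> p^(n-2) * (p\<^sup>2 * (1 + q + q\<^sup>2))"
      by (rule mult_mono[OF 1]) (use assms in auto)
    moreover have "x^(n-2) * x\<^sup>2 = x^n" for x :: real
    proof -
      have "n = n - 2 + 2" using step by simp
      then show ?thesis by (metis power_add)
    qed
    ultimately show "q^n * (1 + p + p\<^sup>2) \<le> p^n * (1 + q + q\<^sup>2)"
      by (metis mult.assoc)
  qed (use assms in auto)
  ultimately have "(q^n * (1 - q)) * (1 + p + p\<^sup>2) \<le> (p^n * (p - 1)) * (1 + p + p\<^sup>2)"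
    by (simp add: mult_ac)
  moreover have "1 + p + p\<^sup>2 > 0" using assms by (simp add: add_pos_nonneg)
  ultimately have "q^n * (1 - q) \<le> p^n * (p - 1)" by simp
  then show ?case using step by (simp add: algebra_simps)
qed (use assms in auto)

section \<open>Cotangent and tangent bounds\<close>

lemma sin_ge_x_cos: "0 \<le> x \<Longrightarrow> x \<le> pi \<Longrightarrow> x * cos x \<le> sin x" for x :: real
proof -
  assume x: "0 \<le> x" "x \<le> pi"
  have "0 \<le> sin x - x * cos x"
    using x by (intro nonneg_from_deriv[of 0 x "\<lambda>x. sin x - x * cos x" "\<lambda>x. x * sin x"])
       (auto intro!: derivative_eq_intros sin_ge_zero mult_nonneg_nonneg)
  then show ?thesis by simp
qed

text \<open>This and the two lemmas after it bound
  \<open>x * cot x = 1 - x^2 / 3 - x^4 / 45 - ...\<close>. Multiplying by \<open>sin x\<close> keeps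
  the derivatives elementary and spares an exception at \<open>0\<close>.\<close>

lemma x_cos_le:
  fixes x :: real
  assumes x: "0 \<le> x" "x \<le> pi"
  shows "x * cos x \<le> sin x * (1 - x\<^sup>2 / 3)"
proof -
  have "0 \<le> sin x * (1 - x\<^sup>2 / 3) - x * cos x"
  proof (rule nonneg_from_deriv[of 0 x "\<lambda>x. sin x * (1 - x\<^sup>2 / 3) - x * cos x"
    "\<lambda>x. x / 3 * (sin x - x * cos x)"])
    show "0 \<le> y / 3 * (sin y - y * cos y)" if "0 \<le> y" "y \<le> x" for y
      using that x sin_ge_x_cos[of y] by (intro mult_nonneg_nonneg) auto
  qed (use x in \<open>auto intro!: derivative_eq_intros simp: field_simps power2_eq_square\<close>)
  then show ?thesis by simp
qed

lemma x_cos_ge_quadratic: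
  fixes x :: real
  assumes x: "0 \<le> x" "x \<le> pi / 2"
  shows "x * cos x \<ge> sin x * (1 - x\<^sup>2 / 2)"
proof -
  have "0 \<le> x * cos x - sin x * (1 - x\<^sup>2 / 2)"
    using x
    by (intro nonneg_from_deriv[of 0 x "\<lambda>x. x * cos x - sin x * (1 - x\<^sup>2 / 2)" "\<lambda>x. x\<^sup>2 / 2 * cos x"])
       (auto intro!: derivative_eq_intros mult_nonneg_nonneg cos_ge_zero simp: field_simps power2_eq_square)
  then show ?thesis by simp
qed

lemma x_cos_ge_quartic:
  fixes x :: real
  assumes x: "0 \<le> x" "x \<le> pi / 2"
  shows "x * cos x \<ge> sin x * (1 - x\<^sup>2 / 3 - x^4 / 20)"
proof -
  have d: "x / 3 * (x * cos x - sin x) + x^3 / 20 * (x * cos x + 4 * sin x) \<ge> 0" if "0 \<le> x"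
    "x \<le> pi / 2" for x :: real
  proof -
    have "0 \<le> x * cos x - sin x + x^3 / 3"
    proof (rule nonneg_from_deriv[of 0 x "\<lambda>x. x * cos x - sin x + x^3 / 3" "\<lambda>x. x * (x - sin x)"])
      show "((\<lambda>x. x * cos x - sin x + x^3 / 3) has_real_derivative y * (y - sin y)) (at y)" for y :: real
        by (auto intro!: derivative_eq_intros simp: algebra_simps power2_eq_square)
    qed (use that sin_x_le_x in auto)
    then have 1: "x / 3 * (x * cos x - sin x) \<ge> x / 3 * (- (x^3 / 3))"
      using that by (intro mult_left_mono) auto
    have "x\<^sup>2 \<le> (1.5708)\<^sup>2" using that pi_bounds by (intro power_mono) auto
    then have "x * x\<^sup>2 / 6 \<le> x * (0.4113)" using that mult_left_mono[of "x\<^sup>2" "(1.5708)\<^sup>2" x]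
      by (simp add: power2_eq_square)
    then have "sin x \<ge> 58/100 * x" using sin_ge_poly3[of x] that by (simp add: power3_eq_cube power2_eq_square)
    moreover have "x * cos x \<ge> 0" using that by (intro mult_nonneg_nonneg cos_ge_zero) auto
    \<comment> \<open>The factor \<open>20/9\<close> turns the second summand of the derivative into
      \<open>x^4 / 9\<close>, which exactly compensates the bound \<open>- x^4 / 9\<close> for the
      first.\<close>
    ultimately have "x * cos x + 4 * sin x \<ge> 20/9 * x" using that by linarith
    then have "x^3 / 20 * (x * cos x + 4 * sin x) \<ge> x^3 / 20 * (20/9 * x)"
      using that by (intro mult_left_mono) auto
    with 1 show ?thesis by (simp add: power3_eq_cube)
  qed
  have "0 \<le> x * cos x - sin x * (1 - x\<^sup>2 / 3 - x^4 / 20)"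
    using x d
    by (intro nonneg_from_deriv[of 0 x "\<lambda>x. x * cos x - sin x * (1 - x\<^sup>2 / 3 - x^4 / 20)"
          "\<lambda>x. x / 3 * (x * cos x - sin x) + x^3 / 20 * (x * cos x + 4 * sin x)"])
       (auto intro!: derivative_eq_intros simp: field_simps eval_nat_numeral)
  then show ?thesis by simp
qed

lemma tan_ge_poly3:
  fixes x :: real
  assumes x: "0 \<le> x" "x < pi / 2"
  shows "tan x \<ge> x + x^3 / 3"
proof -
  have tan_ge: "tan x \<ge> x" if "0 \<le> x" "x < pi / 2" for x :: real
    using sin_ge_x_cos[of x] that cos_gt_zero_pi[of x] by (simp add: tan_def field_simps)
  have "0 \<le> tan x - x - x^3 / 3"
  proof (rule nonneg_from_deriv[of 0 x "\<lambda>x. tan x - x - x^3 / 3" "\<lambda>x. (tan x)\<^sup>2 - x\<^sup>2"])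
    fix y assume y: "0 \<le> y" "y \<le> x"
    have c: "cos y \<noteq> 0" using x y cos_gt_zero_pi[of y] by auto
    show "((\<lambda>x. tan x - x - x^3 / 3) has_real_derivative (tan y)\<^sup>2 - y\<^sup>2) (at y)"
    proof -
      have "inverse ((cos y)\<^sup>2) = 1 + (tan y)\<^sup>2" using tan_sec[OF c] by (simp add: power_inverse)
      then show ?thesis using c by (auto intro!: derivative_eq_intros)
    qed
    show "0 \<le> (tan y)\<^sup>2 - y\<^sup>2" using tan_ge[of y] x y by (simp add: power_mono)
  qed (use x in auto)
  then show ?thesis by simp
qed

section \<open>Smoothing with the Beurling majorant\<close>

text \<open>The coefficient of the odd part of Beurling's majorant on the frequency side. The pole
  \<open>1 / (pi * s)\<close> at \<open>0\<close> reproduces the jump of the sign function; at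
  \<open>s = 1\<close> there is a zero of second order, visible in the form given by
  \<open>kern_eq\<close>.\<close>

definition kern :: "real \<Rightarrow> real" where
  "kern s = (1 - s) * cot (pi * s) + 1 / pi"

lemma kern_eq:
  assumes "0 < s" "s < 1"
  defines "w \<equiv> pi * (1 - s)"
  shows "kern s = (1 - w * cot w) / pi"
proof -
  have "cot (pi * s) = - cot w"
    by (simp add: w_def right_diff_distrib cot_def sin_diff cos_diff)
  then show ?thesis by (simp add: kern_def w_def field_simps)
qed

lemma x_cot_bounds:
  assumes "0 < x" "x < pi"
  shows "x * cot x \<le> 1 - x\<^sup>2 / 3"
    and "x \<le> pi / 2 \<Longrightarrow> x * cot x \<ge> 1 - x\<^sup>2 / 2"
    and "x \<le> pi / 2 \<Longrightarrow> x * cot x \<ge> 1 - x\<^sup>2 / 3 - x^4 / 20"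
    and "x \<le> pi / 2 \<Longrightarrow> x * cot x \<ge> 0"
proof -
  have s: "sin x > 0" using assms by (intro sin_gt_zero) auto
  show "x * cot x \<le> 1 - x\<^sup>2 / 3" using x_cos_le[of x] assms s by (simp add: cot_def divide_le_eq mult.commute)
  assume "x \<le> pi / 2"
  with x_cos_ge_quadratic[of x] x_cos_ge_quartic[of x] assms s cos_ge_zero[of x]
  show "x * cot x \<ge> 1 - x\<^sup>2 / 2" "x * cot x \<ge> 1 - x\<^sup>2 / 3 - x^4 / 20" "x * cot x \<ge> 0"
    by (simp_all add: cot_def le_divide_eq mult.commute)
qed

lemma kern_ge:
  assumes "0 < s" "s < 1"
  shows "kern s \<ge> pi * (1 - s)\<^sup>2 / 3"
  using x_cot_bounds(1)[of "pi * (1 - s)"] assms by (simp add: kern_eq field_simps power2_eq_square)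

lemma kern_nonneg: "0 < s \<Longrightarrow> s < 1 \<Longrightarrow> kern s \<ge> 0"
  using kern_ge[of s] by (smt (verit) divide_nonneg_nonneg mult_nonneg_nonneg pi_ge_zero zero_le_power2)

lemma kern_mult_le:
  assumes "0 < s" "s < 1"
  shows "pi * s * kern s \<le> 1 - (1 - s) * (pi * s)\<^sup>2 / 3"
proof -
  have "pi * s * kern s = (1 - s) * (pi * s * cot (pi * s)) + s"
    by (simp add: kern_def field_simps)
  also have "\<dots> \<le> (1 - s) * (1 - (pi * s)\<^sup>2 / 3) + s"
    using x_cot_bounds(1)[of "pi * s"] assms by (intro add_right_mono mult_left_mono) auto
  finally show ?thesis by (simp add: algebra_simps)
qed

lemma kern_le:
  assumes "0 < s" "s < 1"
  shows "kern s \<le> 1 / (pi * s)"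
proof -
  have "0 \<le> (1 - s) * (pi * s)\<^sup>2 / 3" using assms by simp
  then have "pi * s * kern s \<le> 1" using kern_mult_le[OF assms] by linarith
  then show ?thesis using assms by (simp add: field_simps)
qed

text \<open>Compares \<open>kern\<close> with the kernel \<open>1 / (pi * s)\<close> of the exact
  inversion formula for a distribution function. The slope \<open>pi / 3\<close> is the true one at
  \<open>s = 0\<close>; for \<open>s > 1/2\<close> the defect is not small and the lower bound
  \<open>kern_ge\<close> is enough.\<close>

lemma kern_defect_le:
  assumes "0 < s" "s < 1"
  shows "1 / (pi * s) - kern s \<le> pi * s / 3"
proof (cases "s \<le> 1/2")
  case True
  define w where "w = pi * s"
  have w: "0 < w" "w < pi" "w \<le> pi / 2" using assms True by (auto simp: w_def)
  have "w * kern s = (1 - s) * (w * cot w) + s" by (simp add: w_def kern_def field_simps)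
  moreover have "(1 - s) * (w * cot w) \<ge> (1 - s) * (1 - w\<^sup>2 / 3 - w^4 / 20)"
    using x_cot_bounds(3)[OF w] assms by (intro mult_left_mono) auto
  ultimately have 1: "1 - w * kern s \<le> (1 - s) * (w\<^sup>2 / 3 + w^4 / 20)" by (simp add: algebra_simps)
  have "pi\<^sup>2 \<le> 3.1416\<^sup>2" using pi_bounds by (intro power_mono) auto
  moreover have "s * (1 - s) \<le> 1 / 4" using zero_le_power2[of "s - 1/2"]
    by (simp add: power2_eq_square algebra_simps)
  moreover have "0 \<le> s * (1 - s)" using assms by simp
  ultimately have "pi\<^sup>2 * (s * (1 - s)) \<le> 3.1416\<^sup>2 * (1/4)" by (intro mult_mono) auto
  then have "s * (pi\<^sup>2 * (s * (1 - s))) / 20 \<le> s / 3"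
    using assms mult_left_mono[of "pi\<^sup>2 * (s * (1 - s))" "20/3" s] by (simp add: power2_eq_square)
  then have "(1 - s) * (1/3 + w\<^sup>2 / 20) \<le> 1/3" by (simp add: w_def field_simps power2_eq_square)
  then have "w\<^sup>2 * ((1 - s) * (1/3 + w\<^sup>2 / 20)) \<le> w\<^sup>2 * (1/3)" by (intro mult_left_mono) auto
  moreover have "w\<^sup>2 * ((1 - s) * (1/3 + w\<^sup>2 / 20)) = (1 - s) * (w\<^sup>2 / 3 + w^4 / 20)"
    by (simp add: field_simps eval_nat_numeral)
  ultimately have "1 - w * kern s \<le> w\<^sup>2 / 3" using 1 by linarith
  then have "w * (1 / w - kern s) \<le> w * (w / 3)" using w by (simp add: algebra_simps power2_eq_square)
  then have "1 / w - kern s \<le> w / 3" using w(1) mult_le_cancel_left_pos by blast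
  then show ?thesis by (simp add: w_def)
next
  case False
  have k: "kern s \<ge> pi * (1 - s)\<^sup>2 / 3" by (rule kern_ge[OF assms])
  have "1 / pi \<le> pi * (s * (s + (1 - s)\<^sup>2) / 3)"
  proof -
    have "s * (s + (1 - s)\<^sup>2) \<ge> 1/2 * (3/4)"
      using False assms zero_le_power2[of "s - 1/2"] by (intro mult_mono) (auto simp: power2_eq_square
        algebra_simps)
    then have "pi * pi * (s * (s + (1 - s)\<^sup>2) / 3) \<ge> 3 * 3 * (1/8)"
      using pi_bounds by (intro mult_mono) auto
    then show ?thesis by (simp add: field_simps)
  qed
  then have "1 / pi / s \<le> pi * (s * (s + (1 - s)\<^sup>2) / 3) / s" using assms by (intro divide_right_mono) auto
  also have "\<dots> = pi * s / 3 + pi * (1 - s)\<^sup>2 / 3" using assms by (simp add: field_simps)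
  finally show ?thesis using k by simp
qed

text \<open>Relative to the pole, the modulus of the kernel is at most four percent too large on
  this half. The loss reappears as \<open>0.052 = 1.04 / 20\<close> in
  \<open>maj_le_1\<close>.\<close>

lemma kern_norm_le_1:
  assumes "0 < s" "s \<le> 1/2"
  shows "sqrt ((1 - s)\<^sup>2 + (kern s)\<^sup>2) \<le> 1.04 / (pi * s)"
proof -
  define A where "A = (pi * s)\<^sup>2 * (1 - s)"
  have k: "0 \<le> pi * s * kern s" using kern_nonneg[of s] assms by simp
  have "pi * s * kern s \<le> 1 - A / 3" using kern_mult_le[of s] assms by (simp add: A_def mult_ac)
  then have "(pi * s * kern s)\<^sup>2 \<le> (1 - A / 3)\<^sup>2" using k by (intro power_mono) auto
  moreover have "(pi * s)\<^sup>2 * ((1 - s)\<^sup>2 + (kern s)\<^sup>2) = A * (1 - s) + (pi * s * kern s)\<^sup>2"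
    by (simp add: A_def power2_eq_square algebra_simps)
  ultimately have "(pi * s)\<^sup>2 * ((1 - s)\<^sup>2 + (kern s)\<^sup>2) \<le> (1 - A/3)\<^sup>2 + A * (1 - s)" by linarith
  also have "\<dots> = 1 + A * (1/3 - s) + A\<^sup>2 / 9" by (simp add: power2_eq_square field_simps)
  also have "\<dots> \<le> 1.04\<^sup>2"
  proof -
    \<comment> \<open>The squared modulus exceeds \<open>1\<close> by at most
      \<open>A * (1/3 - s + A / 9)\<close>. On \<open>[a, b]\<close> the number \<open>B\<close>
      bounds \<open>A\<close>, since \<open>s^2 * (1 - s)\<close> increases there;
      \<open>9.8697\<close> bounds \<open>pi^2\<close>, and
      \<open>0.08 < 1.04^2 - 1\<close>.\<close>
    have step: ?thesis if "a \<le> s" "s \<le> b" "0 \<le> a" "b \<le> 1/2" "0 \<le> 1/3 - a + B / 9"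
      "9.8697 * b\<^sup>2 * (1 - b) \<le> B" "B * (1/3 - a + B / 9) \<le> 0.08" for a b B
    proof -
      have pi2: "pi\<^sup>2 \<le> 9.8697" using pi_bounds mult_mono[of pi "3.1416" pi "3.1416"]
        by (simp add: power2_eq_square)
      have "s\<^sup>2 * (1 - s) \<le> b\<^sup>2 * (1 - b)"
      proof -
        have "0 \<le> b\<^sup>2 * (1 - b) - s\<^sup>2 * (1 - s)"
        proof (rule nonneg_from_deriv[of s b "\<lambda>x. x\<^sup>2 * (1 - x) - s\<^sup>2 * (1 - s)" "\<lambda>x. x * (2 - 3 * x)"])
          show "0 \<le> y * (2 - 3 * y)" if "s \<le> y" "y \<le> b" for y
            using that assms \<open>b \<le> 1/2\<close> by (intro mult_nonneg_nonneg) auto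
        qed (use that in \<open>auto intro!: derivative_eq_intros simp: algebra_simps power2_eq_square\<close>)
        then show ?thesis by simp
      qed
      then have "pi\<^sup>2 * (s\<^sup>2 * (1 - s)) \<le> 9.8697 * (b\<^sup>2 * (1 - b))"
        by (rule mult_mono[OF pi2]) (use assms in auto)
      then have AB: "A \<le> B" using that by (simp add: A_def power_mult_distrib mult_ac)
      have A0: "0 \<le> A" using assms by (simp add: A_def)
      have "A * (1/3 - s + A / 9) \<le> A * (1/3 - a + B / 9)" using that A0 AB by (intro mult_left_mono) auto
      also have "\<dots> \<le> B * (1/3 - a + B / 9)" using that AB by (intro mult_right_mono) auto
      finally show ?thesis using that by (simp add: power2_eq_square algebra_simps)
    qed
    consider "s \<le> 0.15" | "0.15 \<le> s" "s \<le> 0.2" | "0.2 \<le> s" "s \<le> 0.24" | "0.24 \<le> s" "s \<le> 0.26"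
      | "0.26 \<le> s" "s \<le> 0.28" | "0.28 \<le> s" "s \<le> 0.3" | "0.3 \<le> s" "s \<le> 0.32" | "0.32 \<le> s" "s \<le> 0.34"
      | "0.34 \<le> s" "s \<le> 0.37" | "0.37 \<le> s" "s \<le> 0.41" | "0.41 \<le> s"
      by linarith
    then show ?thesis
    proof cases
      case 1 show ?thesis by (rule step[of "0" "0.15" "0.1888"]) (use 1 assms in \<open>auto simp: power2_eq_square\<close>)
    next
      case 2 show ?thesis by (rule step[of "0.15" "0.2" "0.3159"]) (use 2 assms in \<open>auto simp:
        power2_eq_square\<close>)
    next
      case 3 show ?thesis by (rule step[of "0.2" "0.24" "0.4321"]) (use 3 assms in \<open>auto simp:
        power2_eq_square\<close>)
    next
      case 4 show ?thesis by (rule step[of "0.24" "0.26"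
        "0.4938"]) (use 4 assms in \<open>auto simp: power2_eq_square\<close>)
    next
      case 5 show ?thesis by (rule step[of "0.26" "0.28"
        "0.5572"]) (use 5 assms in \<open>auto simp: power2_eq_square\<close>)
    next
      case 6 show ?thesis by (rule step[of "0.28" "0.3" "0.6218"]) (use 6 assms in \<open>auto simp:
        power2_eq_square\<close>)
    next
      case 7 show ?thesis by (rule step[of "0.3" "0.32" "0.6873"]) (use 7 assms in \<open>auto simp:
        power2_eq_square\<close>)
    next
      case 8 show ?thesis by (rule step[of "0.32" "0.34"
        "0.7531"]) (use 8 assms in \<open>auto simp: power2_eq_square\<close>)
    next
      case 9 show ?thesis by (rule step[of "0.34" "0.37"
        "0.8513"]) (use 9 assms in \<open>auto simp: power2_eq_square\<close>)
    next
      case 10 show ?thesis by (rule step[of "0.37" "0.41"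
        "0.9789"]) (use 10 assms in \<open>auto simp: power2_eq_square\<close>)
    next
      case 11 show ?thesis by (rule step[of "0.41" "0.5"
        "1.2338"]) (use 11 assms in \<open>auto simp: power2_eq_square\<close>)
    qed
  qed
  finally have "(pi * s * sqrt ((1 - s)\<^sup>2 + (kern s)\<^sup>2))\<^sup>2 \<le> 1.04\<^sup>2"
    by (simp add: power_mult_distrib)
  then have "pi * s * sqrt ((1 - s)\<^sup>2 + (kern s)\<^sup>2) \<le> 1.04" by (rule power2_le_imp_le) simp
  then show ?thesis using assms by (simp add: field_simps)
qed

text \<open>The second form is chosen because \<open>tan w\<close> and \<open>sin w\<close> times
  \<open>cos w ^ n\<close> have elementary primitives. With \<open>tan w >= w + w^3 / 3\<close> and
  \<open>sin w >= w - w^3 / 6\<close>, the weights \<open>7/12\<close> and \<open>5/12\<close> are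
  those that reproduce \<open>w + w^3 / 8\<close>.\<close>

lemma kern_norm_le_2:
  assumes "1/2 \<le> s" "s < 1"
  defines "w \<equiv> pi * (1 - s)"
  shows "pi * sqrt ((1 - s)\<^sup>2 + (kern s)\<^sup>2) \<le> w + w^3 / 8"
    and "s > 1/2 \<Longrightarrow> pi * sqrt ((1 - s)\<^sup>2 + (kern s)\<^sup>2) \<le> 7/12 * tan w + 5/12 * sin w"
proof -
  have w: "0 < w" "w < pi" "w \<le> pi / 2" using assms by (auto simp: w_def field_simps)
  have k0: "0 \<le> pi * kern s" using kern_nonneg[of s] assms(1,2) by simp
  have "pi * kern s = 1 - w * cot w" using kern_eq[of s] assms by (simp add: w_def)
  then have k: "pi * kern s \<le> w\<^sup>2 / 2" "0 \<le> pi * kern s"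
    using x_cot_bounds(2)[OF w] k0 by auto
  have "(pi * sqrt ((1 - s)\<^sup>2 + (kern s)\<^sup>2))\<^sup>2 = w\<^sup>2 + (pi * kern s)\<^sup>2"
    by (simp add: w_def power_mult_distrib distrib_left)
  also have "\<dots> \<le> w\<^sup>2 + (w\<^sup>2 / 2)\<^sup>2" using k by (intro add_left_mono power_mono) auto
  also have "\<dots> \<le> (w + w^3 / 8)\<^sup>2" using w by (simp add: power2_eq_square power3_eq_cube algebra_simps)
  finally show 1: "pi * sqrt ((1 - s)\<^sup>2 + (kern s)\<^sup>2) \<le> w + w^3 / 8"
    by (rule power2_le_imp_le) (use w in auto)
  assume "s > 1/2"
  then have "w < pi / 2" by (simp add: w_def field_simps)
  then have "tan w \<ge> w + w^3 / 3" "sin w \<ge> w - w^3 / 6" using w tan_ge_poly3 sin_ge_poly3 by auto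
  with 1 show "pi * sqrt ((1 - s)\<^sup>2 + (kern s)\<^sup>2) \<le> 7/12 * tan w + 5/12 * sin w" by (simp add: field_simps)
qed

lemma kern_measurable [measurable]: "kern \<in> borel_measurable borel"
  unfolding kern_def[abs_def] cot_def by measurable

text \<open>The Fourier integrand of the majorant, folded from \<open>(-1, 1)\<close> to
  \<open>(0, 1)\<close>: an even part with the Fejer weight \<open>1 - s\<close> and an odd part
  with \<open>kern\<close>.\<close>

definition pker :: "real \<Rightarrow> real \<Rightarrow> real" where
  "pker \<theta> s = (1 - s) * cos (s * \<theta>) + kern s * sin (s * \<theta>)"

lemma pker_measurable [measurable (raw)]:
  assumes [measurable]: "f \<in> borel_measurable N" "g \<in> borel_measurable N"
  shows "(\<lambda>x. pker (f x) (g x)) \<in> borel_measurable N"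
  unfolding pker_def by measurable

lemma abs_kern_sin_le:
  assumes "0 < s" "s < 1"
  shows "\<bar>kern s * sin (s * \<theta>)\<bar> \<le> \<bar>\<theta>\<bar> / pi"
proof -
  have "\<bar>kern s * sin (s * \<theta>)\<bar> \<le> 1 / (pi * s) * \<bar>s * \<theta>\<bar>"
    unfolding abs_mult[of "kern s"]
    using kern_nonneg[OF assms] kern_le[OF assms] assms by (intro mult_mono abs_sin_x_le_abs_x) auto
  then show ?thesis using assms by (simp add: abs_mult)
qed

lemma abs_pker_le:
  assumes "0 < s" "s < 1"
  shows "\<bar>pker \<theta> s\<bar> \<le> 1 + \<bar>\<theta>\<bar> / pi"
proof -
  have "\<bar>(1 - s) * cos (s * \<theta>)\<bar> \<le> 1 * 1"
    unfolding abs_mult using assms by (intro mult_mono) auto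
  then show ?thesis using abs_kern_sin_le[OF assms, of \<theta>] unfolding pker_def by linarith
qed

section \<open>Integrals over the unit interval and the majorant property\<close>

lemma set_integrable_unit_bounded:
  fixes f :: "real \<Rightarrow> real"
  assumes [measurable]: "f \<in> borel_measurable borel" and "\<And>s. 0 < s \<Longrightarrow> s < 1 \<Longrightarrow> \<bar>f s\<bar> \<le> B"
  shows "set_integrable lborel {0<..<1} f"
  unfolding set_integrable_def
  by (rule integrableI_bounded_set[where A="{0<..<1}" and B=B])
     (use assms(2) in \<open>auto simp: indicator_def intro!: AE_I2\<close>)

lemma set_integrable_pker: "set_integrable lborel {0<..<1} (pker \<theta>)"
  by (rule set_integrable_unit_bounded[of _ "1 + \<bar>\<theta>\<bar> / pi"]) (auto intro: abs_pker_le)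

text \<open>Up to the factor 2 this is Beurling's majorant of the sign function, which has its Fourier transform
  supported in a bounded interval.\<close>
definition beurling :: "real \<Rightarrow> real" where
  "beurling y = (LBINT s:{0<..<1}. pker (2 * pi * y) s)"

lemma unit_integral_FTC:
  fixes F f :: "real \<Rightarrow> real"
  assumes "continuous_on {0..1} f" "\<And>x. 0 \<le> x \<Longrightarrow> x \<le> 1 \<Longrightarrow> (F has_real_derivative f x) (at x)"
  shows "set_integrable lborel {0<..<1} f" "(LBINT s:{0<..<1}. f s) = F 1 - F 0"
proof -
  have "(LBINT s=ereal 0..ereal 1. f s) = F 1 - F 0"
    using assms
    by (intro interval_integral_FTC_finite)
       (auto simp flip: has_real_derivative_iff_has_vector_derivative intro: has_field_derivative_at_within)
  then show "(LBINT s:{0<..<1}. f s) = F 1 - F 0" by (simp add: interval_integral_Ioo)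
  have "set_integrable lborel {0..1} f" by (intro borel_integrable_atLeastAtMost' assms)
  then show "set_integrable lborel {0<..<1} f" by (rule set_integrable_subset) auto
qed

lemma unit_integral_sin: "(LBINT s:{0<..<1}. sin (2 * pi * s * z)) = (if z
  = 0 then 0 else (sin (pi * z))\<^sup>2 / (pi * z))"
  and set_integrable_unit_sin: "set_integrable lborel {0<..<1} (\<lambda>s. sin (2 * pi * s * z))"
proof -
  show "set_integrable lborel {0<..<1} (\<lambda>s. sin (2 * pi * s * z))"
    by (rule set_integrable_unit_bounded[of _ 1]) auto
  show "(LBINT s:{0<..<1}. sin (2 * pi * s * z)) = (if z = 0 then 0 else (sin (pi * z))\<^sup>2 / (pi * z))"
  proof (cases "z = 0")
    case False
    have "(LBINT s:{0<..<1}. sin (2 * pi * s * z)) = - cos (2 * pi * 1 * z) / (2 * pi * z) -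
      - cos (2 * pi * 0 * z) / (2 * pi * z)"
      using False
      by (intro unit_integral_FTC[of _ "\<lambda>s. - cos (2 * pi * s * z) / (2 * pi * z)"])
         (auto intro!: derivative_eq_intros continuous_intros)
    then show ?thesis using False cos_double_sin[of "pi * z"] by (simp add: field_simps)
  qed simp
qed

lemma unit_integral_fejer: "(LBINT s:{0<..<1}. (1 - s) * cos (2 * pi * s * z)) = (if z
  = 0 then 1 / 2 else (sin (pi * z))\<^sup>2 / (2 * (pi * z)\<^sup>2))"
  and set_integrable_unit_fejer: "set_integrable lborel {0<..<1} (\<lambda>s. (1 - s) * cos (2 * pi * s * z))"
proof -
  have "\<bar>(1 - s) * cos (2 * pi * s * z)\<bar> \<le> 1 * 1" if "0 < s" "s < 1" for s
    unfolding abs_mult using that by (intro mult_mono) auto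
  then show "set_integrable lborel {0<..<1} (\<lambda>s. (1 - s) * cos (2 * pi * s * z))"
    by (intro set_integrable_unit_bounded[of _ 1]) auto
  show "(LBINT s:{0<..<1}. (1 - s) * cos (2 * pi * s * z)) = (if z
    = 0 then 1 / 2 else (sin (pi * z))\<^sup>2 / (2 * (pi * z)\<^sup>2))"
  proof (cases "z = 0")
    case False
    define a where "a = 2 * pi * z"
    have a: "a \<noteq> 0" using False by (simp add: a_def)
    have "(LBINT s:{0<..<1}. (1 - s) * cos (s * a)) = ((1 - 1) * sin (1 * a) / a - cos (1 * a) / a\<^sup>2) - ((1
      - 0) * sin (0 * a) / a - cos (0 * a) / a\<^sup>2)"
      using a
      by (intro unit_integral_FTC[of _ "\<lambda>s. (1 - s) * sin (s * a) / a - cos (s * a) / a\<^sup>2"])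
         (auto intro!: derivative_eq_intros continuous_intros simp: field_simps power2_eq_square)
    then show ?thesis using False cos_double_sin[of "pi * z"] by (simp add: field_simps a_def power2_eq_square)
  next
    case True
    have "(LBINT s:{0<..<1}. 1 - s) = (1 - 1\<^sup>2 / 2) - (0 - 0\<^sup>2 / 2 :: real)"
      by (intro unit_integral_FTC[of _ "\<lambda>s. s - s\<^sup>2 / 2"]) (auto intro!: derivative_eq_intros continuous_intros)
    then show ?thesis using True by simp
  qed
qed

text \<open>A unit shift changes the phase by \<open>2 * pi * s\<close>, and for phases with this
  difference \<open>cot (pi * s) * (sin a - sin b) = cos a + cos b\<close>. The singular cotangent
  disappears and only elementary integrals remain.\<close>

lemma beurling_step:
  "beurling (y + 1) - beurling y = 2 * (LBINT s:{0<..<1}. (1 - s) * cos (2 * pi * s * (y + 1)))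
     + ((LBINT s:{0<..<1}. sin (2 * pi * s * (y + 1))) - (LBINT s:{0<..<1}. sin (2 * pi * s * y))) / pi"
proof -
  have pt: "pker (2 * pi * (y + 1)) s - pker (2 * pi * y) s
      = 2 * ((1 - s) * cos (2 * pi * s * (y + 1))) + (sin (2 * pi * s * (y + 1)) - sin (2 * pi * s * y)) / pi"
    if "0 < s" "s < 1" for s
  proof -
    define a b where "a = s * (2 * pi * (y + 1))" and "b = s * (2 * pi * y)"
    have s: "sin (pi * s) \<noteq> 0" using that sin_gt_zero[of "pi * s"] by simp
    have "sin a - sin b = 2 * sin (pi * s) * cos ((a + b) / 2)"
      unfolding sin_diff_sin a_def b_def by (simp add: field_simps)
    moreover have "cos a + cos b = 2 * cos ((a + b) / 2) * cos (pi * s)"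
      unfolding cos_plus_cos a_def b_def by (simp add: field_simps)
    ultimately have cot: "cot (pi * s) * (sin a - sin b) = cos a + cos b"
      using s by (simp add: cot_def)
    define q where "q = (sin a - sin b) / pi"
    have "kern s * (sin a - sin b) = (1 - s) * (cot (pi * s) * (sin a - sin b)) + q"
      by (simp add: kern_def q_def add_divide_distrib distrib_right)
    also have "\<dots> = (1 - s) * (cos a + cos b) + q" by (simp only: cot)
    finally have "kern s * (sin a - sin b) = (1 - s) * (cos a + cos b) + q" .
    moreover have "2 * pi * s * (y + 1) = a" "2 * pi * s * y = b" by (simp_all add: a_def b_def)
    ultimately show ?thesis unfolding pker_def a_def[symmetric] b_def[symmetric]
      by (simp add: algebra_simps flip: q_def)
  qed
  have "beurling (y + 1) - beurling y = (LBINT s:{0<..<1}. pker (2 * pi * (y + 1)) s - pker (2 * pi * y) s)"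
    unfolding beurling_def by (rule set_integral_diff(2)[symmetric]) (rule set_integrable_pker)+
  also have "\<dots> = (LBINT s:{0<..<1}. 2 * ((1 - s) * cos (2 * pi * s * (y + 1))) + (sin (2 * pi * s * (y + 1))
    - sin (2 * pi * s * y)) / pi)"
    by (rule set_lebesgue_integral_cong) (auto simp: pt)
  also have "\<dots> = 2 * (LBINT s:{0<..<1}. (1 - s) * cos (2 * pi * s * (y + 1)))
     + ((LBINT s:{0<..<1}. sin (2 * pi * s * (y + 1))) - (LBINT s:{0<..<1}. sin (2 * pi * s * y))) / pi"
    by (subst set_integral_add(2))
       (auto intro!: set_integrable_unit_fejer set_integrable_unit_sin set_integral_diff(1) simp:
         set_integral_diff(2) set_integrable_unit_sin)
  finally show ?thesis .
qed

lemma beurling_step':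
  assumes "y \<noteq> 0" "y \<noteq> -1"
  shows "beurling (y + 1) - beurling y = - (sin (pi * y))\<^sup>2 / (pi\<^sup>2 * (y * (y + 1)\<^sup>2))"
proof -
  define S where "S = (sin (pi * y))\<^sup>2"
  have S: "(sin (pi * (y + 1)))\<^sup>2 = S" by (simp add: distrib_left sin_add S_def)
  define z where "z = y + 1"
  have z: "y + 1 \<noteq> 0" using assms by (simp add: add_eq_0_iff)
  have "beurling (y + 1) - beurling y = 2 * (S / (2 * (pi * (y + 1))\<^sup>2)) + (S / (pi * (y + 1))
    - S / (pi * y)) / pi"
    using assms z by (simp add: beurling_step unit_integral_fejer unit_integral_sin S S_def[symmetric])
  also have "\<dots> = S * (1 / (pi * (y + 1))\<^sup>2 + 1 / (pi\<^sup>2 * (y + 1)) - 1 / (pi\<^sup>2 * y))"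
    unfolding z_def[symmetric]
    by (simp add: diff_divide_distrib right_diff_distrib distrib_left power2_eq_square mult_ac)
  also have "1 / (pi * (y + 1))\<^sup>2 + 1 / (pi\<^sup>2 * (y + 1)) - 1 / (pi\<^sup>2 * y) = - 1 / (pi\<^sup>2 * (y * (y + 1)\<^sup>2))"
  proof -
    have "y + 1 \<noteq> 0" using assms by (simp add: add_eq_0_iff)
    then show ?thesis using assms by (simp add: divide_simps) (simp add: algebra_simps power2_eq_square)
  qed
  finally show ?thesis by (simp add: S_def)
qed

lemma beurling_0: "beurling 0 = 1 / 2"
  using unit_integral_fejer[of 0] by (simp add: beurling_def pker_def)

lemma beurling_of_nat: "beurling (real m) = 1 / 2"
proof (induction m)
  case (Suc m)
  have "beurling (real m + 1) = beurling (real m)"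
  proof (cases "m = 0")
    case True
    then show ?thesis using beurling_step[of 0] by (simp add: unit_integral_fejer[of 1, simplified]
      unit_integral_sin[of 1, simplified])
  next
    case False
    then show ?thesis using beurling_step'[of "real m"] by simp
  qed
  then show ?case using Suc by (simp add: add.commute)
qed (simp add: beurling_0)

lemma beurling_neg_nat: "beurling (- 1 - real m) = - 1 / 2"
proof (induction m)
  case 0
  \<comment> \<open>The only integer step that is not zero: at \<open>y + 1 = 0\<close> the Fejer
    integral takes its exceptional value \<open>1 / 2\<close>, which creates the jump from
    \<open>- 1 / 2\<close> to \<open>1 / 2\<close>.\<close>
  have "beurling (-1 + 1) - beurling (-1) = 2 * (1 / 2) + (0 - (LBINT s:{0<..<1}. sin (2 * pi * s * - 1))) / pi"
    unfolding beurling_step using unit_integral_fejer[of 0] by (simp add: unit_integral_sin[of 0, simplified])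
  moreover have "(LBINT s:{0<..<1}. sin (2 * pi * s * - 1)) = 0" unfolding unit_integral_sin by simp
  ultimately show ?case using beurling_0 by simp
next
  case (Suc m)
  have "sin (pi * (- 1 - real (Suc m))) = 0"
    by (metis (no_types, opaque_lifting) minus_diff_commute mult.commute mult_minus_left of_nat_1 of_nat_add
      sin_minus sin_npi neg_0_equal_iff_equal add.commute diff_minus_eq_add minus_add_distrib
      uminus_add_conv_diff)
  then show ?case using beurling_step'[of "- 1 - real (Suc m)"] Suc by simp
qed

text \<open>Half of a monotonicity argument: away from the origin, along \<open>y + m\<close> here
  and along \<open>y - m\<close> in the next lemma, the values only decrease. Once their averages
  are known to approach the value at the integers, that value is a lower bound for
  \<open>beurling y\<close>.\<close>

lemma beurling_ge_shift:
  assumes "y \<ge> 0"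
  shows "beurling (y + real m) \<le> beurling y"
proof (induction m)
  case (Suc m)
  have "beurling (y + real m + 1) \<le> beurling (y + real m)"
  proof (cases "y + real m = 0")
    case True
    then show ?thesis using beurling_of_nat[of 1] beurling_0 by simp
  next
    case False
    then show ?thesis using beurling_step'[of "y + real m"] assms
      by (smt (verit) divide_nonneg_nonneg minus_divide_left mult_nonneg_nonneg of_nat_0_le_iff zero_le_power2)
  qed
  then show ?case using Suc by (simp add: add_ac)
qed simp

lemma beurling_ge_shift_neg:
  assumes "y < 0"
  shows "beurling (y - real m) \<le> beurling y"
proof (induction m)
  case (Suc m)
  define z where "z = y - real (Suc m)"
  have z: "z < -1" using assms by (simp add: z_def)
  have "(sin (pi * z))\<^sup>2 / (pi\<^sup>2 * (z * (z + 1)\<^sup>2)) \<le> 0"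
    using z by (intro divide_nonneg_nonpos mult_nonneg_nonpos mult_nonpos_nonneg) auto
  then have "beurling z \<le> beurling (z + 1)" using beurling_step'[of z] z by simp
  moreover have "z + 1 = y - real m" by (simp add: z_def)
  ultimately show ?case using Suc by (simp add: z_def)
qed simp

text \<open>Telescoping as for the Dirichlet kernel. What matters is that the bound does not depend
  on \<open>M\<close>.\<close>

lemma sum_cos_bound:
  fixes \<alpha> \<beta> :: real
  shows "\<bar>sin \<beta> * (\<Sum>m<M. cos (\<alpha> + 2 * real m * \<beta>))\<bar> \<le> 1"
proof -
  have "2 * sin \<beta> * (\<Sum>m<M. cos (\<alpha> + 2 * real m * \<beta>)) = sin (\<alpha> + (2 * real M - 1) * \<beta>) - sin (\<alpha> - \<beta>)"
  proof (induction M)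
    case (Suc M)
    have "2 * sin \<beta> * cos (\<alpha> + 2 * real M * \<beta>) = sin (\<alpha> + (2 * real M + 1) * \<beta>) - sin (\<alpha> + (2 * real M
      - 1) * \<beta>)"
    proof -
      have e: "(\<alpha> + (2 * real M + 1) * \<beta> - (\<alpha> + (2 * real M - 1) * \<beta>)) / 2 = \<beta>"
        "(\<alpha> + (2 * real M + 1) * \<beta> + (\<alpha> + (2 * real M - 1) * \<beta>)) / 2 = \<alpha> + 2 * real M * \<beta>"
        by (simp_all add: field_simps)
      show ?thesis unfolding sin_diff_sin e ..
    qed
    then show ?case using Suc by (simp add: distrib_left algebra_simps)
  qed simp
  moreover have "\<bar>sin (\<alpha> + (2 * real M - 1) * \<beta>) - sin (\<alpha> - \<beta>)\<bar> \<le> 2"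
    using abs_sin_le_one[of "\<alpha> + (2 * real M - 1) * \<beta>"] abs_sin_le_one[of "\<alpha> - \<beta>"] by linarith
  ultimately show ?thesis by (simp add: abs_mult)
qed

text \<open>The factor \<open>sin (pi * s * y)\<close> cancels the pole of \<open>kern\<close> at
  \<open>0\<close> and does not involve \<open>c\<close>. Hence differences at distance
  \<open>y\<close> are bounded uniformly in the base point, which provides the dominating function
  for the Cesaro means.\<close>

lemma pker_diff:
  "pker (2 * pi * (y + c)) s - pker (2 * pi * c) s
    = 2 * sin (pi * s * y) * (kern s * cos (pi * s * (2 * c + y)) - (1 - s) * sin (pi * s * (2 * c + y)))"
proof -
  define a b where "a = s * (2 * pi * (y + c))" and "b = s * (2 * pi * c)"
  have e: "(a - b) / 2 = pi * s * y" "(a + b) / 2 = pi * s * (2 * c + y)" "(b - a) / 2 = - (pi * s * y)"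
    by (simp_all add: a_def b_def field_simps)
  have 1: "sin a - sin b = 2 * sin (pi * s * y) * cos (pi * s * (2 * c + y))"
    unfolding sin_diff_sin e ..
  have 2: "cos a - cos b = - 2 * sin (pi * s * y) * sin (pi * s * (2 * c + y))"
    unfolding cos_diff_cos e by simp
  have "(1 - s) * (cos a - cos b) + kern s * (sin a - sin b)
    = 2 * sin (pi * s * y) * (kern s * cos (pi * s * (2 * c + y)) - (1 - s) * sin (pi * s * (2 * c + y)))"
    unfolding 1 2 by (simp add: algebra_simps)
  then show ?thesis unfolding pker_def a_def[symmetric] b_def[symmetric] by (simp add: algebra_simps)
qed

text \<open>The Cesaro means of \<open>beurling (y + c) - beurling c\<close> along a progression of step \<open>\<plusminus>1\<close> vanish, because the
  trigonometric sums stay bounded; this replaces the Riemann--Lebesgue lemma.\<close>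
lemma beurling_cesaro:
  assumes \<sigma>: "\<sigma> = 1 \<or> \<sigma> = (-1::real)"
  shows "(\<lambda>M. (\<Sum>m<M. beurling (y + (b + \<sigma> * real m)) - beurling (b + \<sigma> * real m)) / real M) \<longlonglongrightarrow> 0"
proof -
  define D where "D = (\<lambda>m s. pker (2 * pi * (y + (b + \<sigma> * real m))) s - pker (2 * pi * (b + \<sigma> * real m)) s)"
  define A where "A = (\<lambda>M s. (\<Sum>m<M. D m s) / real M)"
  have [measurable]: "D m \<in> borel_measurable borel" for m unfolding D_def by measurable
  have [measurable]: "A m \<in> borel_measurable borel" for m unfolding A_def by measurable
  have Dle: "\<bar>D m s\<bar> \<le> 2 * (\<bar>y\<bar> + 1)" if s: "0 < s" "s < 1" for m s
  proof -
    define u where "u = pi * s * (2 * (b + \<sigma> * real m) + y)"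
    define p q where "p = (kern s * sin (s * (pi * y))) * cos u" and "q = sin (pi * s * y) * (1 - s) * sin u"
    have "D m s = 2 * (p - q)"
      unfolding D_def pker_diff u_def p_def q_def by (simp add: algebra_simps)
    moreover have "\<bar>p\<bar> \<le> \<bar>y\<bar> * 1"
      unfolding p_def abs_mult[of _ "cos u"] using abs_kern_sin_le[OF s, of "pi * y"]
      by (intro mult_mono) (auto simp: abs_mult)
    moreover have "\<bar>q\<bar> \<le> 1 * 1 * 1"
      unfolding q_def abs_mult using s by (intro mult_mono) auto
    moreover have "\<bar>2 * (p - q)\<bar> \<le> 2 * (\<bar>p\<bar> + \<bar>q\<bar>)" using abs_triangle_ineq4[of p q] by (simp add: abs_mult)
    ultimately show ?thesis by simp
  qed
  have A0: "A M s = 0" if "M = 0" for M s using that by (simp add: A_def)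
  have Ale: "\<bar>A M s\<bar> \<le> 2 * (\<bar>y\<bar> + 1)" if s: "0 < s" "s < 1" for M s
  proof (cases "M = 0")
    case False
    have "\<bar>\<Sum>m<M. D m s\<bar> \<le> (\<Sum>m<M. 2 * (\<bar>y\<bar> + 1))"
      by (rule order_trans[OF sum_abs]) (intro sum_mono Dle s)
    then show ?thesis using False by (simp add: A_def field_simps)
  qed (simp add: A0)
  have Alim: "(\<lambda>M. A M s) \<longlonglongrightarrow> 0" if s: "0 < s" "s < 1" for s
  proof -
    define S where "S = \<bar>sin (pi * s)\<bar>"
    define C where "C = 2 * (kern s + 1) / S"
    have S: "S > 0" using s sin_gt_zero[of "pi * s"] by (simp add: S_def)
    have "\<bar>\<Sum>m<M. D m s\<bar> \<le> C" for M
    proof -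
      define \<alpha> where "\<alpha> = pi * s * (2 * b + y)"
      define \<beta> where "\<beta> = pi * s * \<sigma>"
      have S': "\<bar>sin \<beta>\<bar> = S" using \<sigma> by (auto simp: \<beta>_def S_def)
      define c1 where "c1 = (\<Sum>m<M. cos (\<alpha> + 2 * real m * \<beta>))"
      \<comment> \<open>The sine sum is written as a cosine sum with phase shifted by
        \<open>pi / 2\<close>, so that \<open>sum_cos_bound\<close> covers both sums.\<close>
      define c2 where "c2 = (\<Sum>m<M. cos (\<alpha> - pi / 2 + 2 * real m * \<beta>))"
      have "S * \<bar>c1\<bar> \<le> 1" "S * \<bar>c2\<bar> \<le> 1"
        using sum_cos_bound[of \<beta> \<alpha> M] sum_cos_bound[of \<beta> "\<alpha> - pi/2" M]
        by (simp_all add: c1_def c2_def abs_mult S')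
      then have c: "\<bar>c1\<bar> \<le> 1 / S" "\<bar>c2\<bar> \<le> 1 / S" using S by (simp_all add: field_simps)
      have "cos (\<alpha> - pi / 2 + t) = sin (\<alpha> + t)" for t
        by (simp add: cos_add cos_diff sin_add sin_diff)
      then have c2: "c2 = (\<Sum>m<M. sin (\<alpha> + 2 * real m * \<beta>))" by (simp add: c2_def)
      have "(\<Sum>m<M. D m s) = 2 * sin (pi * s * y) * (kern s * c1 - (1 - s) * c2)"
        unfolding D_def pker_diff c1_def c2 sum_distrib_left sum_subtractf[symmetric]
        by (intro sum.cong refl) (simp add: \<alpha>_def \<beta>_def algebra_simps)
      also have "\<bar>\<dots>\<bar> \<le> 2 * 1 * (kern s * (1 / S) + 1 * (1 / S))"
        unfolding abs_mult
      proof (intro mult_mono)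
        have "\<bar>kern s\<bar> * \<bar>c1\<bar> \<le> kern s * (1 / S)" "\<bar>1 - s\<bar> * \<bar>c2\<bar> \<le> 1 * (1 / S)"
          using kern_nonneg[OF s] s by (intro mult_mono c; simp)+
        then have "\<bar>kern s * c1\<bar> \<le> kern s * (1 / S)" "\<bar>(1 - s) * c2\<bar> \<le> 1 * (1 / S)"
          by (simp_all add: abs_mult)
        then show "\<bar>kern s * c1 - (1 - s) * c2\<bar> \<le> kern s * (1 / S) + 1 * (1 / S)" by linarith
      qed auto
      finally show ?thesis by (simp add: C_def algebra_simps add_divide_distrib)
    qed
    then have "\<bar>A M s\<bar> \<le> C * inverse (real M)" for M
      by (simp add: A_def divide_inverse mult_right_mono abs_mult)
    moreover have "(\<lambda>M. C * inverse (real M)) \<longlonglongrightarrow> 0"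
      by (rule tendsto_mult_right_zero[OF lim_inverse_n])
    ultimately show ?thesis
      by (intro Lim_null_comparison[of "\<lambda>M. A M s" "\<lambda>M. C * inverse (real M)"]) auto
  qed
  have "(\<lambda>M. LBINT s:{0<..<1}. A M s) \<longlonglongrightarrow> (LBINT s:{0<..<1::real}. 0)"
    unfolding set_lebesgue_integral_def
  proof (rule integral_dominated_convergence[where w="\<lambda>s. indicator {0<..<1} s *\<^sub>R (2 * (\<bar>y\<bar> + 1))"])
    show "integrable lborel (\<lambda>s. indicator {0<..<1::real} s *\<^sub>R (2 * (\<bar>y\<bar> + 1)))"
      using set_integrable_unit_bounded[of "\<lambda>_. 2 * (\<bar>y\<bar> + 1)" "2 * (\<bar>y\<bar> + 1)"]
        by (simp add: set_integrable_def)
    show "AE s in lborel. (\<lambda>M. indicator {0<..<1} s *\<^sub>R A M s) \<longlonglongrightarrow> indicator {0<..<1} s *\<^sub>R 0"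
      by (intro AE_I2) (auto simp: indicator_def intro: Alim)
    show "AE s in lborel. norm (indicator {0<..<1} s *\<^sub>R A M s) \<le> indicator {0<..<1} s *\<^sub>R (2 * (\<bar>y\<bar> + 1))" for M
      by (intro AE_I2) (auto simp: indicator_def intro: Ale[simplified])
  qed measurable
  moreover have "(LBINT s:{0<..<1}. A M s) = (\<Sum>m<M. beurling (y + (b + \<sigma> * real m)) - beurling (b
    + \<sigma> * real m)) / real M" for M
  proof -
    have "(LBINT s:{0<..<1}. A M s) = (LBINT s:{0<..<1}. (\<Sum>m<M. D m s)) / real M"
      unfolding A_def by simp
    also have "(LBINT s:{0<..<1}. (\<Sum>m<M. D m s)) = (\<Sum>m<M. LBINT s:{0<..<1}. D m s)"
      unfolding set_lebesgue_integral_def scaleR_sum_right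
      by (rule Bochner_Integration.integral_sum)
         (use set_integral_diff(1)[OF set_integrable_pker set_integrable_pker] in \<open>simp add: D_def
           set_integrable_def\<close>)
    also have "\<dots> = (\<Sum>m<M. beurling (y + (b + \<sigma> * real m)) - beurling (b + \<sigma> * real m))"
      unfolding D_def beurling_def by (intro sum.cong refl set_integral_diff(2) set_integrable_pker)
    finally show ?thesis .
  qed
  ultimately show ?thesis by simp
qed

text \<open>By monotonicity every term of the Cesaro mean is at most
  \<open>beurling y - 1 / 2\<close>, and the means tend to \<open>0\<close>.\<close>

lemma beurling_nonneg_ge:
  assumes "y \<ge> 0"
  shows "beurling y \<ge> 1 / 2"
proof -
  have "beurling y - 1 / 2 \<ge> (\<Sum>m<M. beurling (y + (0 + 1 * real m)) - beurling (0 + 1 * real m)) / real M"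
    if "M \<ge> 1" for M
  proof -
    have "(\<Sum>m<M. beurling (y + (0 + 1 * real m)) - beurling (0 + 1 * real m)) \<le> (\<Sum>m<M. beurling y - 1 / 2)"
      using beurling_ge_shift[OF assms] by (intro sum_mono) (simp add: beurling_of_nat)
    then show ?thesis using that by (simp add: field_simps)
  qed
  then have "beurling y - 1 / 2 \<ge> 0"
    by (intro LIMSEQ_le_const2[OF beurling_cesaro[of 1 y 0]]) auto
  then show ?thesis by simp
qed

lemma beurling_neg_ge:
  assumes "y < 0"
  shows "beurling y \<ge> - 1 / 2"
proof -
  \<comment> \<open>Base point \<open>- 1\<close> and distance \<open>y + 1\<close>: then
    \<open>y - m\<close> is compared with \<open>- 1 - m\<close>, where the value is
    \<open>- 1 / 2\<close>.\<close>
  have "beurling y + 1 / 2 \<ge> (\<Sum>m<M. beurling (y + 1 + (-1 + -1 * real m)) - beurling (-1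
    + -1 * real m)) / real M" if "M \<ge> 1" for M
  proof -
    have "(\<Sum>m<M. beurling (y + 1 + (-1 + -1 * real m)) - beurling (-1 + -1 * real m)) \<le> (\<Sum>m<M. beurling y
      + 1 / 2)"
      using beurling_ge_shift_neg[OF assms] beurling_neg_nat by (intro sum_mono) simp
    then show ?thesis using that by (simp add: field_simps)
  qed
  then have "beurling y + 1 / 2 \<ge> 0"
    by (intro LIMSEQ_le_const2[OF beurling_cesaro[of "-1" "y + 1" "-1"]]) auto
  then show ?thesis by simp
qed

text \<open>The indicator of \<open>S <= x\<close> is at most
  \<open>1 / 2 + beurling (T * (x - S) / (2 * pi))\<close>. Taking expectations and exchanging
  integrals leaves trigonometric moments of \<open>S\<close>; oddness removes the sine moments.
  Integrability of \<open>S\<close> pays for the linear growth of the bound on \<open>pker\<close>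
  in its first argument.\<close>

lemma (in prob_space) smoothing_inequality:
  assumes S[measurable]: "S \<in> borel_measurable M" and intS: "integrable M S"
    and odd: "\<And>t. expectation (\<lambda>\<omega>. sin (t * S \<omega>)) = 0" and T: "T > 0"
  shows "prob {\<omega> \<in> space M. S \<omega> \<le> x} - 1 / 2
    \<le> (LBINT s:{0<..<1}. pker (T * x) s * expectation (\<lambda>\<omega>. cos (s * T * S \<omega>)))"
proof -
  define g where "g = (\<lambda>(\<omega>, s). indicator {0<..<1::real} s *\<^sub>R pker (T * (x - S \<omega>)) s)"
  interpret pair_sigma_finite M lborel by unfold_locales
  have [measurable]: "g \<in> borel_measurable (M \<Otimes>\<^sub>M lborel)" unfolding g_def by measurable
  have gle: "norm (g (\<omega>, s)) \<le> indicator {0<..<1} s *\<^sub>R (1 + T * \<bar>x - S \<omega>\<bar> / pi)" for \<omega> s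
    using abs_pker_le[of s "T * (x - S \<omega>)"] T by (auto simp: g_def indicator_def abs_mult)
  have ib: "integrable lborel (\<lambda>s. indicator {0<..<1::real} s *\<^sub>R c)" for c :: real
    using set_integrable_unit_bounded[of "\<lambda>_. c" "\<bar>c\<bar>"] by (simp add: set_integrable_def)
  have int2: "integrable lborel (\<lambda>s. g (\<omega>, s))" if "\<omega> \<in> space M" for \<omega>
    using set_integrable_pker by (simp add: g_def set_integrable_def)
  have "integrable (M \<Otimes>\<^sub>M lborel) g"
  proof (rule Fubini_integrable)
    show "AE \<omega> in M. integrable lborel (\<lambda>s. g (\<omega>, s))" by (intro AE_I2 int2)
    have le: "(LINT s|lborel. norm (g (\<omega>, s))) \<le> 1 + T * \<bar>x - S \<omega>\<bar> / pi" if "\<omega> \<in> space M" for \<omega>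
    proof -
      have "(LINT s|lborel. norm (g (\<omega>, s))) \<le> (LINT s|lborel. indicator {0<..<1::real} s *\<^sub>R (1 + T * \<bar>x
        - S \<omega>\<bar> / pi))"
        by (intro integral_mono integrable_norm int2 that ib gle)
      then show ?thesis by simp
    qed
    have "integrable M (\<lambda>\<omega>. 1 + T * \<bar>x - S \<omega>\<bar> / pi)" using intS by simp
    then show "integrable M (\<lambda>\<omega>. LINT s|lborel. norm (g (\<omega>, s)))"
    proof (rule Bochner_Integration.integrable_bound)
      show "AE \<omega> in M. norm (LINT s|lborel. norm (g (\<omega>, s))) \<le> norm (1 + T * \<bar>x - S \<omega>\<bar> / pi)"
        using le by (intro AE_I2) (smt (verit) Bochner_Integration.integral_nonneg norm_ge_zero real_norm_def)
    qed measurable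
  qed measurable
  then have int: "integrable (M \<Otimes>\<^sub>M lborel) (\<lambda>(\<omega>, s). g (\<omega>, s))" by simp
  have inner: "(LINT s|lborel. g (\<omega>, s)) = beurling (T * (x - S \<omega>) / (2 * pi))" for \<omega>
    by (simp add: g_def beurling_def set_lebesgue_integral_def)
  have "prob {\<omega> \<in> space M. S \<omega> \<le> x} = expectation (\<lambda>\<omega>. indicator {\<omega> \<in> space M. S \<omega> \<le> x} \<omega>)" by simp
  also have "\<dots> \<le> expectation (\<lambda>\<omega>. 1 / 2 + beurling (T * (x - S \<omega>) / (2 * pi)))"
  proof (rule integral_mono)
    have "integrable M (\<lambda>\<omega>. LINT s|lborel. g (\<omega>, s))" by (rule integrable_fst[OF int])
    then show "integrable M (\<lambda>\<omega>. 1 / 2 + beurling (T * (x - S \<omega>) / (2 * pi)))" by (simp add: inner)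
    show "indicator {\<omega> \<in> space M. S \<omega> \<le> x} \<omega> \<le> 1 / 2 + beurling (T * (x - S \<omega>) / (2 * pi))" for \<omega>
    proof (cases "S \<omega> \<le> x")
      case True
      then have "beurling (T * (x - S \<omega>) / (2 * pi)) \<ge> 1 / 2" using T by (intro beurling_nonneg_ge) auto
      then show ?thesis by (simp add: indicator_def)
    next
      case False
      then have "beurling (T * (x - S \<omega>) / (2 * pi)) \<ge> - 1 / 2"
        using T by (intro beurling_neg_ge) (auto simp: divide_neg_pos mult_pos_neg)
      then show ?thesis using False by simp
    qed
    show "integrable M (indicat_real {\<omega> \<in> space M. S \<omega> \<le> x})"
      by (intro integrable_real_indicator) (auto simp: emeasure_eq_measure)
  qed
  also have "\<dots> = 1 / 2 + expectation (\<lambda>\<omega>. LINT s|lborel. g (\<omega>, s))"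
  proof -
    have "integrable M (\<lambda>\<omega>. LINT s|lborel. g (\<omega>, s))" by (rule integrable_fst[OF int])
    then show ?thesis by (simp add: inner prob_space)
  qed
  also have "expectation (\<lambda>\<omega>. LINT s|lborel. g (\<omega>, s)) = (LINT s|lborel. LINT \<omega>|M. g (\<omega>, s))"
    using Fubini_integral[OF int] by simp
  also have "(LINT s|lborel. LINT \<omega>|M. g (\<omega>, s))
      = (LBINT s:{0<..<1}. pker (T * x) s * expectation (\<lambda>\<omega>. cos (s * T * S \<omega>)))"
    unfolding set_lebesgue_integral_def
  proof (rule Bochner_Integration.integral_cong[OF refl])
    fix s :: real
    have bd: "integrable M (\<lambda>\<omega>. cos (s * T * S \<omega>))" "integrable M (\<lambda>\<omega>. sin (s * T * S \<omega>))"
      by (auto intro!: integrable_const_bound[where B=1])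
    have "expectation (\<lambda>\<omega>. pker (T * (x - S \<omega>)) s)
      = expectation (\<lambda>\<omega>. pker (T * x) s * cos (s * T * S \<omega>) + ((1 - s) * sin (s * (T * x))
        - kern s * cos (s * (T * x))) * sin (s * T * S \<omega>))"
      by (rule Bochner_Integration.integral_cong[OF refl])
         (simp add: pker_def right_diff_distrib cos_diff sin_diff algebra_simps)
    also have "\<dots> = pker (T * x) s * expectation (\<lambda>\<omega>. cos (s * T * S \<omega>))"
      using bd by (simp add: odd)
    finally show "expectation (\<lambda>\<omega>. g (\<omega>, s)) = indicator {0<..<1} s *\<^sub>R (pker (T * x) s * expectation (\<lambda>\<omega>.
      cos (s * T * S \<omega>)))"
      by (simp add: g_def)
  qed
  finally show ?thesis by simp
qed

section \<open>The Gaussian part of the smoothed integral\<close>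

interpretation std_normal: prob_space std_normal_distribution
  by (rule prob_space_normal_density) simp

lemma std_normal_measure_eq:
  assumes [measurable]: "A \<in> sets borel"
  shows "measure std_normal_distribution A = (LINT t|lborel. std_normal_density t * indicator A t)"
proof -
  have "measure std_normal_distribution A = integral\<^sup>L std_normal_distribution (indicator A)" by simp
  also have "\<dots> = (LINT t|lborel. std_normal_density t *\<^sub>R indicator A t)"
    by (subst integral_density) auto
  finally show ?thesis by simp
qed

lemma Phi_minus: "Phi (- x) = 1 - Phi x"
proof -
  have "Phi (- x) = (LINT t|lborel. std_normal_density t * indicator {..<-x} t)"
    unfolding Phi_def by (rule std_normal_measure_eq) simp
  also have "\<dots> = (LINT t|lborel. std_normal_density t * indicator {x<..} t)"
    by (subst lborel_integral_real_affine[where c="-1" and t=0])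
       (auto simp: std_normal_density_def indicator_def intro!: Bochner_Integration.integral_cong)
  also have "\<dots> = (LINT t|lborel. std_normal_density t * indicator {x..} t)"
  proof (rule integral_cong_AE)
    have "AE t in lborel. t \<noteq> x" by (rule AE_lborel_singleton)
    then show "AE t in lborel. std_normal_density t * indicator {x<..} t
      = std_normal_density t * indicator {x..} t"
      by eventually_elim (auto simp: indicator_def)
  qed measurable
  also have "\<dots> = measure std_normal_distribution {x..}"
    by (rule std_normal_measure_eq[symmetric]) simp
  also have "\<dots> = 1 - measure std_normal_distribution {..<x}"
  proof -
    have "{x..} = space std_normal_distribution - {..<x}" by auto
    then show ?thesis by (simp only:) (rule std_normal.prob_compl, simp)
  qed
  finally show ?thesis by (simp add: Phi_def)
qed

lemma Phi_0: "Phi 0 = 1 / 2"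
  using Phi_minus[of 0] by simp

lemma Phi_mono: "x \<le> y \<Longrightarrow> Phi x \<le> Phi y"
  unfolding Phi_def by (rule std_normal.finite_measure_mono) auto

lemma Phi_bounds: "0 \<le> Phi x" "Phi x \<le> 1"
  by (auto simp: Phi_def)

lemma Phi_diff:
  assumes "x \<le> y"
  shows "Phi y - Phi x = (LBINT t:{x..y}. std_normal_density t)"
proof -
  have "Phi y - Phi x = measure std_normal_distribution ({..<y} - {..<x})"
    unfolding Phi_def using assms by (intro std_normal.finite_measure_Diff[symmetric]) auto
  also have "\<dots> = (LINT t|lborel. std_normal_density t * indicator ({..<y} - {..<x}) t)"
    by (rule std_normal_measure_eq) auto
  also have "\<dots> = (LINT t|lborel. indicator {x..y} t * std_normal_density t)"
  proof (rule integral_cong_AE)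
    have "AE t in lborel. t \<noteq> y" by (rule AE_lborel_singleton)
    then show "AE t in lborel. std_normal_density t * indicator ({..<y} - {..<x}) t
      = indicator {x..y} t * std_normal_density t"
      by eventually_elim (auto simp: indicator_def)
  qed measurable
  finally show ?thesis by (simp add: set_lebesgue_integral_def)
qed

section \<open>Gaussian integrals over the half-line\<close>

abbreviation has_half_integral :: "(real \<Rightarrow> real) \<Rightarrow> real \<Rightarrow> bool" where
  "has_half_integral f v \<equiv> has_bochner_integral lborel (\<lambda>s. indicator {0..} s *\<^sub>R f s) v"

lemma has_half_integral_scale:
  assumes "has_half_integral f v" "c > 0"
  shows "has_half_integral (\<lambda>s. f (c * s)) (v / c)"
proof -
  have "has_bochner_integral lborel (\<lambda>s. indicator {0..} (0 + c * s) *\<^sub>R f (0 + c * s)) (v /\<^sub>R \<bar>c\<bar>)"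
    using assms by (subst lborel_has_bochner_integral_real_affine_iff[symmetric]) auto
  moreover have "indicator {0..} (c * s) = (indicator {0..} s :: real)" for s
    using assms by (auto simp: indicator_def zero_le_mult_iff)
  ultimately show ?thesis using assms by (simp add: divide_inverse mult.commute)
qed

lemma has_half_integral_cmult:
  "has_half_integral f v \<Longrightarrow> has_half_integral (\<lambda>s. c * f s) (c * v)"
  using has_bochner_integral_mult_right[of c lborel "\<lambda>s. indicator {0..} s *\<^sub>R f s" v] by (simp add: mult_ac)

lemma has_half_integral_add:
  "has_half_integral f v \<Longrightarrow> has_half_integral g u \<Longrightarrow> has_half_integral (\<lambda>s. f s + g s) (v + u)"
  using has_bochner_integral_add[of lborel "\<lambda>s. indicator {0..} s *\<^sub>R f s" v "\<lambda>s. indicator {0..} s *\<^sub>R g s" u]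
  by (simp add: distrib_left)

lemma half_gaussian_moments:
  assumes "c > 0"
  shows "has_half_integral (\<lambda>s. exp (- (c * s)\<^sup>2)) (sqrt pi / (2 * c))"
    and "has_half_integral (\<lambda>s. s * exp (- (c * s)\<^sup>2)) (1 / (2 * c\<^sup>2))"
    and "has_half_integral (\<lambda>s. s\<^sup>2 * exp (- (c * s)\<^sup>2)) (sqrt pi / (4 * c^3))"
    and "has_half_integral (\<lambda>s. s^3 * exp (- (c * s)\<^sup>2)) (1 / (2 * c^4))"
proof -
  show "has_half_integral (\<lambda>s. exp (- (c * s)\<^sup>2)) (sqrt pi / (2 * c))"
    using has_half_integral_scale[OF gaussian_moment_0 assms] by (simp add: mult.commute)
  have *: "has_half_integral (\<lambda>s. s^k * exp (- (c * s)\<^sup>2)) (v / c^(k + 1))"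
    if "has_half_integral (\<lambda>s. exp (- s\<^sup>2) * s^k) v" for k v
  proof -
    have "has_half_integral (\<lambda>s. (1 / c^k) * (exp (- (c * s)\<^sup>2) * (c * s)^k)) ((1 / c^k) * (v / c))"
      by (intro has_half_integral_cmult has_half_integral_scale[OF that assms])
    moreover have "(\<lambda>s. (1 / c^k) * (exp (- (c * s)\<^sup>2) * (c * s)^k)) = (\<lambda>s. s^k * exp (- (c * s)\<^sup>2))"
    proof
      show "(1 / c^k) * (exp (- (c * s)\<^sup>2) * (c * s)^k) = s^k * exp (- (c * s)\<^sup>2)" for s
        unfolding power_mult_distrib[of c s k] using assms by simp
    qed
    moreover have "(1 / c^k) * (v / c) = v / c^(k + 1)" by simp
    ultimately show ?thesis by metis
  qed
  show "has_half_integral (\<lambda>s. s * exp (- (c * s)\<^sup>2)) (1 / (2 * c\<^sup>2))"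
    using *[of 1 "1/2"] gaussian_moment_1 by (simp add: power2_eq_square)
  show "has_half_integral (\<lambda>s. s\<^sup>2 * exp (- (c * s)\<^sup>2)) (sqrt pi / (4 * c^3))"
    using *[OF gaussian_moment_even_pos[of 1, simplified mult_1_right]]
      by (simp add: fact_numeral eval_nat_numeral)
  show "has_half_integral (\<lambda>s. s^3 * exp (- (c * s)\<^sup>2)) (1 / (2 * c^4))"
    using *[of 3 "1/2"] gaussian_moment_odd_pos[of 1] by (simp add: eval_nat_numeral)
qed

lemma half_gaussian_cos:
  "has_half_integral (\<lambda>t. cos (z * t) * exp (- t\<^sup>2 / 2)) (sqrt (pi / 2) * exp (- z\<^sup>2 / 2))"
proof -
  define f where "f = (\<lambda>t. cos (z * t) * exp (- t\<^sup>2 / 2))"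
  define y where "y = (LINT t|lborel. indicator {0..} t *\<^sub>R f t)"
  have f_eq: "f t = sqrt (2 * pi) * (std_normal_density t * cos (z * t))" for t
    by (simp add: f_def std_normal_density_def)
  have [measurable]: "f \<in> borel_measurable borel" unfolding f_def by measurable
  have int: "integrable lborel (\<lambda>t. std_normal_density t * cos (z * t))"
    by (rule Bochner_Integration.integrable_bound[OF integrable_normal_density[of 1 0]])
       (auto simp: abs_mult mult_left_le)
  then have intf: "integrable lborel f" by (simp add: f_eq[abs_def])
  then have "integrable lborel (\<lambda>t. indicator {0..} t *\<^sub>R f t)"
    by (intro integrable_mult_indicator) auto
  then have y: "has_half_integral f y" by (simp add: y_def has_bochner_integral_integrable)
  have "has_bochner_integral lborel f (2 *\<^sub>R y)"
    by (rule has_bochner_integral_even_function[OF y]) (simp add: f_def)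
  then have "2 * y = (LINT t|lborel. f t)" by (simp add: has_bochner_integral_integral_eq)
  also have "\<dots> = sqrt (2 * pi) * (LINT t|lborel. std_normal_density t * cos (z * t))"
    unfolding f_eq by simp
  also have "(LINT t|lborel. std_normal_density t * cos (z * t)) = exp (- z\<^sup>2 / 2)"
  proof -
    have "exp (- z\<^sup>2 / 2) = Re (char std_normal_distribution z)" by (simp add: char_std_normal_distribution)
    also have "\<dots> = (LINT t|std_normal_distribution. Re (iexp (z * t)))"
      unfolding char_def by (rule integral_Re[symmetric]) (rule std_normal.integrable_iexp; simp)
    also have "\<dots> = (LINT t|lborel. std_normal_density t *\<^sub>R cos (z * t))"
      by (subst integral_density) (auto simp: Re_exp)
    finally show ?thesis by simp
  qed
  finally have 2: "2 * y = sqrt (2 * pi) * exp (- z\<^sup>2 / 2)" .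
  have "y = sqrt (pi / 2) * exp (- z\<^sup>2 / 2)"
  proof -
    have "sqrt (2 * pi) = 2 * sqrt (pi / 2)"
      using real_sqrt_mult[of 4 "pi / 2"] by simp
    then show ?thesis using 2 by simp
  qed
  then show ?thesis using y by (simp add: f_def)
qed

text \<open>Integrates \<open>half_gaussian_cos\<close> over \<open>z\<close> from \<open>0\<close>
  to \<open>x\<close>: after exchanging the integrals, \<open>cos (z * t)\<close> becomes
  \<open>sin (x * t) / t\<close> and the Gaussian in \<open>z\<close> becomes the normal
  distribution function. This is the inversion formula without smoothing.\<close>

lemma half_gaussian_sin_pos:
  assumes "x \<ge> 0"
  shows "has_half_integral (\<lambda>t. sin (x * t) / (pi * t) * exp (- t\<^sup>2 / 2)) (Phi x - 1 / 2)"
proof -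
  define h where "h = (\<lambda>(z, t). indicator {0..x} z *\<^sub>R (indicator {0..} t *\<^sub>R (cos (z * t) * exp (- t\<^sup>2 / 2))))"
  define g where "g = (\<lambda>t::real. indicator {0..} t *\<^sub>R exp (- t\<^sup>2 / 2))"
  have [measurable]: "h \<in> borel_measurable (lborel \<Otimes>\<^sub>M lborel)" "g \<in> borel_measurable borel"
    unfolding h_def g_def by measurable
  have gint: "integrable lborel g"
    using half_gaussian_cos[of 0] unfolding g_def by (simp add: has_bochner_integral_iff)
  have nh: "norm (h (z, t)) \<le> indicator {0..x} z * g t" for z t
    by (auto simp: h_def g_def indicator_def abs_mult)
  have hz: "integrable lborel (\<lambda>t. h (z, t))" for z
    using half_gaussian_cos[of z] by (auto simp: h_def has_bochner_integral_iff)
  have inth: "integrable (lborel \<Otimes>\<^sub>M lborel) (\<lambda>(z, t). h (z, t))"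
  proof -
    have "integrable (lborel \<Otimes>\<^sub>M lborel) h"
    proof (rule lborel_pair.Fubini_integrable)
      show "AE z in lborel. integrable lborel (\<lambda>t. h (z, t))" by (simp add: hz)
      have fin: "emeasure lborel {0..x} < \<infinity>" using emeasure_lborel_Icc[OF assms] by simp
      have "integrable lborel (\<lambda>z. indicator {0..x} z * integral\<^sup>L lborel g)"
        by (intro integrable_mult_left integrable_real_indicator) (simp_all only: fin, simp)
      then show "integrable lborel (\<lambda>z. LINT t|lborel. norm (h (z, t)))"
      proof (rule Bochner_Integration.integrable_bound)
        have "(LINT t|lborel. norm (h (z, t))) \<le> (LINT t|lborel. indicator {0..x} z * g t)" for z
          by (intro integral_mono integrable_norm hz nh integrable_mult_right gint)
        then have "\<bar>LINT t|lborel. norm (h (z, t))\<bar> \<le> \<bar>indicator {0..x} z * integral\<^sup>L lborel g\<bar>" for z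
          by (subst abs_of_nonneg) (auto intro: order_trans[OF _ abs_ge_self])
        then show "AE z in lborel. norm (LINT t|lborel. norm (h (z, t)))
          \<le> norm (indicator {0..x} z * integral\<^sup>L lborel g)"
          by simp
      qed measurable
    qed measurable
    then show ?thesis by simp
  qed
  have inner_t: "(LINT t|lborel. h (z, t)) = indicator {0..x} z *\<^sub>R (pi * std_normal_density z)" for z
  proof -
    have "sqrt (pi / 2) = pi / sqrt (2 * pi)"
      by (simp add: real_sqrt_divide real_sqrt_mult divide_simps)
    then show ?thesis
      using half_gaussian_cos[of z] by (simp add: h_def has_bochner_integral_iff std_normal_density_def)
  qed
  have inner_z: "(LINT z|lborel. h (z, t)) = indicator {0..} t *\<^sub>R (sin (x * t) / t * exp (- t\<^sup>2 / 2))" if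
    "t \<noteq> 0" for t
  proof -
    have "(LBINT z=ereal 0..ereal x. cos (z * t)) = sin (x * t) / t - sin (0 * t) / t"
      using that
      by (intro interval_integral_FTC_finite)
         (auto intro!: continuous_intros derivative_eq_intros simp flip:
           has_real_derivative_iff_has_vector_derivative)
    then have "(LBINT z:{0..x}. cos (z * t)) = sin (x * t) / t"
      using assms by (simp add: interval_integral_Icc)
    then have 1: "(LINT z|lborel. indicator {0..x} z * cos (z * t)) = sin (x * t) / t"
      by (simp add: set_lebesgue_integral_def)
    have "(LINT z|lborel. h (z, t)) = (LINT z|lborel. (indicator {0..x} z * cos (z * t)) * (indicator {0..}
      t * exp (- t\<^sup>2 / 2)))"
      by (intro Bochner_Integration.integral_cong refl) (simp add: h_def)
    also have "\<dots> = sin (x * t) / t * (indicator {0..} t * exp (- t\<^sup>2 / 2))"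
      unfolding integral_mult_left_zero 1 ..
    finally show ?thesis by simp
  qed
  have AEe: "AE t in lborel. (LINT z|lborel. h (z, t)) = indicator {0..} t *\<^sub>R (sin (x * t) / t * exp (- t\<^sup>2 /
    2))"
    using AE_lborel_singleton[of "0::real"] by eventually_elim (rule inner_z)
  have "integrable lborel (\<lambda>t. LINT z|lborel. h (z, t))"
    by (rule lborel_pair.integrable_snd[OF inth])
  then have i1: "integrable lborel (\<lambda>t. indicator {0..} t *\<^sub>R (sin (x * t) / t * exp (- t\<^sup>2 / 2)))"
    using AEe by (subst (asm) integrable_cong_AE) auto
  have "(LINT t|lborel. indicator {0..} t *\<^sub>R (sin (x * t) / t * exp (- t\<^sup>2 / 2)))
    = (LINT t|lborel. LINT z|lborel. h (z, t))"
    using AEe by (intro integral_cong_AE) auto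
  also have "\<dots> = (LINT z|lborel. LINT t|lborel. h (z, t))"
    using lborel_pair.Fubini_integral[OF inth] by simp
  also have "\<dots> = pi * (LBINT z:{0..x}. std_normal_density z)"
    unfolding inner_t set_lebesgue_integral_def
    by (subst integral_mult_right_zero[symmetric]) (simp add: mult.left_commute)
  also have "(LBINT z:{0..x}. std_normal_density z) = Phi x - 1 / 2"
    using Phi_diff[OF assms] by (simp add: Phi_0)
  finally have "has_half_integral (\<lambda>t. sin (x * t) / t * exp (- t\<^sup>2 / 2)) (pi * (Phi x - 1 / 2))"
    using i1 by (simp add: has_bochner_integral_iff)
  from has_half_integral_cmult[OF this, of "1 / pi"] show ?thesis
    by simp
qed

lemma half_gaussian_sin:
  "has_half_integral (\<lambda>t. sin (x * t) / (pi * t) * exp (- t\<^sup>2 / 2)) (Phi x - 1 / 2)"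
proof (cases "x \<ge> 0")
  case False
  then have "has_half_integral (\<lambda>t. -1 * (sin (- x * t) / (pi * t) * exp (- t\<^sup>2 / 2))) (-1 * (Phi (- x)
    - 1 / 2))"
    by (intro has_half_integral_cmult half_gaussian_sin_pos) auto
  then show ?thesis by (simp add: Phi_minus)
qed (rule half_gaussian_sin_pos)

text \<open>The cut-off kernel is compared with \<open>sin \<theta> / (pi * s)\<close> on the whole
  half-line, so that the latter integrates exactly to \<open>Phi x - 1 / 2\<close>. The majorants
  are polynomials in \<open>s\<close> besides the cosine, hence integrable against a Gaussian in
  closed form. The first is precise for small \<open>\<theta>\<close>, the second does not grow with
  it.\<close>

lemma pker_defect_le:
  fixes s t :: real
  assumes "s \<ge> 0"
  defines "\<theta> \<equiv> s * t"
  shows "indicator {0<..<1} s * pker t s - sin \<theta> / (pi * s)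
      \<le> cos \<theta> - s + s * \<theta>\<^sup>2 / 2 + 4 / 27 * s^3 + pi * s * \<bar>\<theta>\<bar> / 3" (is ?A)
    and "indicator {0<..<1} s * pker t s - sin \<theta> / (pi * s)
      \<le> cos \<theta> + s + 4 / 27 * s^3 + pi * s / 3" (is ?B)
proof -
  consider "s = 0" | "0 < s" "s < 1" | "1 \<le> s" using assms by linarith
  then have "?A \<and> ?B"
  proof cases
    case 1
    then show ?thesis by (simp add: \<theta>_def)
  next
    case 2
    define D where "D = 1 / (pi * s) - kern s"
    have D: "0 \<le> D" "D \<le> pi * s / 3" using kern_le[OF 2] kern_defect_le[OF 2] by (simp_all add: D_def)
    have "indicator {0<..<1} s * pker t s - sin \<theta> / (pi * s) = cos \<theta> - s * cos \<theta> - D * sin \<theta>"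
      using 2 by (simp add: pker_def \<theta>_def D_def algebra_simps)
    moreover have "s - s * \<theta>\<^sup>2 / 2 \<le> s * cos \<theta>"
      using mult_left_mono[OF cos_ge_poly2[of \<theta>], of s] 2 by (simp add: right_diff_distrib)
    moreover have "- s \<le> s * cos \<theta>" using mult_left_mono[of "-1" "cos \<theta>" s] 2 by simp
    moreover have aD: "\<bar>D\<bar> \<le> pi * s / 3" using D by simp
    have "\<bar>D\<bar> * \<bar>sin \<theta>\<bar> \<le> pi * s / 3 * \<bar>\<theta>\<bar>"
      by (rule mult_mono[OF aD abs_sin_x_le_abs_x]) (use 2 in auto)
    then have "- (D * sin \<theta>) \<le> pi * s * \<bar>\<theta>\<bar> / 3" by (simp flip: abs_mult)
    moreover have "\<bar>D\<bar> * \<bar>sin \<theta>\<bar> \<le> pi * s / 3 * 1"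
      by (rule mult_mono[OF aD abs_sin_le_one]) (use 2 in auto)
    then have "- (D * sin \<theta>) \<le> pi * s / 3" by (simp flip: abs_mult)
    moreover have "0 \<le> 4 / 27 * s^3" using 2 by simp
    ultimately show ?thesis by linarith
  next
    case 3
    \<comment> \<open>Beyond the cut-off the kernel is \<open>0\<close> and a term of size
      \<open>s - 1\<close> must be covered by a cubic; \<open>4 / 27\<close> is the smallest
      possible coefficient, with contact at \<open>s = 3/2\<close>.\<close>
    have "0 \<le> (s - 3/2)\<^sup>2 * (s + 3) * (4 / 27)" using 3 by (intro mult_nonneg_nonneg) auto
    also have "\<dots> = 4 / 27 * s^3 - s + 1" by (simp add: power2_eq_square power3_eq_cube field_simps)
    finally have s3: "s - 1 \<le> 4 / 27 * s^3" by simp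
    have "s - s * \<theta>\<^sup>2 / 2 \<le> s * cos \<theta>"
      using mult_left_mono[OF cos_ge_poly2[of \<theta>], of s] 3 by (simp add: right_diff_distrib)
    moreover have "s * cos \<theta> - cos \<theta> \<le> s - 1"
      using mult_left_mono[OF cos_le_one[of \<theta>], of "s - 1"] 3 by (simp add: left_diff_distrib)
    moreover have inv: "1 / (pi * s) \<le> pi * s / 3"
    proof -
      have "1 * 1 \<le> s * s" "3 * 3 \<le> pi * pi" using 3 pi_bounds mult_mono[of 1 s 1 s] mult_mono[of 3 pi 3 pi]
        by auto
      then have "1 * 9 \<le> (s * s) * (pi * pi)" by (intro mult_mono) auto
      then show ?thesis using 3 by (simp add: field_simps)
    qed
    moreover have "- (sin \<theta> / (pi * s)) \<le> pi * s * \<bar>\<theta>\<bar> / 3"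
    proof -
      have "- (sin \<theta> / (pi * s)) \<le> \<bar>sin \<theta> / (pi * s)\<bar>" by (rule abs_ge_minus_self)
      also have "\<dots> = 1 / (pi * s) * \<bar>sin \<theta>\<bar>" using 3 by (simp add: abs_mult)
      also have "\<dots> \<le> pi * s / 3 * \<bar>\<theta>\<bar>" using inv 3 by (intro mult_mono abs_sin_x_le_abs_x) auto
      finally show ?thesis by simp
    qed
    moreover have "- (sin \<theta> / (pi * s)) \<le> pi * s / 3"
    proof -
      have "- (sin \<theta> / (pi * s)) \<le> \<bar>sin \<theta> / (pi * s)\<bar>" by (rule abs_ge_minus_self)
      also have "\<dots> = 1 / (pi * s) * \<bar>sin \<theta>\<bar>" using 3 by (simp add: abs_mult)
      also have "\<dots> \<le> pi * s / 3 * 1" using inv 3 by (intro mult_mono) auto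
      finally show ?thesis by simp
    qed
    moreover have "-1 \<le> cos \<theta>" "0 \<le> 4 / 27 * s^3" using 3 by auto
    moreover have "indicator {0<..<1} s * pker t s = 0" using 3 by (simp add: indicator_def)
    ultimately show ?thesis using 3 s3 by linarith
  qed
  then show ?A ?B by auto
qed

text \<open>The two majorants of \<open>pker_defect_le\<close> integrated with Gaussian moments. In
  the first bound \<open>- 1 / T^2\<close> is a gain that prevails for small \<open>x\<close>; the
  second serves for large \<open>x\<close>, where the main term is already damped.\<close>

lemma smoothed_gaussian_minus_Phi_le_aux:
  fixes T x :: real
  assumes "T > 0"
  defines "N \<equiv> (LBINT s:{0<..<1}. pker (T * x) s * exp (- (s * T)\<^sup>2 / 2)) - (Phi x - 1 / 2)"
  shows "N \<le> sqrt (pi / 2) / T * exp (- x\<^sup>2 / 2) + (x\<^sup>2 - 1) / T\<^sup>2 + 8 / 27 / T^4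
    + pi / 3 * sqrt (pi / 2) * \<bar>x\<bar> / T\<^sup>2"
    and "N \<le> sqrt (pi / 2) / T * exp (- x\<^sup>2 / 2) + (1 + pi / 3) / T\<^sup>2 + 8 / 27 / T^4"
proof -
  define w where "w = (\<lambda>s. exp (- (s * T)\<^sup>2 / 2))"
  define c where "c = T / sqrt 2"
  have c: "c > 0" using assms by (simp add: c_def)
  have w: "exp (- (c * s)\<^sup>2) = w s" for s
    by (simp add: c_def w_def power_mult_distrib power_divide mult.commute)
  have s2: "sqrt pi / (2 * c) = sqrt (pi / 2) / T"
    using assms by (simp add: c_def real_sqrt_divide field_simps)
  have c2: "1 / (2 * c\<^sup>2) = 1 / T\<^sup>2" "1 / (2 * c^4) = 2 / T^4"
    by (simp_all add: c_def power_divide power4_eq_xxxx)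
  have c3: "sqrt pi / (4 * c^3) = sqrt (pi / 2) / T^3"
  proof -
    have "sqrt pi / (4 * c^3) = sqrt pi / (2 * c) * (1 / (2 * c\<^sup>2))"
      by (simp add: power3_eq_cube power2_eq_square)
    also have "\<dots> = sqrt (pi / 2) / T^3" unfolding s2 c2 by (simp add: power3_eq_cube power2_eq_square)
    finally show ?thesis .
  qed
  note m = half_gaussian_moments[OF c, unfolded w s2 c2 c3]
  have cos: "has_half_integral (\<lambda>s. cos (s * (T * x)) * w s) (sqrt (pi / 2) / T * exp (- x\<^sup>2 / 2))"
    using has_half_integral_scale[OF half_gaussian_cos[of x] assms(1)] by (simp add: w_def mult_ac)
  have sin: "has_half_integral (\<lambda>s. sin (s * (T * x)) / (pi * s) * w s) (Phi x - 1 / 2)"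
    using has_half_integral_cmult[OF has_half_integral_scale[OF half_gaussian_sin[of x] assms(1)], of T]
      assms(1)
    by (simp add: w_def mult_ac)
  define P where "P = (\<lambda>s. indicator {0<..<1} s * pker (T * x) s * w s)"
  have ind: "(indicator {0<..<1} s * X :: real) = indicator {0..} s *\<^sub>R (indicator {0<..<1} s * X)" for s X
    :: real
    by (auto simp: indicator_def)
  have "integrable lborel P"
  proof -
    have "set_integrable lborel {0<..<1} (\<lambda>s. pker (T * x) s * w s)"
    proof (rule set_integrable_unit_bounded[of _ "(1 + \<bar>T * x\<bar> / pi) * 1"])
      show "\<bar>pker (T * x) s * w s\<bar> \<le> (1 + \<bar>T * x\<bar> / pi) * 1" if "0 < s" "s < 1" for s
        unfolding abs_mult[of _ "w s"] using abs_pker_le[OF that] by (intro mult_mono) (auto simp: w_def)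
    qed (simp add: w_def)
    then show ?thesis by (simp add: set_integrable_def P_def mult.assoc)
  qed
  then have P: "has_half_integral P (LBINT s:{0<..<1}. pker (T * x) s * w s)"
    unfolding P_def mult.assoc by (subst ind[symmetric]) (simp add: has_bochner_integral_iff
      set_lebesgue_integral_def)
  have Neq: "N = (LBINT s:{0<..<1}. pker (T * x) s * w s) + - 1 * (Phi x - 1 / 2)"
    by (simp add: N_def w_def)
  have N: "has_half_integral (\<lambda>s. P s + - 1 * (sin (s * (T * x)) / (pi * s) * w s)) N"
    unfolding Neq using has_half_integral_add[OF P has_half_integral_cmult[OF sin, of "-1"]] .
  have le: "N \<le> v" if v: "has_half_integral f v" and "\<And>s. s \<ge> 0 \<Longrightarrow> P s +
    - 1 * (sin (s * (T * x)) / (pi * s) * w s) \<le> f s" for f v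
  proof -
    have "(LINT s|lborel. indicator {0..} s *\<^sub>R (P s + - 1 * (sin (s * (T * x)) / (pi * s) * w s)))
      \<le> (LINT s|lborel. indicator {0..} s *\<^sub>R f s)"
      using that(2) N v by (intro integral_mono) (auto simp: has_bochner_integral_iff indicator_def)
    then show ?thesis using N v by (simp only: has_bochner_integral_iff)
  qed
  have Pw: "P s + - 1 * (sin (s * (T * x)) / (pi * s) * w s) = (indicator {0<..<1} s * pker (T * x) s
    - sin (s * (T * x)) / (pi * s)) * w s" for s
    by (simp add: P_def algebra_simps)
  have "N \<le> sqrt (pi / 2) / T * exp (- x\<^sup>2 / 2) + ((- 1) * (1 / T\<^sup>2) + ((T\<^sup>2 * x\<^sup>2 / 2 + 4 / 27) * (2 / T^4)
    + (pi * T * \<bar>x\<bar> / 3) * (sqrt (pi / 2) / T^3)))"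
  proof (rule le)
    show "has_half_integral (\<lambda>s. cos (s * (T * x)) * w s + ((- 1) * (s * w s) + ((T\<^sup>2 * x\<^sup>2 / 2
      + 4 / 27) * (s^3 * w s) + (pi * T * \<bar>x\<bar> / 3) * (s\<^sup>2 * w s))))
      (sqrt (pi / 2) / T * exp (- x\<^sup>2 / 2) + ((- 1) * (1 / T\<^sup>2) + ((T\<^sup>2 * x\<^sup>2 / 2 + 4 / 27) * (2 / T^4)
        + (pi * T * \<bar>x\<bar> / 3) * (sqrt (pi / 2) / T^3))))"
      by (intro has_half_integral_add has_half_integral_cmult cos m)
    show "P s + - 1 * (sin (s * (T * x)) / (pi * s) * w s) \<le> cos (s * (T * x)) * w s + ((- 1) * (s * w s)
      + ((T\<^sup>2 * x\<^sup>2 / 2 + 4 / 27) * (s^3 * w s) + (pi * T * \<bar>x\<bar> / 3) * (s\<^sup>2 * w s)))"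
      if "s \<ge> 0" for s
    proof -
      have "P s + - 1 * (sin (s * (T * x)) / (pi * s) * w s) \<le> (cos (s * (T * x)) - s
        + s * (s * (T * x))\<^sup>2 / 2 + 4 / 27 * s^3 + pi * s * \<bar>s * (T * x)\<bar> / 3) * w s"
        unfolding Pw using pker_defect_le(1)[OF that, of "T * x"] by (intro mult_right_mono) (auto simp: w_def)
      also have "\<bar>s * (T * x)\<bar> = s * (T * \<bar>x\<bar>)" using that assms(1) by (simp add: abs_mult)
      finally show ?thesis by (simp add: algebra_simps power2_eq_square power3_eq_cube)
    qed
  qed
  also have "\<dots> = sqrt (pi / 2) / T * exp (- x\<^sup>2 / 2) + (x\<^sup>2 - 1) / T\<^sup>2 + 8 / 27 / T^4
    + pi / 3 * sqrt (pi / 2) * \<bar>x\<bar> / T\<^sup>2"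
    using assms(1) by (simp add: field_simps eval_nat_numeral)
  finally show "N \<le> sqrt (pi / 2) / T * exp (- x\<^sup>2 / 2) + (x\<^sup>2 - 1) / T\<^sup>2 + 8 / 27 / T^4
    + pi / 3 * sqrt (pi / 2) * \<bar>x\<bar> / T\<^sup>2" .
  have "N \<le> sqrt (pi / 2) / T * exp (- x\<^sup>2 / 2) + ((1 + pi / 3) * (1 / T\<^sup>2) + 4 / 27 * (2 / T^4))"
  proof (rule le)
    show "has_half_integral (\<lambda>s. cos (s * (T * x)) * w s + ((1 + pi / 3) * (s * w s) + 4 / 27 * (s^3 * w s)))
      (sqrt (pi / 2) / T * exp (- x\<^sup>2 / 2) + ((1 + pi / 3) * (1 / T\<^sup>2) + 4 / 27 * (2 / T^4)))"
      by (intro has_half_integral_add has_half_integral_cmult cos m)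
    show "P s + - 1 * (sin (s * (T * x)) / (pi * s) * w s) \<le> cos (s * (T * x)) * w s + ((1
      + pi / 3) * (s * w s) + 4 / 27 * (s^3 * w s))"
      if "s \<ge> 0" for s
    proof -
      have "P s + - 1 * (sin (s * (T * x)) / (pi * s) * w s) \<le> (cos (s * (T * x)) + s + 4 / 27 * s^3
        + pi * s / 3) * w s"
        unfolding Pw using pker_defect_le(2)[OF that, of "T * x"] by (intro mult_right_mono) (auto simp: w_def)
      then show ?thesis by (simp add: algebra_simps)
    qed
  qed
  then show "N \<le> sqrt (pi / 2) / T * exp (- x\<^sup>2 / 2) + (1 + pi / 3) / T\<^sup>2 + 8 / 27 / T^4" by simp
qed

lemma sqrt_pi_half_bounds: "1.2533 \<le> sqrt (pi / 2)" "sqrt (pi / 2) \<le> 1.2534"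
  by (rule real_le_rsqrt real_le_lsqrt; use pi_bounds in \<open>simp add: power2_eq_square\<close>)+

text \<open>The main term peaks at \<open>x = 0\<close>, exactly where the second-order gain is
  available. Away from \<open>0\<close> the gain is lost, but the damping
  \<open>1 - exp (- x^2 / 2)\<close> of the main term makes up for it; \<open>0.78\<close> instead
  of \<open>1\<close> leaves room in between. The threshold \<open>5.44\<close> lies just below
  \<open>pi * sqrt 3\<close>, the smallest cut-off used.\<close>

lemma smoothed_gaussian_minus_Phi_le:
  assumes "T \<ge> 5.44"
  shows "(LBINT s:{0<..<1}. pker (T * x) s * exp (- (s * T)\<^sup>2 / 2)) - (Phi x - 1 / 2) \<le> (sqrt (pi / 2)
    - 0.78 / T) / T"
proof -
  define N where "N = (LBINT s:{0<..<1}. pker (T * x) s * exp (- (s * T)\<^sup>2 / 2)) - (Phi x - 1 / 2)"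
  define a where "a = sqrt (pi / 2)"
  have a: "1.2533 \<le> a" "a \<le> 1.2534" using sqrt_pi_half_bounds by (simp_all add: a_def)
  have T: "T > 0" using assms by simp
  have r: "0 < 1 / T" "1 / T \<le> 0.18383" using assms by (auto simp: field_simps)
  have T2: "8 / 27 / T\<^sup>2 \<le> 0.0101"
  proof -
    have "5.44\<^sup>2 \<le> T\<^sup>2" using assms by (intro power_mono) auto
    then show ?thesis using T by (simp add: field_simps power2_eq_square)
  qed
  \<comment> \<open>\<open>B\<close> is the coefficient of \<open>1 / T^2\<close>. The number
    \<open>0.18383\<close> bounds \<open>1 / T\<close>, and \<open>0.7901 = 0.78 + 0.0101\<close>
    includes the term of order \<open>1 / T^4\<close>.\<close>
  have key: "N \<le> (a - 0.78 / T) / T" if "N \<le> a / T * exp (- x\<^sup>2 / 2) + B / T\<^sup>2 + 8 / 27 / T^4"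
    and B: "a * (1 - exp (- x\<^sup>2 / 2)) \<ge> 0.18383 * (B + 0.7901)" for B
  proof -
    have "(B + 0.7901) / T \<le> a * (1 - exp (- x\<^sup>2 / 2))"
    proof (cases "B + 0.7901 \<ge> 0")
      case True
      have "(B + 0.7901) / T = 1 / T * (B + 0.7901)" by simp
      also have "\<dots> \<le> 0.18383 * (B + 0.7901)" by (rule mult_right_mono[OF r(2) True])
      finally show ?thesis using B by linarith
    next
      case False
      then have "(B + 0.7901) / T \<le> 0" using T by (simp add: divide_nonpos_pos)
      moreover have "a * (1 - exp (- x\<^sup>2 / 2)) \<ge> 0" using a by (intro mult_nonneg_nonneg) auto
      ultimately show ?thesis by linarith
    qed
    then have "B / T + 0.78 / T + (8 / 27 / T\<^sup>2) / T \<le> a * (1 - exp (- x\<^sup>2 / 2))"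
      using divide_right_mono[OF T2, of T] T by (simp add: add_divide_distrib)
    then have "(a * exp (- x\<^sup>2 / 2) + B / T + (8 / 27 / T\<^sup>2) / T) / T \<le> (a - 0.78 / T) / T"
      using T by (intro divide_right_mono) (auto simp: algebra_simps)
    moreover have "(a * exp (- x\<^sup>2 / 2) + B / T + (8 / 27 / T\<^sup>2) / T) / T = a / T * exp (- x\<^sup>2 / 2) + B / T\<^sup>2
      + 8 / 27 / T^4"
      using T by (simp add: add_divide_distrib eval_nat_numeral)
    ultimately show ?thesis using that(1) by linarith
  qed
  define y where "y = x\<^sup>2 / 2"
  have y0: "0 \<le> y" by (simp add: y_def)
  have y2: "- x\<^sup>2 / 2 = - y" by (simp add: y_def)
  have xx: "x\<^sup>2 = 2 * y" by (simp add: y_def)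
  have "N \<le> (a - 0.78 / T) / T"
  proof (cases "\<bar>x\<bar> \<le> 1.1")
    case True
    define b where "b = pi / 3 * a"
    have "pi / 3 * a \<le> (3.1416 / 3) * 1.2534" using a pi_bounds by (intro mult_mono) auto
    then have b: "b \<le> 1.3126" by (simp add: b_def)
    have exp_le: "1 - exp (- y) \<ge> y - y\<^sup>2 / 2"
    proof -
      have "0 \<le> 1 - y + y\<^sup>2 / 2 - exp (- y)"
        using y0 by (intro nonneg_from_deriv[of 0 y "\<lambda>y. 1 - y + y\<^sup>2 / 2 - exp (- y)" "\<lambda>y. - 1 + y + exp (- y)"])
          (use exp_ge_add_one_self[of "- _"] in \<open>auto intro!: derivative_eq_intros simp: algebra_simps\<close>)
      then show ?thesis by simp
    qed
    have y1: "y \<le> 0.605" using power_mono[OF True, of 2] by (simp add: y_def power2_eq_square)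
    have "y\<^sup>2 \<le> 0.605 * y" using mult_right_mono[OF y1 y0] by (simp add: power2_eq_square)
    then have "a * (1 - exp (- y)) \<ge> 1.2533 * (y - y\<^sup>2 / 2)"
      using a exp_le y0 by (intro mult_mono) auto
    moreover have "1.2533 * (y - y\<^sup>2 / 2) \<ge> 0.18383 * ((x\<^sup>2 - 1 + b * \<bar>x\<bar>) + 0.7901)"
    proof -
      \<comment> \<open>The linear term is replaced by a parabola touching it at
        \<open>\<bar>x\<bar> = e\<close>; \<open>0.28\<close> and \<open>0.7\<close> are contact
        points suited to the two ranges of \<open>y\<close> below.\<close>
      have bx: "b * \<bar>x\<bar> \<le> 1.3126 * (x\<^sup>2 / (2 * e) + e / 2)" if "e > 0" for e
      proof -
        have "0 \<le> (\<bar>x\<bar> - e)\<^sup>2 / (2 * e)" using that by simp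
        then have "\<bar>x\<bar> \<le> x\<^sup>2 / (2 * e) + e / 2" using that
          by (simp add: power2_diff field_simps power2_eq_square)
        then show ?thesis using b by (intro mult_mono) auto
      qed
      show ?thesis
      proof (cases "y \<le> 0.1")
        case True
        have "y\<^sup>2 \<le> 0.1 * y" using mult_right_mono[OF True y0] by (simp add: power2_eq_square)
        then show ?thesis using bx[of "0.28"] y0 True unfolding xx by simp
      next
        case False
        \<comment> \<open>Bounds \<open>y^2\<close> by its chord over \<open>[0.1, 0.605]\<close>,
          which makes the remaining inequality linear.\<close>
        have "0 \<le> (y - 0.1) * (0.605 - y)" using False y1 by simp
        then have "y\<^sup>2 \<le> 0.705 * y - 0.0605" by (simp add: power2_eq_square field_simps)
        then show ?thesis using bx[of "0.7"] False unfolding xx by simp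
      qed
    qed
    ultimately have "a * (1 - exp (- y)) \<ge> 0.18383 * ((x\<^sup>2 - 1 + b * \<bar>x\<bar>) + 0.7901)" by linarith
    moreover have "N \<le> a / T * exp (- x\<^sup>2 / 2) + (x\<^sup>2 - 1 + b * \<bar>x\<bar>) / T\<^sup>2 + 8 / 27 / T^4"
      using smoothed_gaussian_minus_Phi_le_aux(1)[OF T, of x]
        by (simp add: N_def a_def b_def add_divide_distrib)
    ultimately show ?thesis unfolding y2 by - (rule key[unfolded y2]; assumption)
  next
    case False
    have "1.1\<^sup>2 \<le> \<bar>x\<bar>\<^sup>2" using False by (intro power_mono) auto
    then have "0.605 \<le> y" by (simp add: y_def power2_eq_square)
    then have "exp (- y) \<le> exp (- 0.605)" by simp
    also have "exp (- 0.605 :: real) \<le> 0.57"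
    proof -
      have "1 / 0.57 \<le> exp (0.605::real)" using exp_ge_taylor[of "0.605" 2] by (simp add: eval_nat_numeral)
      then show ?thesis by (simp add: exp_minus field_simps)
    qed
    finally have "a * (1 - exp (- y)) \<ge> 1.2533 * 0.43" using a by (intro mult_mono) auto
    then have "a * (1 - exp (- y)) \<ge> 0.18383 * (1 + pi / 3 + 0.7901)" using pi_bounds by simp
    moreover have "N \<le> a / T * exp (- x\<^sup>2 / 2) + (1 + pi / 3) / T\<^sup>2 + 8 / 27 / T^4"
      using smoothed_gaussian_minus_Phi_le_aux(2)[OF T, of x] by (simp add: N_def a_def)
    ultimately show ?thesis unfolding y2 by - (rule key[unfolded y2]; assumption)
  qed
  then show ?thesis by (simp add: N_def a_def)
qed

section \<open>Comparison with the Gaussian\<close>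

definition knorm :: "real \<Rightarrow> real" where
  "knorm s = sqrt ((1 - s)\<^sup>2 + (kern s)\<^sup>2)"

lemma knorm_measurable [measurable]: "knorm \<in> borel_measurable borel"
  unfolding knorm_def[abs_def] by measurable

lemma knorm_nonneg: "0 \<le> knorm s"
  by (simp add: knorm_def)

lemma abs_pker_le_knorm: "\<bar>pker \<theta> s\<bar> \<le> knorm s"
proof -
  define a b c d where "a = 1 - s" and "b = kern s" and "c = cos (s * \<theta>)" and "d = sin (s * \<theta>)"
  have "(a * c + b * d)\<^sup>2 + (a * d - b * c)\<^sup>2 = (a\<^sup>2 + b\<^sup>2) * (c\<^sup>2 + d\<^sup>2)"
    by (simp add: power2_eq_square algebra_simps)
  moreover have "c\<^sup>2 + d\<^sup>2 = 1" by (simp add: c_def d_def)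
  ultimately have "(a * c + b * d)\<^sup>2 = a\<^sup>2 + b\<^sup>2 - (a * d - b * c)\<^sup>2" by simp
  also have "\<dots> \<le> a\<^sup>2 + b\<^sup>2" by simp
  finally have "(a * c + b * d)\<^sup>2 \<le> a\<^sup>2 + b\<^sup>2" .
  then show ?thesis
    unfolding knorm_def pker_def a_def b_def c_def d_def by (intro real_le_rsqrt) simp
qed

text \<open>Bounds the modulus of \<open>pker\<close> times that of the difference between the \<open>n\<close>-th power of the characteristic
  function and the Gaussian, up to a power of the cosine if \<open>s > 1/2\<close>; on \<open>(0, 1/2]\<close> the factor \<open>1.04 / (pi * s)\<close>
  dominates \<open>knorm s\<close>. Convexity in \<open>l\<close> reduces the range \<open>l > 1 / sqrt 3\<close>
  to its end points.\<close>
definition maj :: "real \<Rightarrow> real \<Rightarrow> real \<Rightarrow> real" where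
  "maj T l s = (if s \<le> 1 / 2 then 1.04 / (pi * s) * (exp (- (s * T)\<^sup>2 / 2) * (exp (l * (s * T)^3 / 10) - 1))
     else knorm s * (exp (- (s * T)\<^sup>2 / 2) * exp (l * (s * T)^3 / 10)))"

lemma maj_measurable [measurable]: "maj T l \<in> borel_measurable borel"
  unfolding maj_def[abs_def] by measurable

lemma maj_convex:
  assumes "0 \<le> \<theta>" "\<theta> \<le> 1" "0 < s"
  shows "maj T ((1 - \<theta>) * l0 + \<theta> * l1) s \<le> (1 - \<theta>) * maj T l0 s + \<theta> * maj T l1 s"
proof -
  define a where "a = (s * T)^3 / 10"
  have "exp ((1 - \<theta>) * (l0 * a) + \<theta> * (l1 * a)) \<le> (1 - \<theta>) * exp (l0 * a) + \<theta> * exp (l1 * a)"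
    using convex_onD[OF exp_convex, of \<theta> "l0 * a" "l1 * a"] assms by simp
  then have 1: "exp (((1 - \<theta>) * l0 + \<theta> * l1) * a) \<le> (1 - \<theta>) * exp (l0 * a) + \<theta> * exp (l1 * a)"
    by (simp add: algebra_simps)
  have la: "l * (s * T)^3 / 10 = l * a" for l by (simp add: a_def)
  define E where "E = exp (- (s * T)\<^sup>2 / 2)"
  show ?thesis
  proof (cases "s \<le> 1/2")
    case True
    define k where "k = 1.04 / (pi * s) * E"
    have "k * exp (((1 - \<theta>) * l0 + \<theta> * l1) * a) \<le> k * ((1 - \<theta>) * exp (l0 * a) + \<theta> * exp (l1 * a))"
      using 1 assms by (intro mult_left_mono) (auto simp: k_def E_def)
    moreover have majeq: "maj T l s = k * exp (l * a) - k" for l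
      unfolding maj_def la E_def[symmetric] k_def using True
        by (simp add: right_diff_distrib mult.assoc diff_divide_distrib)
    ultimately show ?thesis unfolding majeq by (simp add: algebra_simps)
  next
    case False
    define k where "k = knorm s * E"
    have "k * exp (((1 - \<theta>) * l0 + \<theta> * l1) * a) \<le> k * ((1 - \<theta>) * exp (l0 * a) + \<theta> * exp (l1 * a))"
      using 1 by (intro mult_left_mono) (auto simp: k_def E_def knorm_nonneg)
    moreover have majeq: "maj T l s = k * exp (l * a)" for l
      unfolding maj_def la E_def[symmetric] k_def using False by (simp add: mult.assoc)
    ultimately show ?thesis unfolding majeq by (simp add: algebra_simps)
  qed
qed

text \<open>The trapezoidal rule overestimates the integral of a convex function. Compared with
  \<open>y * exp y\<close> it gives half the weight to the undamaged Gaussian in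
  \<open>maj_le_1\<close>.\<close>

lemma exp_minus_1_le:
  assumes "0 \<le> (y::real)"
  shows "exp y - 1 \<le> y / 2 * (1 + exp y)"
proof -
  have d: "0 \<le> 1 + (y - 1) * exp y" if "0 \<le> y" for y :: real
    using that by (intro nonneg_from_deriv[of 0 y "\<lambda>y. 1 + (y - 1) * exp y" "\<lambda>y. y * exp y"])
      (auto intro!: derivative_eq_intros simp: algebra_simps)
  have "0 \<le> y / 2 * (1 + exp y) - (exp y - 1)"
    using assms d by (intro nonneg_from_deriv[of 0 y "\<lambda>y. y / 2 * (1 + exp y) - (exp y - 1)"
      "\<lambda>y. (1 + (y - 1) * exp y) / 2"])
      (auto intro!: derivative_eq_intros simp: field_simps)
  then show ?thesis by simp
qed

text \<open>Since \<open>s <= 1/2\<close>, one factor \<open>s\<close> of the cubic exponent can be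
  bounded away: \<open>l * t^3 / 10 <= t^2 * (l * T / 20)\<close>. Both terms of the trapezoidal
  bound are then genuine Gaussians, the second one wider by the factor \<open>1 - l * T / 10\<close>
  in the exponent.\<close>

lemma maj_le_1:
  assumes "0 < s" "s \<le> 1/2" "0 < T" "0 \<le> l"
  shows "maj T l s \<le> 0.052 * l * T^3 / pi * (s\<^sup>2 * exp (- (T / sqrt 2 * s)\<^sup>2) + s\<^sup>2 * exp (- (T\<^sup>2 * (1
    - l * T / 10) / 2) * s\<^sup>2))"
proof -
  define t where "t = s * T"
  define y where "y = l * t^3 / 10"
  have t: "0 < t" using assms by (simp add: t_def)
  have y: "0 \<le> y" using t assms by (simp add: y_def)
  have "y \<le> t\<^sup>2 * (l * T / 20)"
  proof -
    have "y = t\<^sup>2 * (l * T / 10) * s" by (simp add: y_def t_def power3_eq_cube power2_eq_square)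
    also have "\<dots> \<le> t\<^sup>2 * (l * T / 10) * (1 / 2)" using assms by (intro mult_left_mono) auto
    finally show ?thesis by simp
  qed
  then have "exp (- t\<^sup>2 / 2 + y) \<le> exp (- t\<^sup>2 / 2 + t\<^sup>2 * (l * T / 20))" by simp
  also have "- t\<^sup>2 / 2 + t\<^sup>2 * (l * T / 20) = - (T\<^sup>2 * (1 - l * T / 10) / 2) * s\<^sup>2"
    by (simp add: t_def power_mult_distrib field_simps)
  finally have 2: "exp (- t\<^sup>2 / 2 + y) \<le> exp (- (T\<^sup>2 * (1 - l * T / 10) / 2) * s\<^sup>2)" .
  have 1: "exp (- t\<^sup>2 / 2) = exp (- (T / sqrt 2 * s)\<^sup>2)"
    by (simp add: t_def power_mult_distrib power_divide mult.commute)
  have "maj T l s = 1.04 / (pi * s) * (exp (- t\<^sup>2 / 2) * (exp y - 1))"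
    using assms by (simp add: maj_def t_def y_def)
  also have "\<dots> \<le> 1.04 / (pi * s) * (exp (- t\<^sup>2 / 2) * (y / 2 * (1 + exp y)))"
    using exp_minus_1_le[OF y] assms by (intro mult_left_mono) auto
  also have "\<dots> = 1.04 / (pi * s) * (y / 2) * (exp (- t\<^sup>2 / 2) + exp (- t\<^sup>2 / 2 + y))"
  proof -
    have "A * (e * (y / 2 * (1 + f))) = A * (y / 2) * (e + e * f)" for A e f :: real
      by (simp add: field_simps)
    then show ?thesis unfolding exp_add .
  qed
  also have "1.04 / (pi * s) * (y / 2) = 0.052 * l * T^3 / pi * s\<^sup>2"
    using assms by (simp add: y_def t_def power3_eq_cube power2_eq_square field_simps)
  also have "0.052 * l * T^3 / pi * s\<^sup>2 * (exp (- t\<^sup>2 / 2) + exp (- t\<^sup>2 / 2 + y))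
      \<le> 0.052 * l * T^3 / pi * s\<^sup>2 * (exp (- (T / sqrt 2 * s)\<^sup>2) + exp (- (T\<^sup>2 * (1 - l * T / 10) / 2) * s\<^sup>2))"
    using 1 2 assms by (intro mult_left_mono add_mono) auto
  finally show ?thesis by (simp add: distrib_left mult.assoc)
qed

lemma maj_le_2:
  assumes "1/2 < s" "s < 1" "exp (- ((s * T)\<^sup>2 / 2 - l * (s * T)^3 / 10)) \<le> m"
  shows "maj T l s \<le> ((1 - s) + pi\<^sup>2 * (1 - s)^3 / 8) * m"
proof -
  have "pi * knorm s \<le> pi * ((1 - s) + pi\<^sup>2 * (1 - s)^3 / 8)"
    using kern_norm_le_2(1)[of s] assms
    by (simp add: knorm_def power_mult_distrib power3_eq_cube power2_eq_square algebra_simps)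
  then have k: "knorm s \<le> (1 - s) + pi\<^sup>2 * (1 - s)^3 / 8" by simp
  have "maj T l s = knorm s * exp (- ((s * T)\<^sup>2 / 2 - l * (s * T)^3 / 10))"
    using assms by (simp add: maj_def flip: exp_add)
  also have "\<dots> \<le> ((1 - s) + pi\<^sup>2 * (1 - s)^3 / 8) * m"
    using k assms knorm_nonneg[of s] by (intro mult_mono) auto
  finally show ?thesis .
qed

text \<open>Integration by parts with the primitive \<open>s * exp (- b * s^2)\<close>. The boundary
  term at \<open>1/2\<close> is kept because it is negative and is later balanced against the
  interval \<open>[1/2, 3/4]\<close>.\<close>

lemma half_integral_trunc:
  fixes b :: real
  assumes "0 < b"
  obtains v where "has_bochner_integral lborel (\<lambda>s. indicator {0..1/2} s *\<^sub>R (s\<^sup>2 * exp (- b * s\<^sup>2))) v"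
    "v \<le> 1 / (2 * b) * (sqrt pi / (2 * sqrt b) - exp (- b / 4) / 2)"
proof -
  define f where "f = (\<lambda>s::real. exp (- b * s\<^sup>2) - 2 * b * (s\<^sup>2 * exp (- b * s\<^sup>2)))"
  define I where "I = (\<lambda>g. LINT s|lborel. indicator {0..1/2::real} s *\<^sub>R (g s :: real))"
  have i: "set_integrable lborel {0..1/2} g" if "continuous_on {0..1/2} g" for g :: "real \<Rightarrow> real"
    by (rule borel_integrable_atLeastAtMost'[OF that])
  have i1: "integrable lborel (\<lambda>s. indicator {0..1/2} s *\<^sub>R exp (- b * s\<^sup>2))"
    and i2: "integrable lborel (\<lambda>s. indicator {0..1/2} s *\<^sub>R (s\<^sup>2 * exp (- b * s\<^sup>2)))"
    by (rule i[unfolded set_integrable_def]; intro continuous_intros)+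
  have "(LINT s|lborel. f s * indicator {0..1/2} s) = (1/2) * exp (- b * (1/2)\<^sup>2) - 0 * exp (- b * 0\<^sup>2)"
    unfolding f_def
    by (rule integral_FTC_Icc_real[of 0 "1/2" "\<lambda>s. s * exp (- b * s\<^sup>2)"])
       (auto intro!: derivative_eq_intros continuous_intros simp: power2_eq_square algebra_simps)
  moreover have "(LINT s|lborel. f s * indicator {0..1/2} s)
     = (LINT s|lborel. indicator {0..1/2} s *\<^sub>R exp (- b * s\<^sup>2)
       - 2 * b * (indicator {0..1/2} s *\<^sub>R (s\<^sup>2 * exp (- b * s\<^sup>2))))"
    by (intro Bochner_Integration.integral_cong refl) (simp add: f_def algebra_simps)
  moreover have "\<dots> = I (\<lambda>s. exp (- b * s\<^sup>2)) - 2 * b * I (\<lambda>s. s\<^sup>2 * exp (- b * s\<^sup>2))"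
    unfolding I_def Bochner_Integration.integral_diff[OF i1 integrable_mult_right[OF i2]]
      integral_mult_right_zero ..
  ultimately have 1: "I (\<lambda>s. exp (- b * s\<^sup>2)) - 2 * b * I (\<lambda>s. s\<^sup>2 * exp (- b * s\<^sup>2)) = exp (- b / 4) / 2"
    by (simp add: power2_eq_square)
  have g: "has_half_integral (\<lambda>s. exp (- b * s\<^sup>2)) (sqrt pi / (2 * sqrt b))"
    using half_gaussian_moments(1)[of "sqrt b"] assms by (simp add: power_mult_distrib)
  have "I (\<lambda>s. exp (- b * s\<^sup>2)) \<le> (LINT s|lborel. indicator {0..} s *\<^sub>R exp (- b * s\<^sup>2))"
    unfolding I_def using i1 g
    by (intro integral_mono) (auto simp: has_bochner_integral_iff indicator_def)
  also have "\<dots> = sqrt pi / (2 * sqrt b)" using g by (simp only: has_bochner_integral_iff)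
  finally have "2 * b * I (\<lambda>s. s\<^sup>2 * exp (- b * s\<^sup>2)) \<le> sqrt pi / (2 * sqrt b) - exp (- b / 4) / 2"
    using 1 by linarith
  then have "I (\<lambda>s. s\<^sup>2 * exp (- b * s\<^sup>2)) \<le> 1 / (2 * b) * (sqrt pi / (2 * sqrt b) - exp (- b / 4) / 2)"
    using assms by (simp add: field_simps)
  moreover have "has_bochner_integral lborel (\<lambda>s. indicator {0..1/2} s *\<^sub>R (s\<^sup>2 * exp (- b * s\<^sup>2))) (I (\<lambda>s. s\<^sup>2
    * exp (- b * s\<^sup>2)))"
    using i2 by (simp add: has_bochner_integral_iff I_def)
  ultimately show thesis by (rule that[rotated])
qed

lemma knorm_weight_integral:
  fixes a b :: real
  assumes "a \<le> b"
  shows "has_bochner_integral lborel (\<lambda>s. indicator {a..b} s *\<^sub>R ((1 - s) + pi\<^sup>2 * (1 - s)^3 / 8))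
     (((1 - a)\<^sup>2 - (1 - b)\<^sup>2) / 2 + pi\<^sup>2 * ((1 - a)^4 - (1 - b)^4) / 32)"
proof -
  have "has_bochner_integral lborel (\<lambda>s. ((1 - s) + pi\<^sup>2 * (1 - s)^3 / 8) * indicator {a..b} s)
     ((- (1 - b)\<^sup>2 / 2 - pi\<^sup>2 * (1 - b)^4 / 32) - (- (1 - a)\<^sup>2 / 2 - pi\<^sup>2 * (1 - a)^4 / 32))"
    by (rule has_bochner_integral_FTC_Icc_real[of a b "\<lambda>s. - (1 - s)\<^sup>2 / 2 - pi\<^sup>2 * (1 - s)^4 / 32"])
       (use assms in \<open>auto intro!: derivative_eq_intros continuous_intros simp: power2_eq_square field_simps\<close>)
  moreover have "(- (1 - b)\<^sup>2 / 2 - pi\<^sup>2 * (1 - b)^4 / 32) - (- (1 - a)\<^sup>2 / 2 - pi\<^sup>2 * (1 - a)^4 / 32)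
      = ((1 - a)\<^sup>2 - (1 - b)\<^sup>2) / 2 + pi\<^sup>2 * ((1 - a)^4 - (1 - b)^4) / 32"
    by (simp add: field_simps)
  ultimately show ?thesis by (simp only: mult.commute[of _ "indicator _ _"] real_scaleR_def)
qed

lemma maj_nonneg:
  assumes "0 < s" "0 \<le> l" "0 \<le> T"
  shows "0 \<le> maj T l s"
  using assms knorm_nonneg[of s] unfolding maj_def by (auto intro!: mult_nonneg_nonneg)

lemma set_integrable_maj:
  assumes "0 < T" "0 \<le> l"
  shows "set_integrable lborel {0<..<1} (maj T l)"
proof (rule set_integrable_unit_bounded[of _ "0.052 * l * T^3 / pi * (1 + exp (l * T^3)) + 4 * exp (l * T^3)"])
  define C where "C = 0.052 * l * T^3 / pi"
  have C: "0 \<le> C" using assms by (simp add: C_def)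
  have lT: "0 \<le> l * T^3" using assms by simp
  show "\<bar>maj T l s\<bar> \<le> 0.052 * l * T^3 / pi * (1 + exp (l * T^3)) + 4 * exp (l * T^3)" if s: "0 < s"
    "s < 1" for s
  proof -
    have le: "l * (s * T)^3 / 10 \<le> l * T^3"
    proof -
      have "(s * T)^3 \<le> (1 * T)^3" using s assms by (intro power_mono mult_right_mono) auto
      then have "l * (s * T)^3 \<le> l * T^3" using assms by (intro mult_left_mono) auto
      moreover have "0 \<le> l * (s * T)^3" using s assms by simp
      ultimately show ?thesis by simp
    qed
    have "maj T l s \<le> C * (1 + exp (l * T^3)) + 4 * exp (l * T^3)"
    proof (cases "s \<le> 1/2")
      case True
      define t where "t = s * T"
      define y where "y = l * t^3 / 10"
      have y: "0 \<le> y" using s assms by (simp add: y_def t_def)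
      have "maj T l s \<le> 1.04 / (pi * s) * (1 * (y / 2 * (1 + exp y)))"
      proof -
        have "exp (- t\<^sup>2 / 2) * (exp y - 1) \<le> 1 * (y / 2 * (1 + exp y))"
          by (rule mult_mono[OF _ exp_minus_1_le[OF y]]) (use y in auto)
        then have "1.04 / (pi * s) * (exp (- t\<^sup>2 / 2) * (exp y - 1)) \<le> 1.04 / (pi * s) * (1 * (y / 2 * (1
          + exp y)))"
          using s by (intro mult_left_mono) auto
        then show ?thesis using True by (simp only: maj_def t_def y_def if_True)
      qed
      also have "\<dots> = C * s\<^sup>2 * (1 + exp y)"
        using s by (simp add: C_def y_def t_def power3_eq_cube power2_eq_square field_simps)
      also have "\<dots> \<le> C * 1 * (1 + exp (l * T^3))"
        using le s C by (intro mult_mono add_left_mono) (auto simp: y_def t_def power_le_one)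
      also have "\<dots> \<le> C * (1 + exp (l * T^3)) + 4 * exp (l * T^3)" by simp
      finally show ?thesis .
    next
      case False
      have "maj T l s \<le> ((1 - s) + pi\<^sup>2 * (1 - s)^3 / 8) * exp (l * T^3)"
      proof (rule maj_le_2)
        have "0 \<le> (s * T)\<^sup>2 / 2" by simp
        then have "- ((s * T)\<^sup>2 / 2 - l * (s * T)^3 / 10) \<le> l * T^3" using le by linarith
        then show "exp (- ((s * T)\<^sup>2 / 2 - l * (s * T)^3 / 10)) \<le> exp (l * T^3)" by simp
      qed (use False s in auto)
      also have "\<dots> \<le> 4 * exp (l * T^3)"
      proof (rule mult_right_mono)
        have "pi\<^sup>2 * (1 - s)^3 \<le> 4\<^sup>2 * 1" using s pi_less_4
          by (intro mult_mono power_mono) (auto simp: power_le_one)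
        then show "(1 - s) + pi\<^sup>2 * (1 - s)^3 / 8 \<le> 4" using s by simp
      qed simp
      also have "\<dots> \<le> C * (1 + exp (l * T^3)) + 4 * exp (l * T^3)" using C by simp
      finally show ?thesis .
    qed
    then show ?thesis using maj_nonneg[of s l T] s assms by (simp add: C_def)
  qed
qed measurable

text \<open>The exponent \<open>t\<^sup>2 / 2 - l t\<^sup>3 / 10\<close> is unimodal in \<open>t\<close>, so it is minimal at the end points.\<close>
lemma exponent_ge_min:
  fixes l :: real
  assumes "0 \<le> a" "a \<le> t" "t \<le> b" "0 < l" "m \<le> a\<^sup>2 / 2 - l * a^3 / 10" "m \<le> b\<^sup>2 / 2 - l * b^3 / 10"
  shows "m \<le> t\<^sup>2 / 2 - l * t^3 / 10"
proof (cases "3 * l * t \<le> 10")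
  case True
  have "0 \<le> (t\<^sup>2 / 2 - l * t^3 / 10) - (a\<^sup>2 / 2 - l * a^3 / 10)"
  proof (rule nonneg_from_deriv[of a t "\<lambda>t. (t\<^sup>2 / 2 - l * t^3 / 10) - (a\<^sup>2 / 2 - l * a^3 / 10)"
    "\<lambda>t. t * (10 - 3 * l * t) / 10"])
    fix y assume y: "a \<le> y" "y \<le> t"
    have "l * y \<le> l * t" using y assms by (intro mult_left_mono) auto
    then have "3 * l * y \<le> 10" using True by linarith
    then have "0 \<le> y * (10 - 3 * l * y)" using y assms by (intro mult_nonneg_nonneg) auto
    then show "0 \<le> y * (10 - 3 * l * y) / 10" by simp
  qed (use assms in \<open>auto intro!: derivative_eq_intros simp: power2_eq_square field_simps\<close>)
  then show ?thesis using assms by linarith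
next
  case False
  have "0 \<le> (- (b\<^sup>2 / 2 - l * b^3 / 10)) + (t\<^sup>2 / 2 - l * t^3 / 10)"
  proof (rule nonneg_from_deriv[of t b "\<lambda>b. (- (b\<^sup>2 / 2 - l * b^3 / 10)) + (t\<^sup>2 / 2 - l * t^3 / 10)"
    "\<lambda>t. t * (3 * l * t - 10) / 10"])
    fix y assume y: "t \<le> y" "y \<le> b"
    have "l * t \<le> l * y" using y assms by (intro mult_left_mono) auto
    then have "10 \<le> 3 * l * y" using False by linarith
    then have "0 \<le> y * (3 * l * y - 10)" using y assms by (intro mult_nonneg_nonneg) auto
    then show "0 \<le> y * (3 * l * y - 10) / 10" by simp
  qed (use assms in \<open>auto intro!: derivative_eq_intros simp: power2_eq_square field_simps\<close>)
  then show ?thesis using assms by linarith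
qed

text \<open>Gaussian moments on \<open>(0, 1/2]\<close>; on the other three pieces the exponential
  is replaced by a constant, justified at the end points by \<open>exponent_ge_min\<close>. The
  decimals bound the integrals of \<open>(1 - s) + pi^2 * (1 - s)^3 / 8\<close> over these pieces.
  They shrink towards \<open>s = 1\<close>, where the exponent is worst.\<close>

lemma maj_integral_le:
  assumes T: "0 < T" and l: "0 < l" and lT: "l * T < 10"
  defines "q \<equiv> (\<lambda>t. t\<^sup>2 / 2 - l * t^3 / 10)"
  defines "\<mu> \<equiv> 1 - l * T / 10"
  assumes m1: "q1 \<le> q (T / 2)" "q1 \<le> q (3/4 * T)" and m2: "q2 \<le> q (3/4 * T)" "q2 \<le> q (7/8 * T)"
    and m3: "q3 \<le> q (7/8 * T)" "q3 \<le> q T"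
  shows "(LBINT s:{0<..<1}. maj T l s) \<le> 0.052 * l / pi * sqrt (pi / 2) * (1 + 1 / (\<mu> * sqrt \<mu>))
     + 0.11183 * exp (- q1) - 0.026 * l * T / (pi * \<mu>) * exp (- q (T / 2)) + 0.02457 * exp (- q2)
       + 0.00789 * exp (- q3)"
proof -
  define c where "c = 0.052 * l * T^3 / pi"
  define b where "b = T\<^sup>2 * \<mu> / 2"
  define k where "k = (\<lambda>s. (1 - s) + pi\<^sup>2 * (1 - s)^3 / 8)"
  have \<mu>: "0 < \<mu>" using lT by (simp add: \<mu>_def)
  have b: "0 < b" using T \<mu> by (simp add: b_def)
  have c: "0 \<le> c" using T l by (simp add: c_def)
  define c1 where "c1 = T / sqrt 2"
  have c1: "0 < c1" using T by (simp add: c1_def)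
  have k0: "0 \<le> k s" if "s \<le> 1" for s using that by (auto simp: k_def)
  obtain v where v: "has_bochner_integral lborel (\<lambda>s. indicator {0..1/2} s *\<^sub>R (s\<^sup>2 * exp (- b * s\<^sup>2))) v"
    "v \<le> 1 / (2 * b) * (sqrt pi / (2 * sqrt b) - exp (- b / 4) / 2)"
    using half_integral_trunc[OF b] by blast
  define W where "W = (\<lambda>a b. (((1 - a)\<^sup>2 - (1 - b)\<^sup>2) / 2 + pi\<^sup>2 * ((1 - a)^4 - (1 - b)^4) / 32) :: real)"
  have w: "has_bochner_integral lborel (\<lambda>s. indicator {a..b} s *\<^sub>R k s) (W a b)" if "a \<le> b" for a b
    unfolding W_def k_def by (rule knorm_weight_integral[OF that])
  define F where "F = (\<lambda>s. c * (indicator {0..} s *\<^sub>R (s\<^sup>2 * exp (- (c1 * s)\<^sup>2)))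
    + (c * (indicator {0..1/2} s *\<^sub>R (s\<^sup>2 * exp (- b * s\<^sup>2)))
     + (exp (- q1) * (indicator {1/2..3/4} s *\<^sub>R k s) + (exp (- q2) * (indicator {3/4..7/8} s *\<^sub>R k s)
       + exp (- q3) * (indicator {7/8..1} s *\<^sub>R k s)))))"
  define V where "V = c * (sqrt pi / (4 * c1^3)) + (c * v + (exp (- q1) * W (1/2) (3/4)
    + (exp (- q2) * W (3/4) (7/8) + exp (- q3) * W (7/8) 1)))"
  have FV: "has_bochner_integral lborel F V"
    unfolding F_def V_def
    by (intro has_bochner_integral_add has_bochner_integral_mult_right half_gaussian_moments(3) c1 v(1) w) auto
  have "(LBINT s:{0<..<1}. maj T l s) \<le> (LINT s|lborel. F s)"
    unfolding set_lebesgue_integral_def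
  proof (rule integral_mono)
    show "integrable lborel (\<lambda>s. indicator {0<..<1} s *\<^sub>R maj T l s)"
      using set_integrable_maj[OF T, of l] l by (simp add: set_integrable_def)
    show "integrable lborel F" using FV by (simp add: has_bochner_integral_iff)
    fix s :: real
    have pos: "0 \<le> c * (indicator {0..} s *\<^sub>R (s\<^sup>2 * exp (- (c1 * s)\<^sup>2)))"
      "0 \<le> c * (indicator {0..1/2} s *\<^sub>R (s\<^sup>2 * exp (- b * s\<^sup>2)))"
      "0 \<le> exp (- q1) * (indicator {1/2..3/4} s *\<^sub>R k s)"
      "0 \<le> exp (- q2) * (indicator {3/4..7/8} s *\<^sub>R k s)" "0 \<le> exp (- q3) * (indicator {7/8..1} s *\<^sub>R k s)"
      using c k0[of s] by (auto simp: indicator_def)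
    have qle: "exp (- ((s * T)\<^sup>2 / 2 - l * (s * T)^3 / 10)) \<le> exp (- m)"
      if "x \<le> s" "s \<le> y" "0 \<le> x" "m \<le> q (x * T)" "m \<le> q (y * T)" for x y m
      using exponent_ge_min[of "x * T" "s * T" "y * T" l m] that T l by (simp add: q_def)
    consider "s \<le> 0 \<or> 1 \<le> s" | "0 < s" "s \<le> 1/2" | "1/2 < s" "s \<le> 3/4" | "3/4 \<le> s" "s \<le> 7/8" | "7/8 \<le> s" "s < 1"
      by linarith
    then show "indicator {0<..<1} s *\<^sub>R maj T l s \<le> F s"
    proof cases
      case 1
      then have "indicator {0<..<1} s = (0::real)" by auto
      then show ?thesis using pos unfolding F_def by simp
    next
      case 2
      have "maj T l s \<le> c * (s\<^sup>2 * exp (- (c1 * s)\<^sup>2)) + c * (s\<^sup>2 * exp (- b * s\<^sup>2))"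
        using maj_le_1[of s T l] 2 T l by (simp add: c_def c1_def b_def \<mu>_def distrib_left)
      then show ?thesis using pos(3-5) 2 unfolding F_def by simp
    next
      case 3
      have "maj T l s \<le> k s * exp (- q1)"
        unfolding k_def using 3 qle[of "1/2" "3/4" q1] m1 by (intro maj_le_2) (auto simp: mult.commute)
      then show ?thesis using pos(1,2,4,5) 3 unfolding F_def by (simp add: mult.commute)
    next
      case 4
      have "maj T l s \<le> k s * exp (- q2)"
        unfolding k_def using 4 qle[of "3/4" "7/8" q2] m2 by (intro maj_le_2) auto
      then show ?thesis using pos(1-3,5) 4 unfolding F_def by (simp add: mult.commute)
    next
      case 5
      have "maj T l s \<le> k s * exp (- q3)"
        unfolding k_def using 5 qle[of "7/8" 1 q3] m3 by (intro maj_le_2) auto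
      then show ?thesis using pos(1-4) 5 unfolding F_def by (simp add: mult.commute)
    qed
  qed
  also have "\<dots> = V" using FV by (simp add: has_bochner_integral_iff)
  also have "V \<le> 0.052 * l / pi * sqrt (pi / 2) * (1 + 1 / (\<mu> * sqrt \<mu>))
     + 0.11183 * exp (- q1) - 0.026 * l * T / (pi * \<mu>) * exp (- q (T / 2)) + 0.02457 * exp (- q2)
       + 0.00789 * exp (- q3)"
  proof -
    have "pi\<^sup>2 \<le> 9.8697" using pi_bounds mult_mono[of pi "3.1416" pi "3.1416"] by (simp add: power2_eq_square)
    then have W: "W (1/2) (3/4) \<le> 0.11183" "W (3/4) (7/8) \<le> 0.02457" "W (7/8) 1 \<le> 0.00789"
      by (simp_all add: W_def power_divide)
    have 1: "c * (sqrt pi / (4 * c1^3)) = 0.052 * l / pi * sqrt (pi / 2)"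
      using T by (simp add: c_def c1_def power3_eq_cube real_sqrt_divide field_simps)
    have 2: "c * (1 / (2 * b) * (sqrt pi / (2 * sqrt b))) = 0.052 * l / pi * sqrt (pi / 2) * (1 / (\<mu> * sqrt \<mu>))"
      using T \<mu> by (simp add: c_def b_def real_sqrt_divide real_sqrt_mult power3_eq_cube power2_eq_square
        field_simps)
    have 3: "c * (1 / (2 * b) * (exp (- b / 4) / 2)) = 0.026 * l * T / (pi * \<mu>) * exp (- q (T / 2))"
    proof -
      have "b / 4 = q (T / 2)" by (simp add: b_def q_def \<mu>_def power2_eq_square power3_eq_cube field_simps)
      then have e: "exp (- b / 4) = exp (- q (T / 2))" by simp
      show ?thesis unfolding e using T \<mu> by (simp add: c_def b_def power3_eq_cube power2_eq_square field_simps)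
    qed
    have "c * v \<le> c * (1 / (2 * b) * (sqrt pi / (2 * sqrt b) - exp (- b / 4) / 2))"
      using v(2) c by (rule mult_left_mono)
    also have "\<dots> = 0.052 * l / pi * sqrt (pi / 2) * (1 / (\<mu> * sqrt \<mu>))
      - 0.026 * l * T / (pi * \<mu>) * exp (- q (T / 2))"
      using 2 3 by (simp add: right_diff_distrib)
    finally have "c * v \<le> 0.052 * l / pi * sqrt (pi / 2) * (1 / (\<mu> * sqrt \<mu>))
      - 0.026 * l * T / (pi * \<mu>) * exp (- q (T / 2))" .
    note cv = this
    have W': "exp (- q1) * W (1/2) (3/4) \<le> exp (- q1) * 0.11183"
      "exp (- q2) * W (3/4) (7/8) \<le> exp (- q2) * 0.02457" "exp (- q3) * W (7/8) 1 \<le> exp (- q3) * 0.00789"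
      by (rule mult_left_mono[OF W(1)] mult_left_mono[OF W(2)] mult_left_mono[OF W(3)]; simp)+
    have "P + (x + (w1 + (w2 + w3))) \<le> P * (1 + R) + c1 * e1 - Z * e0 + c2 * e2 + c3 * e3"
      if "x \<le> P * R - Z * e0" "w1 \<le> e1 * c1" "w2 \<le> e2 * c2" "w3 \<le> e3 * c3"
      for P R Z x w1 w2 w3 c1 c2 c3 e0 e1 e2 e3 :: real
      using that by (simp add: algebra_simps)
    from this[OF cv W'] show ?thesis unfolding V_def 1 .
  qed
  finally show ?thesis .
qed

text \<open>\<open>sqrt N * exp (- c * N)\<close> decreases from \<open>N = 1 / (2 * c)\<close> on,
  a point not beyond \<open>3\<close> when \<open>c >= 1 / 6\<close>. With
  \<open>N = 1 / l^2\<close> it turns exponentially small terms into multiples of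
  \<open>l\<close>.\<close>

lemma sqrt_exp_le:
  fixes c N :: real
  assumes "1 / 6 \<le> c" "3 \<le> N"
  shows "sqrt N * exp (- c * N) \<le> sqrt 3 * exp (- 3 * c)"
proof -
  define x where "x = N - 3"
  have x: "0 \<le> x" using assms by (simp add: x_def)
  have "sqrt (N / 3) \<le> 1 + x / 6"
    by (rule real_le_lsqrt) (use x zero_le_power2[of "N - 3"] in \<open>auto simp: x_def power2_eq_square
      field_simps\<close>)
  also have "\<dots> \<le> 1 + c * x" using assms x mult_right_mono[of "1/6" c x] by simp
  also have "\<dots> \<le> exp (c * x)" by (rule exp_ge_add_one_self)
  finally have "sqrt (N / 3) * (sqrt 3 * exp (- c * N)) \<le> exp (c * x) * (sqrt 3 * exp (- c * N))"
    by (intro mult_right_mono) auto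
  also have "\<dots> = sqrt 3 * (exp (c * x) * exp (- c * N))" by simp
  also have "exp (c * x) * exp (- c * N) = exp (- 3 * c)"
    unfolding exp_add[symmetric] by (simp add: x_def algebra_simps)
  also have "sqrt (N / 3) * (sqrt 3 * exp (- c * N)) = sqrt N * exp (- c * N)"
    by (simp add: real_sqrt_divide)
  finally show ?thesis .
qed

lemma sqrt_3_bounds: "1.73205 \<le> sqrt 3" "sqrt 3 \<le> (1.73206 :: real)"
  by (rule real_le_rsqrt real_le_lsqrt; simp add: power2_eq_square)+

lemma pi_power_bounds: "9.86958 \<le> pi\<^sup>2" "pi\<^sup>2 \<le> 9.86966" "31.00614 \<le> pi^3" "pi^3 \<le> 31.00653"
proof -
  have p: "3.14159 \<le> pi" "pi \<le> 3.1416" using pi_bounds by auto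
  have "3.14159\<^sup>2 \<le> pi\<^sup>2" "pi\<^sup>2 \<le> 3.1416\<^sup>2" "3.14159^3 \<le> pi^3" "pi^3 \<le> 3.1416^3"
    using p by (auto intro!: power_mono)
  then show "9.86958 \<le> pi\<^sup>2" "pi\<^sup>2 \<le> 9.86966" "31.00614 \<le> pi^3" "pi^3 \<le> 31.00653"
    by (simp_all add: power2_eq_square power3_eq_cube)
qed

lemma inverse_mult_sqrt_le:
  fixes \<mu> a b :: real
  assumes "0 < a" "a \<le> \<mu>" "0 < b" "b\<^sup>2 \<le> a"
  shows "1 / (\<mu> * sqrt \<mu>) \<le> 1 / (a * b)"
proof -
  have "b \<le> sqrt \<mu>" using assms by (intro real_le_rsqrt) auto
  then have "a * b \<le> \<mu> * sqrt \<mu>" using assms by (intro mult_mono) auto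
  then show ?thesis using assms by (intro divide_left_mono mult_pos_pos) auto
qed

text \<open>With the cut-off \<open>pi / l\<close> the product \<open>l * T\<close> is constant, so
  the Gaussian factor \<open>\<mu>\<close> is the number \<open>1 - pi / 10\<close> and all
  exponents scale with \<open>N = 1 / l^2 >= 3\<close>. Hence a bound linear in \<open>l\<close>, of
  which \<open>0.0574\<close> comes from \<open>(0, 1/2]\<close>.\<close>

lemma maj_integral_small:
  assumes l: "0 < l" "l \<le> 1 / sqrt 3"
  shows "(LBINT s:{0<..<1}. maj (pi / l) l s) \<le> 0.069 * l"
proof -
  define N where "N = 1 / l\<^sup>2"
  define T where "T = pi / l"
  define \<mu> where "\<mu> = 1 - l * T / 10"
  have T: "0 < T" "l * T = pi" using l by (auto simp: T_def)
  have \<mu>: "0.68584 \<le> \<mu>" "\<mu> \<le> 0.68585" unfolding \<mu>_def T(2) using pi_bounds by auto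
  have "l\<^sup>2 \<le> (1 / sqrt 3)\<^sup>2" using l by (intro power_mono) auto
  then have "l\<^sup>2 \<le> 1 / 3" by (simp add: power_divide)
  then have N: "3 \<le> N" using l by (simp add: N_def field_simps)
  have sN: "sqrt N = 1 / l" using l by (simp add: N_def real_sqrt_divide)
  have q: "(s * T)\<^sup>2 / 2 - l * (s * T)^3 / 10 = N * (pi\<^sup>2 * s\<^sup>2 / 2 - pi^3 * s^3 / 10)" for s
    using l by (simp add: N_def T_def power2_eq_square power3_eq_cube field_simps)
  have q1: "0.846 * N \<le> (1/2 * T)\<^sup>2 / 2 - l * (1/2 * T)^3 / 10"
    and q2: "1.467 * N \<le> (3/4 * T)\<^sup>2 / 2 - l * (3/4 * T)^3 / 10"
    and q3: "1.467 * N \<le> (7/8 * T)\<^sup>2 / 2 - l * (7/8 * T)^3 / 10"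
    and q4: "1.467 * N \<le> (1 * T)\<^sup>2 / 2 - l * (1 * T)^3 / 10"
    unfolding q using N pi_power_bounds
    by (subst mult.commute, intro mult_left_mono; simp add: power_divide)+
  have q12: "(1/2 * T)\<^sup>2 / 2 - l * (1/2 * T)^3 / 10 \<le> (3/4 * T)\<^sup>2 / 2 - l * (3/4 * T)^3 / 10"
    unfolding q using N pi_power_bounds by (intro mult_left_mono) (auto simp: power_divide)
  define Q where "Q = (T/2)\<^sup>2 / 2 - l * (T/2)^3 / 10"
  have Q: "0.846 * N \<le> Q" using q1 by (simp add: Q_def)
  have "(LBINT s:{0<..<1}. maj T l s) \<le> 0.052 * l / pi * sqrt (pi / 2) * (1 + 1 / (\<mu> * sqrt \<mu>))
     + 0.11183 * exp (- Q) - 0.026 * l * T / (pi * \<mu>) * exp (- Q) + 0.02457 * exp (- (1.467 * N))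
       + 0.00789 * exp (- (1.467 * N))"
    unfolding \<mu>_def Q_def
    by (rule maj_integral_le) (use T l q1 q2 q3 q4 q12 pi_less_4 in auto)
  moreover have "0.052 * l / pi * sqrt (pi / 2) * (1 + 1 / (\<mu> * sqrt \<mu>)) \<le> 0.0574 * l"
  proof -
    have "1 / (\<mu> * sqrt \<mu>) \<le> 1 / (0.68584 * 0.828)"
      by (rule inverse_mult_sqrt_le) (use \<mu> in \<open>auto simp: power2_eq_square\<close>)
    then have 1: "1 + 1 / (\<mu> * sqrt \<mu>) \<le> 2.762" by simp
    have "1 / pi \<le> 1 / 3.14159" using pi_bounds by (intro divide_left_mono) auto
    then have "1 / pi * sqrt (pi / 2) * (1 + 1 / (\<mu> * sqrt \<mu>)) \<le> 1 / 3.14159 * 1.2534 * 2.762"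
      using sqrt_pi_half_bounds 1 \<mu> by (intro mult_mono) auto
    also have "\<dots> \<le> 0.0574 / 0.052" by simp
    finally have "0.052 * l * (1 / pi * sqrt (pi / 2) * (1 + 1 / (\<mu> * sqrt \<mu>))) \<le> 0.052 * l * (0.0574 / 0.052)"
      using l by (intro mult_left_mono) auto
    then show ?thesis by simp
  qed
  \<comment> \<open>The exponent on \<open>[1/2, 3/4]\<close> was chosen as the exact value
    \<open>Q\<close> at the left end, so that the boundary term of the integration by parts can be
    subtracted from it.\<close>
  moreover have "0.11183 * exp (- Q) - 0.026 * l * T / (pi * \<mu>) * exp (- Q) \<le> 0.07393 * exp (- (0.846 * N))"
  proof -
    have "0.026 * l * T / (pi * \<mu>) = 0.026 / \<mu>" using T(2) by (simp add: mult.assoc)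
    moreover have "0.026 / 0.68585 \<le> 0.026 / \<mu>" using \<mu> by (intro divide_left_mono) auto
    ultimately have "0.11183 - 0.026 * l * T / (pi * \<mu>) \<le> 0.07393" by simp
    then have "(0.11183 - 0.026 * l * T / (pi * \<mu>)) * exp (- Q) \<le> 0.07393 * exp (- Q)"
      by (intro mult_right_mono) auto
    also have "\<dots> \<le> 0.07393 * exp (- (0.846 * N))" using Q by simp
    finally show ?thesis by (simp add: left_diff_distrib)
  qed
  moreover have "exp (- (0.846 * N)) \<le> 0.137 * l" "exp (- (1.467 * N)) \<le> 0.022 * l"
  proof -
    have *: "exp (- (c * N)) \<le> C * l" if "1 / 6 \<le> c" "sqrt 3 / C \<le> exp (3 * c)" "0 < C" for c C
    proof -
      have "1 / l * exp (- (c * N)) \<le> sqrt 3 * exp (- 3 * c)"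
        using sqrt_exp_le[OF that(1) N] unfolding sN by simp
      also have "\<dots> \<le> C" using that(2,3) by (simp add: exp_minus field_simps)
      finally show ?thesis using l by (simp add: field_simps)
    qed
    show "exp (- (0.846 * N)) \<le> 0.137 * l"
    proof (rule *)
      have "1.73206 / 0.137 \<le> exp (2.538 :: real)"
        using exp_ge_taylor[of "2.538" 10] by (simp add: eval_nat_numeral)
      then show "sqrt 3 / 0.137 \<le> exp (3 * 0.846)" using sqrt_3_bounds by simp
    qed auto
    show "exp (- (1.467 * N)) \<le> 0.022 * l"
    proof (rule *)
      have "1.73206 / 0.022 \<le> exp (4.401 :: real)"
        using exp_ge_taylor[of "4.401" 12] by (simp add: eval_nat_numeral)
      then show "sqrt 3 / 0.022 \<le> exp (3 * 1.467)" using sqrt_3_bounds by simp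
    qed auto
  qed
  moreover have "X \<le> 0.069 * l"
    if "X \<le> A + B - Z + 0.02457 * e + 0.00789 * e" "A \<le> 0.0574 * l" "B - Z \<le> 0.07393 * d" "d \<le> 0.137 * l"
      "e \<le> 0.022 * l"
    for X A B Z d e :: real using that l by simp
  ultimately have "(LBINT s:{0<..<1}. maj T l s) \<le> 0.069 * l" by blast
  then show ?thesis by (simp add: T_def)
qed

text \<open>The right end of the range of \<open>l\<close>: \<open>1.046\<close> slightly exceeds
  \<open>1 / (2 * 0.4786)\<close>, beyond which the bound \<open>1 / 2\<close> is good enough. Near
  \<open>s = 1\<close> the exponential has begun to grow, whence \<open>exp 2.1\<close>; the small
  weight \<open>0.00789\<close> of the last piece makes this tolerable.\<close>

lemma maj_integral_large: "(LBINT s:{0<..<1}. maj (pi * sqrt 3) 1.046 s) \<le> 0.26"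
proof -
  define T where "T = pi * sqrt 3"
  define \<mu> where "\<mu> = 1 - 1.046 * T / 10"
  have T: "5.4413 \<le> T" "T \<le> 5.4415"
  proof -
    have "3.14159 * 1.73205 \<le> pi * sqrt 3" "pi * sqrt 3 \<le> 3.1416 * 1.73206"
      using mult_mono[of "3.14159" pi "1.73205" "sqrt 3"] mult_mono[of pi "3.1416" "sqrt 3"
        "1.73206"] pi_bounds sqrt_3_bounds by simp_all
    then show "5.4413 \<le> T" "T \<le> 5.4415" by (simp_all add: T_def)
  qed
  have \<mu>: "0.4308 \<le> \<mu>" unfolding \<mu>_def using T by simp
  have "5.4413\<^sup>2 \<le> T\<^sup>2" "T\<^sup>2 \<le> 5.4415\<^sup>2" "5.4413^3 \<le> T^3" "T^3 \<le> 5.4415^3"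
    using T by (auto intro!: power_mono)
  then have T2: "29.6077 \<le> T\<^sup>2" "T\<^sup>2 \<le> 29.61" "161.1 \<le> T^3" "T^3 \<le> 161.13"
    by (simp_all add: power2_eq_square power3_eq_cube)
  have q: "(s * T)\<^sup>2 / 2 - 1.046 * (s * T)^3 / 10 = s\<^sup>2 / 2 * T\<^sup>2 - 0.1046 * s^3 * T^3" for s
    by (simp add: power_mult_distrib)
  have q1: "1.2 \<le> (1/2 * T)\<^sup>2 / 2 - 1.046 * (1/2 * T)^3 / 10"
    and q2: "1.2 \<le> (3/4 * T)\<^sup>2 / 2 - 1.046 * (3/4 * T)^3 / 10"
    and q3: "0 \<le> (7/8 * T)\<^sup>2 / 2 - 1.046 * (7/8 * T)^3 / 10"
    and q4: "- 2.1 \<le> (1 * T)\<^sup>2 / 2 - 1.046 * (1 * T)^3 / 10"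
    unfolding q using T2 by (simp_all add: power_divide)
  define Q where "Q = (T/2)\<^sup>2 / 2 - 1.046 * (T/2)^3 / 10"
  have "(LBINT s:{0<..<1}. maj T 1.046 s) \<le> 0.052 * 1.046 / pi * sqrt (pi / 2) * (1 + 1 / (\<mu> * sqrt \<mu>))
     + 0.11183 * exp (- 1.2) - 0.026 * 1.046 * T / (pi * \<mu>) * exp (- Q) + 0.02457 * exp (- 0)
       + 0.00789 * exp (- (- 2.1))"
    unfolding \<mu>_def Q_def
    by (rule maj_integral_le) (use T q1 q2 q3 q4 in auto)
  moreover have "0.052 * 1.046 / pi * sqrt (pi / 2) * (1 + 1 / (\<mu> * sqrt \<mu>)) \<le> 0.1"
  proof -
    have "1 / (\<mu> * sqrt \<mu>) \<le> 1 / (0.4308 * 0.656)"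
      by (rule inverse_mult_sqrt_le) (use \<mu> in \<open>auto simp: power2_eq_square\<close>)
    then have 1: "1 + 1 / (\<mu> * sqrt \<mu>) \<le> 4.539" by simp
    have "1 / pi \<le> 1 / 3.14159" using pi_bounds by (intro divide_left_mono) auto
    then have "1 / pi * sqrt (pi / 2) * (1 + 1 / (\<mu> * sqrt \<mu>)) \<le> 1 / 3.14159 * 1.2534 * 4.539"
      using sqrt_pi_half_bounds 1 \<mu> by (intro mult_mono) auto
    then have "0.052 * 1.046 * (1 / pi * sqrt (pi / 2) * (1 + 1 / (\<mu> * sqrt \<mu>)))
      \<le> 0.052 * 1.046 * (1 / 3.14159 * 1.2534 * 4.539)"
      by (intro mult_left_mono) auto
    also have "\<dots> \<le> 0.1" by simp
    finally show ?thesis by simp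
  qed
  moreover have "0 \<le> 0.026 * 1.046 * T / (pi * \<mu>) * exp (- Q)" using T \<mu> by simp
  moreover have "exp (- 1.2) \<le> (1 / 3 :: real)"
    using exp_ge_taylor[of "1.2" 4] by (simp add: exp_minus eval_nat_numeral field_simps)
  moreover have "exp (2.1 :: real) \<le> 9"
  proof -
    have "1 / 9 \<le> exp (- 2.1 :: real)"
      using exp_ge_one_minus_x_over_n_power_n[of "2.1" 42] by (simp add: power_divide)
    then show ?thesis by (simp add: exp_minus field_simps)
  qed
  moreover have "X \<le> 0.26"
    if "X \<le> A + 0.11183 * e - Z + 0.02457 * exp (- 0) + 0.00789 * exp (- (- 2.1))" "A \<le> 0.1" "0 \<le> Z"
      "e \<le> 1 / 3" "exp (2.1 :: real) \<le> 9"
    for X A Z e :: real using that by simp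
  ultimately have "(LBINT s:{0<..<1}. maj T 1.046 s) \<le> 0.26" by blast
  then show ?thesis by (simp add: T_def)
qed

text \<open>Covers the return of the characteristic function to modulus one in the two-point case.
  The majorant is the combination of \<open>tan\<close> and \<open>sin\<close> from
  \<open>kern_norm_le_2\<close>; the integrals are \<open>1 / n\<close> and
  \<open>1 / (n + 1)\<close> up to constants, so the contribution is of second order.\<close>

lemma cos_power_majorant:
  assumes n: "n \<ge> 1"
  obtains C where "has_bochner_integral lborel (\<lambda>s. indicator {1/2..1} s *\<^sub>R C s) ((7 / (12 * real n)
    + 5 / (12 * real (n + 1))) / pi\<^sup>2)"
    "\<And>s. 1/2 < s \<Longrightarrow> s < 1 \<Longrightarrow> knorm s * \<bar>cos (pi * s)\<bar>^n \<le> C s"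
    "\<And>s. 1/2 \<le> s \<Longrightarrow> s \<le> 1 \<Longrightarrow> 0 \<le> C s"
proof
  define C where "C = (\<lambda>s. (7/12 * (cos (pi * (1 - s))^(n - 1) * sin (pi * (1 - s))) + 5/12 * (cos (pi * (1
    - s))^n * sin (pi * (1 - s)))) / pi)"
  define F where "F = (\<lambda>s. (7/12 * (cos (pi * (1 - s))^n / (n * pi)) + 5/12 * (cos (pi * (1 - s))^(n
    + 1) / (real (n + 1) * pi))) / pi)"
  have "((\<lambda>s. cos (pi * (1 - s))^m / (real m * pi)) has_real_derivative cos (pi * (1 - s))^(m
    - 1) * sin (pi * (1 - s))) (at s)"
    if "m \<ge> 1" for m s
    using that by (auto intro!: derivative_eq_intros simp: field_simps)
  note d = this
  have "(F has_real_derivative C s) (at s)" for s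
    unfolding F_def C_def
    using DERIV_cdivide[OF DERIV_add[OF DERIV_cmult[OF d[OF n, of s], of "7/12"] DERIV_cmult[OF d[of
      "n + 1" s], of "5/12"]], of pi]
    by simp
  then have "has_bochner_integral lborel (\<lambda>s. C s * indicator {1/2..1} s) (F 1 - F (1/2))"
    by (intro has_bochner_integral_FTC_Icc_real) (auto simp: C_def intro!: continuous_intros)
  moreover have "F 1 - F (1/2) = (7 / (12 * real n) + 5 / (12 * real (n + 1))) / pi\<^sup>2"
  proof -
    have F1: "F 1 = (7/12 * (1 / (n * pi)) + 5/12 * (1 / (real (n + 1) * pi))) / pi" by (simp add: F_def)
    have F0: "F (1/2) = 0" using n by (simp add: F_def zero_power)
    show ?thesis unfolding F1 F0
      by (simp add: power2_eq_square add_divide_distrib mult_ac del: of_nat_Suc of_nat_add)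
  qed
  ultimately show "has_bochner_integral lborel (\<lambda>s. indicator {1/2..1} s *\<^sub>R C s) ((7 / (12 * real n)
    + 5 / (12 * real (n + 1))) / pi\<^sup>2)"
    by (simp add: mult.commute)
  show "knorm s * \<bar>cos (pi * s)\<bar>^n \<le> C s" if s: "1/2 < s" "s < 1" for s
  proof -
    define w where "w = pi * (1 - s)"
    have w: "0 < w" "w < pi / 2" using s by (auto simp: w_def field_simps)
    have cw: "cos w > 0" using w by (intro cos_gt_zero_pi) auto
    have "cos (pi * s) = - cos w" by (simp add: w_def right_diff_distrib cos_diff)
    then have "\<bar>cos (pi * s)\<bar> = cos w" using cw by simp
    moreover have "pi * knorm s * cos w ^ n \<le> (7/12 * tan w + 5/12 * sin w) * cos w ^ n"
      using kern_norm_le_2(2)[of s] s cw by (intro mult_right_mono) (auto simp: knorm_def w_def)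
    moreover have "tan w * cos w ^ n = cos w ^ (n - 1) * sin w"
      using cw n by (cases n) (auto simp: tan_def)
    ultimately have "pi * (knorm s * \<bar>cos (pi * s)\<bar>^n) \<le> 7/12 * (cos w ^ (n - 1) * sin w)
      + 5/12 * (cos w ^ n * sin w)"
      by (simp add: algebra_simps)
    then show ?thesis by (simp add: C_def w_def field_simps)
  qed
  show "0 \<le> C s" if s: "1/2 \<le> s" "s \<le> 1" for s
  proof -
    have w: "0 \<le> pi * (1 - s)" "pi * (1 - s) \<le> pi / 2" using s by (auto simp: field_simps)
    have "0 \<le> cos (pi * (1 - s))" by (rule cos_ge_zero) (use w pi_gt_zero in linarith)+
    moreover have "0 \<le> sin (pi * (1 - s))" by (rule sin_ge_zero) (use w pi_gt_zero in linarith)+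
    ultimately show ?thesis by (simp add: C_def)
  qed
qed

lemma cos_exp_le_1:
  assumes "0 \<le> u" "u \<le> pi"
  shows "cos u * exp (u\<^sup>2 / 2) \<le> 1"
proof -
  have "0 \<le> 1 - cos u * exp (u\<^sup>2 / 2)"
  proof (rule nonneg_from_deriv[of 0 u "\<lambda>u. 1 - cos u * exp (u\<^sup>2 / 2)" "\<lambda>u. (sin u - u * cos u) * exp (u\<^sup>2 / 2)"])
    show "0 \<le> (sin y - y * cos y) * exp (y\<^sup>2 / 2)" if "0 \<le> y" "y \<le> u" for y
      using sin_ge_x_cos[of y] that assms by simp
  qed (use assms in \<open>auto intro!: derivative_eq_intros simp: algebra_simps\<close>)
  then show ?thesis by simp
qed

text \<open>Multiplied by \<open>exp (t^2 / 2)\<close>, this is the power inequality with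
  \<open>p = exp (u^3 / 10)\<close> and \<open>q = cos u * exp (u^2 / 2)\<close>. Its use: the
  deviation of the \<open>n\<close>-th power below the Gaussian is controlled by the same expression
  as the deviation above it.\<close>

lemma gaussian_minus_cos_power_le:
  assumes n: "n \<ge> 3" and u: "0 \<le> u" "u \<le> pi / 2"
  defines "t \<equiv> sqrt (real n) * u"
  shows "exp (- t\<^sup>2 / 2) - cos u ^ n \<le> exp (- t\<^sup>2 / 2) * (exp (real n * u^3 / 10) - 1)"
proof -
  have q: "0 \<le> cos u * exp (u\<^sup>2 / 2)" using u by (intro mult_nonneg_nonneg cos_ge_zero) auto
  have "exp (u^3 / 10) ^ n + (cos u * exp (u\<^sup>2 / 2)) ^ n \<ge> 2"
  proof (rule power_sum_ge_2[OF _ q _ exp_cos_cube_sum_ge_2[OF u] n])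
    show "1 \<le> exp (u^3 / 10)" using u by simp
    show "cos u * exp (u\<^sup>2 / 2) \<le> 1" by (rule cos_exp_le_1) (use u pi_gt_zero in linarith)+
  qed
  moreover have "exp (u^3 / 10) ^ n = exp (real n * u^3 / 10)"
    by (simp flip: exp_of_nat_mult)
  moreover have "exp (u\<^sup>2 / 2) ^ n = exp (t\<^sup>2 / 2)"
    by (simp add: t_def power_mult_distrib flip: exp_of_nat_mult)
  ultimately have "exp (- t\<^sup>2 / 2) * 2 \<le> exp (- t\<^sup>2 / 2) * (exp (real n * u^3 / 10) + cos u ^ n * exp (t\<^sup>2 / 2))"
    by (intro mult_left_mono) (auto simp: power_mult_distrib)
  also have "\<dots> = exp (- t\<^sup>2 / 2) * exp (real n * u^3 / 10) + cos u ^ n"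
    by (simp add: distrib_left exp_minus)
  finally show ?thesis by (simp add: algebra_simps)
qed

lemma one_minus_power_le_exp:
  fixes x a :: real
  assumes "0 \<le> x" "x \<le> 1 + a / real n" "n \<ge> 1"
  shows "x ^ n \<le> exp a"
proof -
  have "x \<le> exp (a / real n)" using assms exp_ge_add_one_self[of "a / real n"] by linarith
  then have "x ^ n \<le> exp (a / real n) ^ n" using assms by (intro power_mono)
  then show ?thesis using assms by (simp flip: exp_of_nat_mult)
qed

text \<open>For \<open>s <= 1/2\<close> the value \<open>x\<close> is nonnegative and both
  deviations are at most \<open>e * (exp y - 1)\<close>, because \<open>1 / sqrt n <= l\<close>. For
  \<open>s > 1/2\<close> no cancellation is used. A negative \<open>x\<close> satisfies
  \<open>\<bar>x\<bar> <= \<bar>cos (pi * s)\<bar>\<close>, since \<open>T <= pi * sqrt n\<close>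
  places \<open>u\<close> below \<open>pi * s\<close>.\<close>

lemma pointwise_majorant:
  fixes x :: real
  assumes n: "n \<ge> 3" and l: "1 / sqrt n \<le> l" and T: "0 < T" "T \<le> pi * sqrt n" and s: "0 < s" "s < 1"
  defines "t \<equiv> s * T"
  assumes ub: "x \<le> 1 - t\<^sup>2 / (2 * n) + l * t^3 / (10 * n)"
    and lb: "cos (t / sqrt n) \<le> x" and x1: "\<bar>x\<bar> \<le> 1"
  shows "\<bar>pker \<theta> s * (x ^ n - exp (- t\<^sup>2 / 2))\<bar>
      \<le> maj T l s + (if s \<le> 1/2 then 0 else knorm s * \<bar>cos (pi * s)\<bar> ^ n)"
proof -
  define u where "u = t / sqrt n"
  define y where "y = l * t^3 / 10"
  define e where "e = exp (- t\<^sup>2 / 2)"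
  have n0: "0 < sqrt (real n)" using n by simp
  have t: "0 < t" using s T by (simp add: t_def)
  have u: "0 < u" "u \<le> pi * s" using T s n0 t by (auto simp: u_def t_def field_simps)
  have tu: "t = sqrt (real n) * u" using n0 by (simp add: u_def)
  have l0: "0 < l" using l n0 by (meson divide_pos_pos less_le_trans zero_less_one)
  have y: "0 \<le> y" using t l0 by (simp add: y_def)
  have e: "0 < e" by (simp add: e_def)
  have ub': "x \<le> 1 + (- t\<^sup>2 / 2 + y) / real n" using ub n by (simp add: y_def field_simps)
  have ey: "exp (- t\<^sup>2 / 2 + y) = e * exp y" unfolding e_def exp_add ..
  have xn: "x ^ n \<le> e * exp y" if "0 \<le> x"
    using one_minus_power_le_exp[OF that ub'] n ey by simp
  have eey: "e \<le> e * exp y" using y e by simp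
  show ?thesis
  proof (cases "s \<le> 1/2")
    case True
    have u2: "u \<le> pi / 2" using u(2) mult_left_mono[OF True pi_ge_zero] by linarith
    have cu: "0 \<le> cos u" using u u2 by (intro cos_ge_zero) auto
    then have x0: "0 \<le> x" using lb by (simp add: u_def)
    have "real n * u^3 / 10 = t^3 / 10 * (1 / sqrt n)"
      using n0 by (simp add: tu power3_eq_cube field_simps)
    also have "\<dots> \<le> t^3 / 10 * l" using l t by (intro mult_left_mono) auto
    finally have "exp (real n * u^3 / 10) \<le> exp y" by (simp add: y_def mult.commute)
    then have "e * (exp (real n * u^3 / 10) - 1) \<le> e * (exp y - 1)" using e by (intro mult_left_mono) auto
    moreover have "e - cos u ^ n \<le> e * (exp (real n * u^3 / 10) - 1)"
      using gaussian_minus_cos_power_le[OF n _ u2] u by (simp add: e_def tu)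
    ultimately have "e - cos u ^ n \<le> e * (exp y - 1)" by linarith
    moreover have "cos u ^ n \<le> x ^ n" using lb cu by (intro power_mono) (auto simp: u_def)
    ultimately have "\<bar>x ^ n - e\<bar> \<le> e * (exp y - 1)" using xn[OF x0] by (simp add: algebra_simps abs_le_iff)
    then have "\<bar>pker \<theta> s\<bar> * \<bar>x ^ n - e\<bar> \<le> 1.04 / (pi * s) * (e * (exp y - 1))"
      using abs_pker_le_knorm[of \<theta> s] kern_norm_le_1[OF s(1) True] unfolding knorm_def[symmetric]
      by (intro mult_mono) (use s in auto)
    then show ?thesis using True by (simp add: maj_def abs_mult e_def y_def t_def)
  next
    case False
    define C where "C = \<bar>cos (pi * s)\<bar>"
    have "\<bar>x ^ n - e\<bar> \<le> e * exp y + C ^ n"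
    proof (cases "0 \<le> x")
      case True
      then have "0 \<le> x ^ n" "x ^ n \<le> e * exp y" using xn by auto
      moreover have "0 \<le> C ^ n" by (simp add: C_def)
      ultimately show ?thesis using eey e by linarith
    next
      case False
      have us: "u \<le> pi" "pi * s \<le> pi" using u s by (auto intro: order_trans)
      have "cos (pi * s) \<le> cos u" using u us by (intro cos_monotone_0_pi_le) auto
      then have "\<bar>x\<bar> \<le> C" using False lb by (simp add: C_def u_def)
      then have "\<bar>x\<bar> ^ n \<le> C ^ n" by (intro power_mono) auto
      then have "\<bar>x ^ n\<bar> \<le> C ^ n" by (simp add: power_abs)
      then show ?thesis using eey e by linarith
    qed
    then have "\<bar>pker \<theta> s\<bar> * \<bar>x ^ n - e\<bar> \<le> knorm s * (e * exp y + C ^ n)"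
      using abs_pker_le_knorm[of \<theta> s] by (intro mult_mono) (auto simp: knorm_nonneg)
    then show ?thesis using False by (simp add: maj_def abs_mult e_def y_def t_def C_def distrib_left)
  qed
qed

lemma smoothed_power_integral_le:
  fixes g :: "real \<Rightarrow> real"
  assumes n: "n \<ge> 3" and l: "1 / sqrt n \<le> l" and T: "0 < T" "T \<le> pi * sqrt n"
    and [measurable]: "g \<in> borel_measurable borel"
    and ub: "\<And>t. 0 < t \<Longrightarrow> g t \<le> 1 - t\<^sup>2 / (2 * n) + l * t^3 / (10 * n)"
    and lb: "\<And>t. 0 < t \<Longrightarrow> t \<le> pi * sqrt n \<Longrightarrow> cos (t / sqrt n) \<le> g t"
    and g1: "\<And>t. \<bar>g t\<bar> \<le> 1"
  shows "(LBINT s:{0<..<1}. pker \<theta> s * g (s * T) ^ n)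
    \<le> (LBINT s:{0<..<1}. pker \<theta> s * exp (- (s * T)\<^sup>2 / 2)) + (LBINT s:{0<..<1}. maj T l s)
      + (7 / (12 * real n) + 5 / (12 * real (n + 1))) / pi\<^sup>2"
proof -
  have l0: "0 < l" using l n by (meson divide_pos_pos less_le_trans of_nat_0_less_iff real_sqrt_gt_zero
    zero_less_one zero_less_numeral)
  have n1: "n \<ge> 1" using n by simp
  obtain C where C: "has_bochner_integral lborel (\<lambda>s. indicator {1/2..1} s *\<^sub>R C s) ((7 / (12 * real n)
    + 5 / (12 * real (n + 1))) / pi\<^sup>2)"
    "\<And>s. 1/2 < s \<Longrightarrow> s < 1 \<Longrightarrow> knorm s * \<bar>cos (pi * s)\<bar>^n \<le> C s"
    "\<And>s. 1/2 \<le> s \<Longrightarrow> s \<le> 1 \<Longrightarrow> 0 \<le> C s"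
    using cos_power_majorant[OF n1] by blast
  define e where "e = (\<lambda>s. exp (- (s * T)\<^sup>2 / 2))"
  have bnd: "set_integrable lborel {0<..<1} (\<lambda>s. pker \<theta> s * h s)"
    if [measurable]: "h \<in> borel_measurable borel" and h: "\<And>s. \<bar>h s\<bar> \<le> 1" for h
  proof (rule set_integrable_unit_bounded[of _ "(1 + \<bar>\<theta>\<bar> / pi) * 1"])
    show "\<bar>pker \<theta> s * h s\<bar> \<le> (1 + \<bar>\<theta>\<bar> / pi) * 1" if "0 < s" "s < 1" for s
      unfolding abs_mult using abs_pker_le[OF that] h by (intro mult_mono) auto
  qed measurable
  have i1: "set_integrable lborel {0<..<1} (\<lambda>s. pker \<theta> s * g (s * T) ^ n)"
    by (rule bnd) (use g1 in \<open>auto simp: power_abs power_le_one\<close>)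
  have i2: "set_integrable lborel {0<..<1} (\<lambda>s. pker \<theta> s * e s)"
    by (rule bnd) (auto simp: e_def)
  have i3: "set_integrable lborel {0<..<1} (maj T l)" using set_integrable_maj T l0 by simp
  have "(LBINT s:{0<..<1}. pker \<theta> s * g (s * T) ^ n) - (LBINT s:{0<..<1}. pker \<theta> s * e s)
     = (LBINT s:{0<..<1}. pker \<theta> s * g (s * T) ^ n - pker \<theta> s * e s)"
    by (rule set_integral_diff(2)[symmetric, OF i1 i2])
  also have "\<dots> \<le> (LINT s|lborel. indicator {0<..<1} s *\<^sub>R maj T l s + indicator {1/2..1} s *\<^sub>R C s)"
    unfolding set_lebesgue_integral_def
  proof (rule integral_mono)
    show "integrable lborel (\<lambda>s. indicator {0<..<1} s *\<^sub>R (pker \<theta> s * g (s * T) ^ n - pker \<theta> s * e s))"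
      using set_integral_diff(1)[OF i1 i2] by (simp add: set_integrable_def)
    show "integrable lborel (\<lambda>s. indicator {0<..<1} s *\<^sub>R maj T l s + indicator {1/2..1} s *\<^sub>R C s)"
      using i3 C(1) by (intro Bochner_Integration.integrable_add) (auto simp: set_integrable_def
        has_bochner_integral_iff)
    fix s :: real
    show "indicator {0<..<1} s *\<^sub>R (pker \<theta> s * g (s * T) ^ n - pker \<theta> s * e s)
        \<le> indicator {0<..<1} s *\<^sub>R maj T l s + indicator {1/2..1} s *\<^sub>R C s"
    proof (cases "0 < s \<and> s < 1")
      case True
      then have s: "0 < s" "s < 1" by auto
      have st: "0 < s * T" using s T by simp
      have "s * T \<le> 1 * (pi * sqrt n)" using s T by (intro mult_mono) auto
      then have "cos (s * T / sqrt n) \<le> g (s * T)" using lb[OF st] by simp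
      then have "\<bar>pker \<theta> s * (g (s * T) ^ n - exp (- (s * T)\<^sup>2 / 2))\<bar>
          \<le> maj T l s + (if s \<le> 1/2 then 0 else knorm s * \<bar>cos (pi * s)\<bar> ^ n)"
        by (intro pointwise_majorant n l T s ub st g1)
      also have "\<dots> \<le> maj T l s + indicator {1/2..1} s *\<^sub>R C s"
        using C(2)[of s] C(3)[of s] s by (auto simp: indicator_def)
      finally have "pker \<theta> s * g (s * T) ^ n - pker \<theta> s * e s \<le> maj T l s + indicator {1/2..1} s *\<^sub>R C s"
        by (simp add: e_def right_diff_distrib abs_le_iff)
      then show ?thesis using s by simp
    next
      case False
      then have "indicator {0<..<1} s = (0::real)" by auto
      then show ?thesis using C(3)[of s] False by (auto simp: indicator_def)
    qed
  qed
  also have "\<dots> = (LBINT s:{0<..<1}. maj T l s) + (7 / (12 * real n) + 5 / (12 * real (n + 1))) / pi\<^sup>2"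
    using i3 C(1) by (subst Bochner_Integration.integral_add) (auto simp: set_integrable_def
      set_lebesgue_integral_def has_bochner_integral_iff)
  finally show ?thesis by (simp add: e_def)
qed

text \<open>The cut-off is \<open>T = pi / l\<close> for \<open>l \<le> 1 / sqrt 3\<close> and \<open>T = pi * sqrt 3\<close> beyond, where the bound is convex in \<open>l\<close>.\<close>
lemma smoothed_power_minus_Phi_le:
  fixes g :: "real \<Rightarrow> real"
  assumes n: "n \<ge> 3" and l: "1 / sqrt n \<le> l" and l1: "l \<le> 1.046"
    and g: "g \<in> borel_measurable borel"
    and ub: "\<And>t. 0 < t \<Longrightarrow> g t \<le> 1 - t\<^sup>2 / (2 * n) + l * t^3 / (10 * n)"
    and lb: "\<And>t. 0 < t \<Longrightarrow> t \<le> pi * sqrt n \<Longrightarrow> cos (t / sqrt n) \<le> g t"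
    and g1: "\<And>t. \<bar>g t\<bar> \<le> 1"
  obtains T where "0 < T" "\<And>x. (LBINT s:{0<..<1}. pker (T * x) s * g (s * T) ^ n) - (Phi x - 1 / 2)
    \<le> 0.4786 * l"
proof -
  note goal = that
  define cp where "cp = (7 / (12 * real n) + 5 / (12 * real (n + 1))) / pi\<^sup>2"
  have l0: "0 < l" using l n by (meson divide_pos_pos less_le_trans of_nat_0_less_iff real_sqrt_gt_zero
    zero_less_one zero_less_numeral)
  have s3: "5.44 \<le> pi * sqrt 3"
    using mult_mono[of "3.14159" pi "1.73205" "sqrt 3"] pi_bounds sqrt_3_bounds by simp
  have main: thesis if T: "pi * sqrt 3 \<le> T" "T \<le> pi * sqrt n"
    and le: "(sqrt (pi / 2) - 0.78 / T) / T + (LBINT s:{0<..<1}. maj T l s) + cp \<le> 0.4786 * l" for T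
  proof (rule goal)
    show T0: "0 < T" using T s3 by simp
    show "(LBINT s:{0<..<1}. pker (T * x) s * g (s * T) ^ n) - (Phi x - 1 / 2) \<le> 0.4786 * l" for x
      using smoothed_power_integral_le[OF n l T0 T(2) g ub lb g1, of
        "T * x"] smoothed_gaussian_minus_Phi_le[of T x] le T s3
      unfolding cp_def by linarith
  qed
  show thesis
  proof (cases "l \<le> 1 / sqrt 3")
    case True
    define T where "T = pi / l"
    have "sqrt 3 * l \<le> 1" using True by (simp add: field_simps)
    then have T1: "pi * sqrt 3 \<le> T" using l0 by (simp add: T_def field_simps)
    have "1 \<le> l * sqrt n" using l n by (simp add: field_simps)
    then have T2: "T \<le> pi * sqrt n" using l0 by (simp add: T_def field_simps)
    have "1\<^sup>2 \<le> (l * sqrt n)\<^sup>2" using \<open>1 \<le> l * sqrt n\<close> by (intro power_mono) auto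
    then have ln: "1 \<le> l\<^sup>2 * n" by (simp add: power_mult_distrib)
    have l2: "l\<^sup>2 \<le> 1/3"
    proof -
      have "l\<^sup>2 \<le> (1 / sqrt 3)\<^sup>2" using True l0 by (intro power_mono) auto
      then show ?thesis by (simp add: power_divide)
    qed
    have cp: "cp \<le> 0.10133 * (l\<^sup>2 * (1 - 5/16 * l\<^sup>2))"
    proof -
      define y where "y = l\<^sup>2"
      have y: "0 < y" "y \<le> 1/3" using l2 l0 by (auto simp: y_def)
      have 1: "1 / real n \<le> y" using ln n by (simp add: field_simps y_def)
      \<comment> \<open>Extracts the gain of \<open>1 / (n + 1)\<close> over \<open>1 / n\<close>;
        \<open>3/4 = 1 / (1 + 1/3)\<close> is the largest factor admissible up to
        \<open>y = 1/3\<close>, and \<open>5/16\<close> is \<open>5/12 * 3/4\<close>.\<close>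
      have "1 \<le> (1 - 3/4 * y) * (1 + y)"
        using mult_nonneg_nonneg[of y "1/3 - y"] y by (simp add: algebra_simps)
      then have "y * 1 \<le> y * ((1 - 3/4 * y) * (1 + y))" using y by (intro mult_left_mono) auto
      moreover have "(1 - 3/4 * y) * (1 + y) \<le> (1 - 3/4 * y) * (y * real (n + 1))"
        using ln y by (intro mult_left_mono) (auto simp: y_def algebra_simps)
      then have "y * ((1 - 3/4 * y) * (1 + y)) \<le> y * ((1 - 3/4 * y) * (y * real (n + 1)))"
        using y by (intro mult_left_mono) auto
      ultimately have "y * 1 \<le> y * ((1 - 3/4 * y) * (y * real (n + 1)))" by linarith
      then have "1 \<le> (1 - 3/4 * y) * (y * real (n + 1))" using y by (simp only: mult_le_cancel_left_pos)
      then have 2: "1 / real (n + 1) \<le> y * (1 - 3/4 * y)" by (simp add: field_simps)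
      have "cp = (7/12 * (1 / real n) + 5/12 * (1 / real (n + 1))) * (1 / pi\<^sup>2)" by (simp add: cp_def)
      also have "\<dots> \<le> (7/12 * y + 5/12 * (y * (1 - 3/4 * y))) * 0.10133"
      proof (rule mult_mono)
        show "1 / pi\<^sup>2 \<le> 0.10133" using pi_power_bounds(1) by (simp add: divide_le_eq)
        show "7/12 * (1 / real n) + 5/12 * (1 / real (n + 1)) \<le> 7/12 * y + 5/12 * (y * (1 - 3/4 * y))"
          using 1 2 by linarith
        show "0 \<le> 7/12 * y + 5/12 * (y * (1 - 3/4 * y))" using y
          by (intro add_nonneg_nonneg mult_nonneg_nonneg) auto
      qed simp
      finally show ?thesis by (simp add: y_def[symmetric] algebra_simps)
    qed
    have "(sqrt (pi / 2) - 0.78 / T) / T \<le> l * (0.39898 - 0.079 * l)"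
    proof -
      have "(sqrt (pi / 2) - 0.78 / T) / T = l * (sqrt (pi / 2) / pi - 0.78 / pi\<^sup>2 * l)"
        using l0 by (simp add: T_def power2_eq_square field_simps)
      also have "\<dots> \<le> l * (0.39898 - 0.079 * l)"
      proof (intro mult_left_mono diff_mono mult_right_mono)
        show "sqrt (pi / 2) / pi \<le> 0.39898"
          using sqrt_pi_half_bounds pi_bounds by (simp add: divide_le_eq)
        show "0.079 \<le> 0.78 / pi\<^sup>2" using pi_power_bounds(2) by (simp add: le_divide_eq)
      qed (use l0 in auto)
      finally show ?thesis .
    qed
    moreover have "(LBINT s:{0<..<1}. maj T l s) \<le> 0.069 * l"
      unfolding T_def by (rule maj_integral_small[OF l0 True])
    moreover have "l * (0.39898 - 0.079 * l) + 0.069 * l + 0.10133 * (l\<^sup>2 * (1 - 5/16 * l\<^sup>2)) \<le> 0.4786 * l"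
    proof -
      \<comment> \<open>The tangent to \<open>l^3\<close> at \<open>0.485\<close>, which is near the
        maximiser of the cubic to be bounded.\<close>
      have "0 \<le> (l - 0.485)\<^sup>2 * (l + 0.97)" using l0 by (intro mult_nonneg_nonneg) auto
      then have "l^3 \<ge> 0.705675 * l - 0.22816825"
        by (simp add: power2_eq_square power3_eq_cube field_simps)
      then have "0.39898 - 0.079 * l + 0.069 + 0.10133 * l - 0.10133 * 5/16 * l^3 \<le> 0.4786"
        using l0 by simp
      then have "l * (0.39898 - 0.079 * l + 0.069 + 0.10133 * l - 0.10133 * 5/16 * l^3) \<le> l * 0.4786"
        using l0 by (intro mult_left_mono) auto
      then show ?thesis by (simp add: power2_eq_square power3_eq_cube field_simps)
    qed
    ultimately show thesis using cp by (intro main[OF T1 T2]) linarith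
  next
    case False
    define l0 where "l0 = 1 / sqrt (3::real)"
    define T where "T = pi * sqrt 3"
    define \<theta> where "\<theta> = (l - l0) / (1.046 - l0)"
    have l0b: "0.57733 \<le> l0" "l0 \<le> 0.57736"
      using sqrt_3_bounds by (auto simp: l0_def field_simps)
    have "\<theta> * (1.046 - l0) = l - l0" using l0b by (simp add: \<theta>_def)
    then have "l = (1 - \<theta>) * l0 + \<theta> * 1.046" by (simp add: algebra_simps)
    moreover have "0 \<le> \<theta>" "\<theta> \<le> 1"
      using False l1 l0b by (auto simp: \<theta>_def l0_def[symmetric] divide_le_eq)
    ultimately have \<theta>: "0 \<le> \<theta>" "\<theta> \<le> 1" "l = (1 - \<theta>) * l0 + \<theta> * 1.046" by auto
    have T2: "T \<le> pi * sqrt n" using n by (simp add: T_def)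
    have T3: "5.4413 \<le> T" "T \<le> 5.4415"
    using mult_mono[of "3.14159" pi "1.73205" "sqrt 3"] mult_mono[of pi "3.1416" "sqrt 3"
      "1.73206"] pi_bounds sqrt_3_bounds
    by (simp_all add: T_def)
    have T0: "0 < T" using T3 by simp
    have Tl0: "T = pi / l0" by (simp add: T_def l0_def)
    have cp: "cp \<le> 0.03026"
    proof -
      have "cp = (7/12 * (1 / real n) + 5/12 * (1 / real (n + 1))) * (1 / pi\<^sup>2)" by (simp add: cp_def)
      also have "\<dots> \<le> (7/12 * (1/3) + 5/12 * (1/4)) * (1 / 9.86958)"
        using n pi_power_bounds(1) by (intro mult_mono add_mono divide_left_mono) auto
      finally show ?thesis by simp
    qed
    have nrm: "(sqrt (pi / 2) - 0.78 / T) / T \<le> 0.20403"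
    proof -
      have "0.78 / 5.4415 \<le> 0.78 / T" using T3 by (intro divide_left_mono) auto
      then have "(sqrt (pi / 2) - 0.78 / T) / T \<le> (1.2534 - 0.78 / 5.4415) / T"
        using sqrt_pi_half_bounds T0 by (intro divide_right_mono) auto
      also have "\<dots> \<le> (1.2534 - 0.78 / 5.4415) / 5.4413"
        using T3 by (intro divide_left_mono) auto
      also have "\<dots> \<le> 0.20403" by simp
      finally show ?thesis .
    qed
    define J where "J = (\<lambda>l. LBINT s:{0<..<1}. maj T l s)"
    have J0: "J l0 \<le> 0.069 * l0" unfolding J_def Tl0 by (rule maj_integral_small) (use l0b in \<open>auto simp:
      l0_def\<close>)
    have J1: "J 1.046 \<le> 0.26" unfolding J_def T_def by (rule maj_integral_large)
    have i: "set_integrable lborel {0<..<1} (maj T l')" if "0 \<le> l'" for l'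
      by (rule set_integrable_maj[OF T0 that])
    have "J l \<le> (LBINT s:{0<..<1}. (1 - \<theta>) * maj T l0 s + \<theta> * maj T 1.046 s)"
      unfolding J_def
    proof (rule set_integral_mono)
      show "set_integrable lborel {0<..<1} (maj T l)" using l0 by (intro i) auto
      show "set_integrable lborel {0<..<1} (\<lambda>s. (1 - \<theta>) * maj T l0 s + \<theta> * maj T 1.046 s)"
        using l0b by (intro set_integral_add(1) set_integrable_mult_right i) auto
      show "maj T l s \<le> (1 - \<theta>) * maj T l0 s + \<theta> * maj T 1.046 s" if "s \<in> {0<..<1}" for s
        unfolding \<theta>(3) using maj_convex[of \<theta> s T l0 "1.046"] \<theta>(1,2) that by auto
    qed
    also have "\<dots> = (1 - \<theta>) * J l0 + \<theta> * J 1.046"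
      unfolding J_def using l0b by (subst set_integral_add(2)) (auto intro!: set_integrable_mult_right i)
    also have "\<dots> \<le> (1 - \<theta>) * (0.069 * l0) + \<theta> * 0.26"
      using J0 J1 \<theta> by (intro add_mono mult_left_mono) auto
    \<comment> \<open>The values at both end points lie below the line
      \<open>0.4786 * l - 0.2343\<close>; the constant \<open>0.2343\<close> reserves
      \<open>0.20403\<close> for the smoothing error and \<open>0.03026\<close> for the cosine
      powers.\<close>
    also have "\<dots> \<le> (1 - \<theta>) * (0.4786 * l0 - 0.2343) + \<theta> * (0.4786 * 1.046 - 0.2343)"
      using l0b \<theta> by (intro add_mono mult_left_mono) auto
    also have "\<dots> = 0.4786 * l - 0.2343" unfolding \<theta>(3) by (simp add: field_simps)
    finally have "J l \<le> 0.4786 * l - 0.2343" .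
    moreover have "X + Y + Z \<le> 0.4786 * l" if "Y \<le> 0.4786 * l - 0.2343" "X \<le> 0.20403"
      "Z \<le> 0.03026" for X Y Z :: real
      using that by simp
    ultimately have "(sqrt (pi / 2) - 0.78 / T) / T + J l + cp \<le> 0.4786 * l" using nrm cp by blast
    then show thesis using T2 by (intro main[of T]) (auto simp: J_def T_def)
  qed
qed

section \<open>A Berry--Esseen inequality for symmetric summands\<close>

context prob_space
begin

section \<open>Characteristic functions of symmetric random variables\<close>

lemma char_distr_eq:
  fixes Y :: "'a \<Rightarrow> real"
  assumes [measurable]: "Y \<in> borel_measurable M"
  shows "char (distr M borel Y) t = Complex (expectation (\<lambda>\<omega>. cos (t * Y \<omega>))) (expectation (\<lambda>\<omega>. sin (t * Y \<omega>)))"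
proof -
  have i: "integrable M (\<lambda>\<omega>. iexp (t * Y \<omega>))" by (rule integrable_iexp) auto
  have "char (distr M borel Y) t = expectation (\<lambda>\<omega>. iexp (t * Y \<omega>))"
    unfolding char_def by (rule integral_distr) auto
  then have "Re (char (distr M borel Y) t) = expectation (\<lambda>\<omega>. cos (t * Y \<omega>))"
    "Im (char (distr M borel Y) t) = expectation (\<lambda>\<omega>. sin (t * Y \<omega>))"
    using integral_Re[OF i] integral_Im[OF i] by (simp_all add: Re_exp Im_exp)
  then show ?thesis by (simp add: complex_eq_iff)
qed

lemma symmetric_imp_odd:
  fixes Y :: "'a \<Rightarrow> real"
  assumes [measurable]: "Y \<in> borel_measurable M" and symm: "distr M borel (\<lambda>\<omega>. - Y \<omega>) = distr M borel Y"
  shows "expectation (\<lambda>\<omega>. sin (t * Y \<omega>)) = 0"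
proof -
  have "char (distr M borel (\<lambda>\<omega>. - Y \<omega>)) t = char (distr M borel Y) t" by (simp add: symm)
  then show ?thesis by (simp add: char_distr_eq)
qed

text \<open>Vanishing sine moments make the characteristic function real, so \<open>Y\<close> and
  \<open>- Y\<close> share it. This transfers symmetry from the summands to their sum.\<close>

lemma odd_imp_symmetric:
  fixes Y :: "'a \<Rightarrow> real"
  assumes [measurable]: "Y \<in> borel_measurable M" and odd: "\<And>t. expectation (\<lambda>\<omega>. sin (t * Y \<omega>)) = 0"
  shows "distr M borel (\<lambda>\<omega>. - Y \<omega>) = distr M borel Y"
  by (rule Levy_uniqueness) (auto intro!: real_distribution_distr ext simp: char_distr_eq odd)

lemma symmetric_prob_le:
  fixes Y :: "'a \<Rightarrow> real"
  assumes [measurable]: "Y \<in> borel_measurable M" and symm: "distr M borel (\<lambda>\<omega>. - Y \<omega>) = distr M borel Y"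
  shows "prob {\<omega> \<in> space M. Y \<omega> \<le> - y} = prob {\<omega> \<in> space M. y \<le> Y \<omega>}"
proof -
  have "prob {\<omega> \<in> space M. y \<le> Y \<omega>} = measure (distr M borel Y) {y..}"
    by (subst measure_distr) (auto intro!: arg_cong[where f=prob])
  also have "\<dots> = measure (distr M borel (\<lambda>\<omega>. - Y \<omega>)) {y..}" by (simp only: symm)
  also have "\<dots> = prob {\<omega> \<in> space M. Y \<omega> \<le> - y}"
    by (subst measure_distr) (auto intro!: arg_cong[where f=prob])
  finally show ?thesis ..
qed

lemma symmetric_prob_less:
  fixes Y :: "'a \<Rightarrow> real"
  assumes Y[measurable]: "Y \<in> borel_measurable M" and symm: "distr M borel (\<lambda>\<omega>. - Y \<omega>) = distr M borel Y"
  shows "prob {\<omega> \<in> space M. Y \<omega> < y} = 1 - prob {\<omega> \<in> space M. Y \<omega> \<le> - y}"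
proof -
  have "prob {\<omega> \<in> space M. Y \<omega> < y} = 1 - prob {\<omega> \<in> space M. \<not> Y \<omega> < y}"
    using prob_neg[of "\<lambda>\<omega>. Y \<omega> < y"] by (simp add: borel_measurable_less)
  then show ?thesis using symmetric_prob_le[OF assms, of y] by (simp add: not_less)
qed

lemma symmetric_prob_neg_le_half:
  fixes Y :: "'a \<Rightarrow> real"
  assumes Y[measurable]: "Y \<in> borel_measurable M" and symm: "distr M borel (\<lambda>\<omega>. - Y \<omega>) = distr M borel Y"
    and y: "y < 0"
  shows "2 * prob {\<omega> \<in> space M. Y \<omega> \<le> y} = prob {\<omega> \<in> space M. - y \<le> \<bar>Y \<omega>\<bar>}"
proof -
  have "prob {\<omega> \<in> space M. - y \<le> \<bar>Y \<omega>\<bar>} = prob ({\<omega> \<in> space M. Y \<omega> \<le> y} \<union> {\<omega> \<in> space M. - y \<le> Y \<omega>})"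
    by (rule arg_cong[where f=prob]) auto
  also have "\<dots> = prob {\<omega> \<in> space M. Y \<omega> \<le> y} + prob {\<omega> \<in> space M. - y \<le> Y \<omega>}"
    using y by (intro finite_measure_Union) auto
  finally show ?thesis using symmetric_prob_le[OF Y symm, of "- y"] by simp
qed

text \<open>The lower estimate at \<open>x\<close> is the upper one at \<open>- x\<close>:
  reflection exchanges the strict with the non-strict distribution function. Hence the one-sided
  estimates use \<open><=\<close> although the supremum is taken with \<open><\<close>.\<close>

lemma symmetric_two_sided:
  fixes Y :: "'a \<Rightarrow> real"
  assumes Y[measurable]: "Y \<in> borel_measurable M" and symm: "distr M borel (\<lambda>\<omega>. - Y \<omega>) = distr M borel Y"
    and le: "\<And>x. prob {\<omega> \<in> space M. Y \<omega> \<le> x * b} - Phi x \<le> c"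
  shows "\<bar>prob {\<omega> \<in> space M. Y \<omega> < x * b} - Phi x\<bar> \<le> c"
proof -
  have "prob {\<omega> \<in> space M. Y \<omega> < x * b} \<le> prob {\<omega> \<in> space M. Y \<omega> \<le> x * b}"
    by (rule finite_measure_mono) auto
  moreover have "Phi x - prob {\<omega> \<in> space M. Y \<omega> < x * b} \<le> c"
    using le[of "- x"] by (simp add: symmetric_prob_less[OF Y symm] Phi_minus)
  ultimately show ?thesis using le[of x] by linarith
qed

lemma symmetric_half_bound:
  fixes Y :: "'a \<Rightarrow> real"
  assumes Y[measurable]: "Y \<in> borel_measurable M" and symm: "distr M borel (\<lambda>\<omega>. - Y \<omega>) = distr M borel Y"
    and b: "b > 0"
  shows "prob {\<omega> \<in> space M. Y \<omega> \<le> x * b} - Phi x \<le> 1 / 2"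
proof (cases "x \<ge> 0")
  case True
  then have "1 / 2 \<le> Phi x" using Phi_mono[of 0 x] by (simp add: Phi_0)
  then show ?thesis using prob_le_1[of "{\<omega> \<in> space M. Y \<omega> \<le> x * b}"] by linarith
next
  case False
  then have "2 * prob {\<omega> \<in> space M. Y \<omega> \<le> x * b} \<le> 1"
    using b by (subst symmetric_prob_neg_le_half[OF Y symm]) (auto simp: mult_neg_pos)
  then show ?thesis using Phi_bounds(1)[of x] by linarith
qed

lemma sum_char:
  fixes X :: "nat \<Rightarrow> 'a \<Rightarrow> real"
  assumes meas[measurable]: "\<And>i. i < n \<Longrightarrow> X i \<in> borel_measurable M" and n: "n \<ge> 1"
    and indep: "indep_vars (\<lambda>_. borel) X {..<n}"
    and ident: "\<And>i. i < n \<Longrightarrow> distr M borel (X i) = distr M borel (X 0)"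
    and symm: "distr M borel (\<lambda>\<omega>. - X 0 \<omega>) = distr M borel (X 0)"
  shows "expectation (\<lambda>\<omega>. cos (t * (\<Sum>i<n. X i \<omega>))) = expectation (\<lambda>\<omega>. cos (t * X 0 \<omega>)) ^ n"
    and "expectation (\<lambda>\<omega>. sin (t * (\<Sum>i<n. X i \<omega>))) = 0"
proof -
  have S: "(\<lambda>\<omega>. \<Sum>i<n. X i \<omega>) \<in> borel_measurable M" by (rule borel_measurable_sum) auto
  have X0: "X 0 \<in> borel_measurable M" using n by (intro meas) auto
  have "char (distr M borel (\<lambda>\<omega>. \<Sum>i<n. X i \<omega>)) t = (\<Prod>i<n. char (distr M borel (X i)) t)"
    using indep by (rule char_distr_sum)
  also have "\<dots> = (\<Prod>i<n. char (distr M borel (X 0)) t)"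
  proof (rule prod.cong[OF refl])
    fix i assume "i \<in> {..<n}"
    then have "distr M borel (X i) = distr M borel (X 0)" using ident by blast
    then show "char (distr M borel (X i)) t = char (distr M borel (X 0)) t" by (rule arg_cong)
  qed
  also have "\<dots> = of_real (expectation (\<lambda>\<omega>. cos (t * X 0 \<omega>)) ^ n)"
    by (simp add: char_distr_eq[OF X0] symmetric_imp_odd[OF X0 symm] complex_of_real_def[symmetric])
  finally show "expectation (\<lambda>\<omega>. cos (t * (\<Sum>i<n. X i \<omega>))) = expectation (\<lambda>\<omega>. cos (t * X 0 \<omega>)) ^ n"
    "expectation (\<lambda>\<omega>. sin (t * (\<Sum>i<n. X i \<omega>))) = 0"
    by (simp_all add: char_distr_eq[OF S] complex_eq_iff)
qed

text \<open>Expectations of the pointwise bounds. The last one says that, for given variance, the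
  symmetric two-point distribution has the smallest characteristic function up to the first minimum
  of the cosine.\<close>

lemma expectation_cos_bounds:
  fixes Y :: "'a \<Rightarrow> real"
  assumes Y[measurable]: "Y \<in> borel_measurable M" and i3: "integrable M (\<lambda>\<omega>. \<bar>Y \<omega>\<bar>^3)"
    and i2: "integrable M (\<lambda>\<omega>. (Y \<omega>)\<^sup>2)"
  shows "expectation (\<lambda>\<omega>. cos (t * Y \<omega>)) \<le> 1 - t\<^sup>2 * expectation (\<lambda>\<omega>. (Y \<omega>)\<^sup>2) / 2
    + \<bar>t\<bar>^3 * expectation (\<lambda>\<omega>. \<bar>Y \<omega>\<bar>^3) / 10"
    and "\<bar>expectation (\<lambda>\<omega>. cos (t * Y \<omega>))\<bar> \<le> 1"
    and "0 < t \<Longrightarrow> 0 < expectation (\<lambda>\<omega>. (Y \<omega>)\<^sup>2) \<Longrightarrow> t * sqrt (expectation (\<lambda>\<omega>. (Y \<omega>)\<^sup>2)) \<le> pi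
      \<Longrightarrow> cos (t * sqrt (expectation (\<lambda>\<omega>. (Y \<omega>)\<^sup>2))) \<le> expectation (\<lambda>\<omega>. cos (t * Y \<omega>))"
proof -
  have ic: "integrable M (\<lambda>\<omega>. cos (t * Y \<omega>))"
    by (auto intro!: integrable_const_bound[where B=1])
  define v where "v = expectation (\<lambda>\<omega>. (Y \<omega>)\<^sup>2)"
  have "expectation (\<lambda>\<omega>. cos (t * Y \<omega>)) \<le> expectation (\<lambda>\<omega>. 1 - t\<^sup>2 / 2 * (Y \<omega>)\<^sup>2 + \<bar>t\<bar>^3 / 10 * \<bar>Y \<omega>\<bar>^3)"
  proof (rule integral_mono[OF ic])
    show "cos (t * Y \<omega>) \<le> 1 - t\<^sup>2 / 2 * (Y \<omega>)\<^sup>2 + \<bar>t\<bar>^3 / 10 * \<bar>Y \<omega>\<bar>^3" for \<omega>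
      using cos_le_cubic[of "t * Y \<omega>"] by (simp add: power_mult_distrib abs_mult)
  qed (use i2 i3 in auto)
  also have "\<dots> = 1 - t\<^sup>2 / 2 * v + \<bar>t\<bar>^3 / 10 * expectation (\<lambda>\<omega>. \<bar>Y \<omega>\<bar>^3)"
    using i2 i3 by (simp add: prob_space v_def)
  finally show "expectation (\<lambda>\<omega>. cos (t * Y \<omega>)) \<le> 1 - t\<^sup>2 * expectation (\<lambda>\<omega>. (Y \<omega>)\<^sup>2) / 2
    + \<bar>t\<bar>^3 * expectation (\<lambda>\<omega>. \<bar>Y \<omega>\<bar>^3) / 10"
    by (simp add: v_def)
  have "norm (expectation (\<lambda>\<omega>. cos (t * Y \<omega>))) \<le> expectation (\<lambda>\<omega>. norm (cos (t * Y \<omega>)))"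
    by (rule integral_norm_bound)
  also have "\<dots> \<le> expectation (\<lambda>\<omega>. 1)" using ic by (intro integral_mono) auto
  finally show "\<bar>expectation (\<lambda>\<omega>. cos (t * Y \<omega>))\<bar> \<le> 1" by (simp add: prob_space)
  assume t: "0 < t" and v: "0 < expectation (\<lambda>\<omega>. (Y \<omega>)\<^sup>2)" and tv: "t * sqrt (expectation (\<lambda>\<omega>. (Y \<omega>)\<^sup>2)) \<le> pi"
  define u where "u = t * sqrt v"
  have u: "0 < u" "u \<le> pi" using t v tv by (simp_all add: u_def v_def)
  have u2: "u\<^sup>2 = t\<^sup>2 * v" using v by (simp add: u_def v_def power_mult_distrib)
  define k where "k = sin u / (2 * u)"
  \<comment> \<open>The tangent is taken at the root mean square \<open>u\<close> of
    \<open>t * Y\<close>, so its correction has mean zero.\<close>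
  have "cos u = expectation (\<lambda>\<omega>. cos u + k * (u\<^sup>2 - t\<^sup>2 * (Y \<omega>)\<^sup>2))"
    using i2 by (simp add: prob_space u2 v_def)
  also have "\<dots> \<le> expectation (\<lambda>\<omega>. cos (t * Y \<omega>))"
  proof (rule integral_mono[OF _ ic])
    show "cos u + k * (u\<^sup>2 - t\<^sup>2 * (Y \<omega>)\<^sup>2) \<le> cos (t * Y \<omega>)" for \<omega>
      using cos_ge_parabola[OF u, of "t * Y \<omega>"] by (simp add: k_def power_mult_distrib)
  qed (use i2 in auto)
  finally show "cos (t * sqrt (expectation (\<lambda>\<omega>. (Y \<omega>)\<^sup>2))) \<le> expectation (\<lambda>\<omega>. cos (t * Y \<omega>))"
    by (simp add: u_def v_def)
qed

text \<open>Bounds \<open>y^3\<close>, a convex function of \<open>y^2\<close>, by its tangent at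
  \<open>\<sigma>^2\<close>; the expectation of the tangent is \<open>\<sigma>^3\<close>.\<close>

lemma lyapunov_3_2:
  fixes Y :: "'a \<Rightarrow> real"
  assumes Y[measurable]: "Y \<in> borel_measurable M" and i3: "integrable M (\<lambda>\<omega>. \<bar>Y \<omega>\<bar>^3)"
    and i2: "integrable M (\<lambda>\<omega>. (Y \<omega>)\<^sup>2)"
  shows "sqrt (expectation (\<lambda>\<omega>. (Y \<omega>)\<^sup>2)) ^ 3 \<le> expectation (\<lambda>\<omega>. \<bar>Y \<omega>\<bar>^3)"
proof -
  define v where "v = expectation (\<lambda>\<omega>. (Y \<omega>)\<^sup>2)"
  define \<sigma> where "\<sigma> = sqrt v"
  have v0: "0 \<le> v" by (simp add: v_def)
  then have \<sigma>: "0 \<le> \<sigma>" "\<sigma>\<^sup>2 = v" by (auto simp: \<sigma>_def)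
  have "\<sigma>^3 = expectation (\<lambda>\<omega>. 3/2 * \<sigma> * (Y \<omega>)\<^sup>2 - \<sigma>^3 / 2)"
    using i2 by (simp add: prob_space v_def[symmetric] flip: \<sigma>(2)) (simp add: power2_eq_square power3_eq_cube)
  also have "\<dots> \<le> expectation (\<lambda>\<omega>. \<bar>Y \<omega>\<bar>^3)"
  proof (rule integral_mono[OF _ i3])
    show "3/2 * \<sigma> * (Y \<omega>)\<^sup>2 - \<sigma>^3 / 2 \<le> \<bar>Y \<omega>\<bar>^3" for \<omega>
    proof -
      define y where "y = \<bar>Y \<omega>\<bar>"
      have "0 \<le> (y - \<sigma>)\<^sup>2 * (2 * y + \<sigma>)" using \<sigma> by (simp add: y_def)
      then have "3/2 * \<sigma> * y\<^sup>2 - \<sigma>^3 / 2 \<le> y^3" by (simp add: power2_eq_square power3_eq_cube field_simps)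
      then show ?thesis by (simp add: y_def)
    qed
  qed (use i2 in auto)
  finally show ?thesis by (simp add: \<sigma>_def v_def)
qed

lemma symmetric_berry_esseen:
  fixes X :: "nat \<Rightarrow> 'a \<Rightarrow> real"
  assumes meas: "\<And>i. i < n \<Longrightarrow> X i \<in> borel_measurable M" and n: "n \<ge> 3"
    and indep: "indep_vars (\<lambda>_. borel) X {..<n}"
    and ident: "\<And>i. i < n \<Longrightarrow> distr M borel (X i) = distr M borel (X 0)"
    and symm: "distr M borel (\<lambda>\<omega>. - X 0 \<omega>) = distr M borel (X 0)"
    and i3: "integrable M (\<lambda>\<omega>. \<bar>X 0 \<omega>\<bar>^3)" and i2: "integrable M (\<lambda>\<omega>. (X 0 \<omega>)\<^sup>2)"
    and v: "0 < expectation (\<lambda>\<omega>. (X 0 \<omega>)\<^sup>2)"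
  defines "b \<equiv> sqrt (real n * expectation (\<lambda>\<omega>. (X 0 \<omega>)\<^sup>2))"
  shows "prob {\<omega> \<in> space M. (\<Sum>i<n. X i \<omega>) \<le> x * b} - Phi x
    \<le> 0.4786 * (real n * expectation (\<lambda>\<omega>. \<bar>X 0 \<omega>\<bar>^3) / b^3)"
proof -
  define v where "v = expectation (\<lambda>\<omega>. (X 0 \<omega>)\<^sup>2)"
  define \<beta> where "\<beta> = expectation (\<lambda>\<omega>. \<bar>X 0 \<omega>\<bar>^3)"
  define l where "l = real n * \<beta> / b^3"
  define S where "S = (\<lambda>\<omega>. \<Sum>i<n. X i \<omega>)"
  have n1: "n \<ge> 1" using n by simp
  have X0[measurable]: "X 0 \<in> borel_measurable M" using n by (intro meas) auto
  have S[measurable]: "S \<in> borel_measurable M" unfolding S_def by (rule borel_measurable_sum) (auto intro: meas)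
  have v0: "0 < v" using v by (simp add: v_def)
  have b: "b = sqrt n * sqrt v" by (simp add: b_def v_def real_sqrt_mult)
  have n0: "0 < sqrt (real n)" using n by simp
  have b0: "0 < b" using v0 n0 by (simp add: b)
  have b2: "b\<^sup>2 = n * v" using v0 by (simp add: b power_mult_distrib)
  have char: "expectation (\<lambda>\<omega>. cos (t * S \<omega>)) = expectation (\<lambda>\<omega>. cos (t * X 0 \<omega>)) ^ n"
    "expectation (\<lambda>\<omega>. sin (t * S \<omega>)) = 0" for t
    unfolding S_def by (rule sum_char[OF meas n1 indep ident symm]; assumption)+
  have Ssymm: "distr M borel (\<lambda>\<omega>. - S \<omega>) = distr M borel S"
    by (rule odd_imp_symmetric[OF S char(2)])
  show ?thesis
  proof (cases "l \<le> 1.046")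
    case False
    have "prob {\<omega> \<in> space M. S \<omega> \<le> x * b} - Phi x \<le> 1 / 2"
      by (rule symmetric_half_bound[OF S Ssymm b0])
    also have "\<dots> \<le> 0.4786 * l" using False by simp
    finally show ?thesis by (simp only: l_def \<beta>_def S_def)
  next
    case True
    define g where "g = (\<lambda>t. expectation (\<lambda>\<omega>. cos (t / b * X 0 \<omega>)))"
    have gm: "g \<in> borel_measurable borel" unfolding g_def by measurable
    have g1: "\<bar>g t\<bar> \<le> 1" for t unfolding g_def by (rule expectation_cos_bounds(2)[OF X0 i3 i2])
    have ub: "g t \<le> 1 - t\<^sup>2 / (2 * real n) + l * t^3 / (10 * real n)" if "0 < t" for t
    proof -
      have "g t \<le> 1 - (t / b)\<^sup>2 * v / 2 + \<bar>t / b\<bar>^3 * \<beta> / 10"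
        unfolding g_def v_def \<beta>_def by (rule expectation_cos_bounds(1)[OF X0 i3 i2])
      moreover have "(t / b)\<^sup>2 * v / 2 = t\<^sup>2 / (2 * real n)" using b2 v0 n by (simp add: power_divide)
      moreover have "\<bar>t / b\<bar>^3 * \<beta> / 10 = l * t^3 / (10 * real n)"
        using that b0 n by (simp add: l_def power_divide)
      ultimately show ?thesis by simp
    qed
    have lb: "cos (t / sqrt n) \<le> g t" if t: "0 < t" "t \<le> pi * sqrt n" for t
    proof -
      have tb: "t / b * sqrt v = t / sqrt n" using v0 n0 by (simp add: b)
      have "t / sqrt n \<le> pi" using t n0 by (simp add: field_simps)
      then show ?thesis
        using expectation_cos_bounds(3)[OF X0 i3 i2, of "t / b"] t b0 v tb by (simp add: g_def v_def[symmetric])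
    qed
    have ll: "1 / sqrt n \<le> l"
    proof -
      have "sqrt v ^ 3 \<le> \<beta>" using lyapunov_3_2[OF X0 i3 i2] by (simp add: v_def \<beta>_def)
      then have "n * sqrt v ^ 3 / b^3 \<le> l" unfolding l_def using b0
        by (intro divide_right_mono mult_left_mono) auto
      moreover have "n * sqrt v ^ 3 / b^3 = 1 / sqrt n"
      proof -
        have "a * a * c^3 / (a * c)^3 = 1 / a" if "0 < a" "0 < c" for a c :: real
          using that by (simp add: power_mult_distrib power3_eq_cube)
        from this[of "sqrt n" "sqrt v"] show ?thesis using v0 n0 by (simp add: b)
      qed
      ultimately show ?thesis by simp
    qed
    obtain T where T: "0 < T" "\<And>x. (LBINT s:{0<..<1}. pker (T * x) s * g (s * T) ^ n) - (Phi x - 1 / 2)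
      \<le> 0.4786 * l"
      using smoothed_power_minus_Phi_le[OF n ll True gm ub lb g1] by blast
    define Z where "Z = (\<lambda>\<omega>. S \<omega> / b)"
    have Z[measurable]: "Z \<in> borel_measurable M" unfolding Z_def by measurable
    have Zi: "integrable M Z"
    proof -
      have "integrable M (X i)" if "i < n" for i
      proof -
        have le: "norm y \<le> norm (1 + y\<^sup>2)" for y :: real
          using zero_le_power2[of "\<bar>y\<bar> - 1"] by (simp add: power2_diff)
        have 0: "integrable M (X 0)"
        proof (rule Bochner_Integration.integrable_bound)
          show "integrable M (\<lambda>\<omega>. 1 + (X 0 \<omega>)\<^sup>2)" using i2 by simp
          show "AE \<omega> in M. norm (X 0 \<omega>) \<le> norm (1 + (X 0 \<omega>)\<^sup>2)" by (intro AE_I2 le)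
        qed (rule X0)
        have [measurable]: "X i \<in> borel_measurable M" using that by (rule meas)
        have "integrable (distr M borel (X i)) (\<lambda>x. x)"
          unfolding ident[OF that] using 0 by (subst integrable_distr_eq) auto
        then show ?thesis by (subst (asm) integrable_distr_eq) auto
      qed
      then show ?thesis unfolding Z_def S_def by (intro integrable_divide
        Bochner_Integration.integrable_sum) auto
    qed
    have odd: "expectation (\<lambda>\<omega>. sin (t * Z \<omega>)) = 0" for t
      using char(2)[of "t / b"] by (simp add: Z_def)
    have cosZ: "expectation (\<lambda>\<omega>. cos (s * T * Z \<omega>)) = g (s * T) ^ n" for s
      using char(1)[of "s * T / b"] by (simp add: Z_def g_def)
    have "prob {\<omega> \<in> space M. Z \<omega> \<le> x} - 1 / 2 \<le> (LBINT s:{0<..<1}. pker (T * x) s * g (s * T) ^ n)"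
      using smoothing_inequality[OF Z Zi odd T(1), of x] by (simp add: cosZ)
    moreover have "{\<omega> \<in> space M. Z \<omega> \<le> x} = {\<omega> \<in> space M. (\<Sum>i<n. X i \<omega>) \<le> x * b}"
      using b0 by (simp add: Z_def S_def divide_le_eq)
    ultimately show ?thesis using T(2)[of x] by (simp add: l_def \<beta>_def)
  qed
qed

end

section \<open>Numerical bounds for the normal distribution\<close>

lemma std_normal_density_const_bounds: "0.3989 \<le> 1 / sqrt (2 * pi)" "1 / sqrt (2 * pi) \<le> 0.39896"
proof -
  have e: "sqrt (2 * pi) = 2 * sqrt (pi / 2)"
  proof -
    have "sqrt (2 * pi) = sqrt (2\<^sup>2 * (pi / 2))" by simp
    also have "\<dots> = 2 * sqrt (pi / 2)" by (subst real_sqrt_mult) simp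
    finally show ?thesis .
  qed
  have "0.3989 \<le> 1 / (2 * s) \<and> 1 / (2 * s) \<le> 0.39896" if "1.2533 \<le> s" "s \<le> 1.2534" for s :: real
    using that by (simp add: field_simps)
  from this[OF sqrt_pi_half_bounds] show "0.3989 \<le> 1 / sqrt (2 * pi)" "1 / sqrt (2 * pi) \<le> 0.39896"
    unfolding e by auto
qed

lemma set_integrable_std_normal_density: "set_integrable lborel {x..y} std_normal_density"
  by (intro borel_integrable_atLeastAtMost') (auto simp: std_normal_density_def intro!: continuous_intros)

lemma Phi_diff_le_tangent:
  assumes "0 \<le> x" "x \<le> y"
  shows "Phi y - Phi x \<le> (y - x) * std_normal_density x"
proof -
  have "Phi y - Phi x = (LBINT t:{x..y}. std_normal_density t)" by (rule Phi_diff[OF assms(2)])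
  also have "\<dots> \<le> (LBINT t:{x..y}. std_normal_density x)"
  proof (rule set_integral_mono[OF set_integrable_std_normal_density])
    show "std_normal_density t \<le> std_normal_density x" if "t \<in> {x..y}" for t
      using assms that by (auto simp: std_normal_density_def intro!: mult_left_mono power_mono
        divide_right_mono)
  qed (rule borel_integrable_atLeastAtMost', rule continuous_on_const)
  also have "\<dots> = (y - x) * std_normal_density x"
    using assms by (simp add: set_lebesgue_integral_def)
  finally show ?thesis .
qed

text \<open>The maximum is \<open>1 / sqrt (2 * pi * exp 1) = 0.24197...\<close>, attained at
  \<open>x = 1\<close>; accordingly the exponential is expanded around
  \<open>x^2 = 1\<close>.\<close>

lemma std_normal_density_times_self: "x * std_normal_density x \<le> 0.242"
proof -
  have "1.648697 \<le> exp (1 / 2 :: real)"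
    using exp_ge_taylor[of "1/2" 5] by (simp add: fact_numeral eval_nat_numeral)
  then have e: "exp (- (1 / 2)) \<le> 1 / (1.648697 :: real)"
    by (simp add: exp_minus field_simps)
  have "x \<le> 1 + (x\<^sup>2 - 1) / 2" using zero_le_power2[of "x - 1"] by (simp add: power2_diff field_simps)
  also have "\<dots> \<le> exp ((x\<^sup>2 - 1) / 2)" by (rule exp_ge_add_one_self)
  finally have "x * exp (- (x\<^sup>2 / 2)) \<le> exp ((x\<^sup>2 - 1) / 2) * exp (- (x\<^sup>2 / 2))" by (rule mult_right_mono) simp
  also have "\<dots> = exp (- (1 / 2))" by (simp add: diff_divide_distrib flip: exp_add)
  also note e
  finally have "1 / sqrt (2 * pi) * (x * exp (- (x\<^sup>2 / 2))) \<le> 1 / sqrt (2 * pi) * (1 / 1.648697)"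
    by (rule mult_left_mono) simp
  also have "\<dots> \<le> 0.39896 * (1 / 1.648697)"
    by (rule mult_right_mono[OF std_normal_density_const_bounds(2)]) simp
  finally show ?thesis by (simp add: std_normal_density_def)
qed

lemma Phi_scale_le:
  assumes x: "0 \<le> x" and a: "1 \<le> a"
  shows "Phi (a * x) - Phi x \<le> 0.242 * (a - 1)"
proof -
  have "Phi (a * x) - Phi x \<le> (a * x - x) * std_normal_density x"
    using x a by (intro Phi_diff_le_tangent) (auto intro: mult_right_mono[of 1 a x, simplified])
  also have "\<dots> = (a - 1) * (x * std_normal_density x)" by (simp add: algebra_simps)
  also have "\<dots> \<le> (a - 1) * 0.242" using a by (intro mult_left_mono std_normal_density_times_self) simp
  finally show ?thesis by simp
qed

lemma exp_minus_le_poly: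
  assumes "0 \<le> (u :: real)"
  shows "exp (- u) \<le> 1 - u + u\<^sup>2 / 2"
proof -
  have "1 \<le> (1 - u + u\<^sup>2 / 2) * (1 + u + u\<^sup>2 / 2)"
  proof -
    have "(1 - u + u\<^sup>2 / 2) * (1 + u + u\<^sup>2 / 2) = 1 + (u\<^sup>2)\<^sup>2 / 4"
      by (simp add: power2_eq_square algebra_simps)
    then show ?thesis by simp
  qed
  also have "\<dots> \<le> (1 - u + u\<^sup>2 / 2) * exp u"
  proof (rule mult_left_mono)
    show "1 + u + u\<^sup>2 / 2 \<le> exp u"
      using exp_ge_taylor[OF assms, of 2] by (simp add: eval_nat_numeral)
    show "0 \<le> 1 - u + u\<^sup>2 / 2" using zero_le_power2[of "u - 1"] zero_le_power2[of u] unfolding power2_diff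
      by simp
  qed
  finally show ?thesis by (simp add: exp_minus field_simps)
qed

lemma set_integral_poly:
  assumes "(0::real) \<le> x"
  shows "(LBINT t:{0..x}. a + b * t^2 + c * t^4) = a * x + b * x^3 / 3 + c * x^5 / 5"
    "set_integrable lborel {0..x} (\<lambda>t. a + b * t^2 + c * t^4)"
proof -
  have "(\<integral>t. (a + b * t^2 + c * t^4) * indicator {0..x} t \<partial>lborel)
      = (a * x + b * x^3 / 3 + c * x^5 / 5) - (a * 0 + b * 0^3 / 3 + c * 0^5 / 5)"
    using assms by (intro integral_FTC_Icc_real) (auto intro!: derivative_eq_intros)
  then show "(LBINT t:{0..x}. a + b * t^2 + c * t^4) = a * x + b * x^3 / 3 + c * x^5 / 5"
    by (simp add: set_lebesgue_integral_def mult.commute)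
  show "set_integrable lborel {0..x} (\<lambda>t. a + b * t^2 + c * t^4)"
    by (intro borel_integrable_atLeastAtMost') (auto intro!: continuous_intros)
qed

text \<open>The points \<open>1\<close> and \<open>0.4\<close> are where \<open>bound_n_le_2\<close>
  splits the line; two-digit accuracy suffices there.\<close>

lemma Phi_1_le: "Phi 1 \<le> 0.8425"
proof -
  define c :: real where "c = 1 / sqrt (2 * pi)"
  have c: "0 \<le> c" "c \<le> 0.39896" using std_normal_density_const_bounds by (auto simp: c_def)
  have "Phi 1 - Phi 0 = (LBINT t:{0..1}. std_normal_density t)" by (rule Phi_diff) simp
  also have "\<dots> \<le> (LBINT t:{0..1}. c + (- c / 2) * t^2 + (c / 8) * t^4)"
  proof (rule set_integral_mono[OF set_integrable_std_normal_density set_integral_poly(2)])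
    show "std_normal_density t \<le> c + (- c / 2) * t^2 + (c / 8) * t^4" for t
    proof -
      have "c * exp (- (t\<^sup>2 / 2)) \<le> c * (1 - t\<^sup>2 / 2 + (t\<^sup>2 / 2)\<^sup>2 / 2)"
        using c by (intro mult_left_mono exp_minus_le_poly) auto
      moreover have "std_normal_density t = c * exp (- (t\<^sup>2 / 2))" by (simp add: std_normal_density_def c_def)
      ultimately show ?thesis by (simp add: algebra_simps power_divide)
    qed
  qed simp
  also have "\<dots> = c * (103 / 120)" by (subst set_integral_poly) (auto simp: algebra_simps)
  also have "\<dots> \<le> 0.3425" using c by simp
  finally show ?thesis by (simp add: Phi_0)
qed

lemma Phi_04_ge: "0.6523 \<le> Phi 0.4"
proof -
  define c :: real where "c = 1 / sqrt (2 * pi)"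
  have c: "0.3989 \<le> c" using std_normal_density_const_bounds by (auto simp: c_def)
  have "0.1523 \<le> c * (0.4 - 0.4^3 / 6)" using c by (simp add: power3_eq_cube)
  also have "\<dots> = (LBINT t:{0..0.4}. c + (- c / 2) * t^2 + 0 * t^4)"
    by (subst set_integral_poly) (auto simp: algebra_simps)
  also have "\<dots> \<le> (LBINT t:{0..0.4}. std_normal_density t)"
  proof (rule set_integral_mono[OF set_integral_poly(2) set_integrable_std_normal_density])
    show "c + (- c / 2) * t^2 + 0 * t^4 \<le> std_normal_density t" for t
    proof -
      have "c * (1 + (- (t\<^sup>2 / 2))) \<le> c * exp (- (t\<^sup>2 / 2))"
        using c by (intro mult_left_mono exp_ge_add_one_self) auto
      moreover have "std_normal_density t = c * exp (- (t\<^sup>2 / 2))" by (simp add: std_normal_density_def c_def)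
      ultimately show ?thesis by (simp add: algebra_simps)
    qed
  qed simp
  also have "\<dots> = Phi 0.4 - Phi 0" by (rule Phi_diff[symmetric]) simp
  finally show ?thesis by (simp add: Phi_0)
qed

section \<open>Truncation\<close>

locale iid_symmetric = prob_space M for M :: "'a measure" +
  fixes X :: "nat \<Rightarrow> 'a \<Rightarrow> real" and n :: nat
  assumes n_ge_1: "n \<ge> 1"
    and measX: "\<And>i. i < n \<Longrightarrow> X i \<in> borel_measurable M"
    and indepX: "indep_vars (\<lambda>_. borel) X {..<n}"
    and identX: "\<And>i. i < n \<Longrightarrow> distr M borel (X i) = distr M borel (X 0)"
    and symmX: "distr M borel (\<lambda>\<omega>. - X 0 \<omega>) = distr M borel (X 0)"
    and sqX: "integrable M (\<lambda>\<omega>. (X 0 \<omega>)\<^sup>2)"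
    and posX: "expectation (\<lambda>\<omega>. (X 0 \<omega>)\<^sup>2) > 0"
begin

definition v :: real where "v = expectation (\<lambda>\<omega>. (X 0 \<omega>)\<^sup>2)"
definition B :: real where "B = sqrt (real n * v)"
definition S :: "'a \<Rightarrow> real" where "S \<omega> = (\<Sum>i<n. X i \<omega>)"
text \<open>Large values are set to \<open>0\<close> rather than clipped, so that the truncated
  third moment is exactly the numerator of \<open>M3\<close>; symmetry is preserved.\<close>

definition trunc :: "real \<Rightarrow> real" where "trunc t = (if \<bar>t\<bar> < B then t else 0)"
definition L :: real where
  "L = real n * expectation (\<lambda>\<omega>. (X 0 \<omega>)\<^sup>2 * indicator {t. B \<le> \<bar>t\<bar>} (X 0 \<omega>)) / B\<^sup>2"
definition M3 :: real where
  "M3 = real n * expectation (\<lambda>\<omega>. \<bar>X 0 \<omega>\<bar> ^ 3 * indicator {t. \<bar>t\<bar> < B} (X 0 \<omega>)) / B ^ 3"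

lemma X0_measurable [measurable]: "X 0 \<in> borel_measurable M"
  using n_ge_1 by (intro measX) auto

lemma S_measurable [measurable]: "S \<in> borel_measurable M"
  unfolding S_def by (rule borel_measurable_sum) (auto intro: measX)

lemma trunc_measurable [measurable]: "trunc \<in> borel_measurable borel"
  unfolding trunc_def by measurable

lemma v_pos: "v > 0" using posX by (simp add: v_def)

lemma B_pos: "B > 0" using v_pos n_ge_1 by (simp add: B_def)

lemma B_sq: "B\<^sup>2 = real n * v" using v_pos by (simp add: B_def)

lemma expectation_ident:
  assumes "i < n" and [measurable]: "f \<in> borel_measurable borel"
  shows "expectation (\<lambda>\<omega>. f (X i \<omega>) :: real) = expectation (\<lambda>\<omega>. f (X 0 \<omega>))"
proof -
  have [measurable]: "X i \<in> borel_measurable M" by (rule measX[OF assms(1)])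
  have "expectation (\<lambda>\<omega>. f (X i \<omega>)) = integral\<^sup>L (distr M borel (X i)) f"
    by (rule integral_distr[symmetric]) auto
  also have "\<dots> = integral\<^sup>L (distr M borel (X 0)) f" by (simp only: identX[OF assms(1)])
  also have "\<dots> = expectation (\<lambda>\<omega>. f (X 0 \<omega>))" by (rule integral_distr) auto
  finally show ?thesis .
qed

lemma S_symmetric: "distr M borel (\<lambda>\<omega>. - S \<omega>) = distr M borel S"
proof (rule odd_imp_symmetric[OF S_measurable])
  show "expectation (\<lambda>\<omega>. sin (t * S \<omega>)) = 0" for t
    unfolding S_def by (rule sum_char(2)[OF measX n_ge_1 indepX identX symmX]; assumption)
qed

lemma half_bound: "prob {\<omega> \<in> space M. S \<omega> \<le> x * B} - Phi x \<le> 1 / 2"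
  by (rule symmetric_half_bound[OF S_measurable S_symmetric B_pos])

lemma tail_integrable: "integrable M (\<lambda>\<omega>. (X 0 \<omega>)\<^sup>2 * indicator {t. B \<le> \<bar>t\<bar>} (X 0 \<omega>))"
  by (rule Bochner_Integration.integrable_bound[OF sqX]) (auto simp: indicator_def)

lemma trunc_integrable: "integrable M (\<lambda>\<omega>. \<bar>trunc (X 0 \<omega>)\<bar> ^ k)"
  using B_pos by (intro integrable_const_bound[where B="B ^ k"]) (auto simp: trunc_def intro!: AE_I2 power_mono)

lemma trunc_integrable2: "integrable M (\<lambda>\<omega>. (trunc (X 0 \<omega>))\<^sup>2)"
  using trunc_integrable[of 2] by simp

lemma L_eq: "expectation (\<lambda>\<omega>. (X 0 \<omega>)\<^sup>2 * indicator {t. B \<le> \<bar>t\<bar>} (X 0 \<omega>)) = v * L"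
  using v_pos n_ge_1 unfolding L_def B_sq by simp

lemma expectation_trunc2: "expectation (\<lambda>\<omega>. (trunc (X 0 \<omega>))\<^sup>2) = v * (1 - L)"
proof -
  have "expectation (\<lambda>\<omega>. (trunc (X 0 \<omega>))\<^sup>2)
      = expectation (\<lambda>\<omega>. (X 0 \<omega>)\<^sup>2 - (X 0 \<omega>)\<^sup>2 * indicator {t. B \<le> \<bar>t\<bar>} (X 0 \<omega>))"
    by (intro Bochner_Integration.integral_cong) (auto simp: trunc_def indicator_def)
  then show ?thesis using sqX tail_integrable by (simp add: L_eq v_def[symmetric] algebra_simps)
qed

lemma expectation_trunc3: "real n * expectation (\<lambda>\<omega>. \<bar>trunc (X 0 \<omega>)\<bar> ^ 3) = M3 * B ^ 3"
proof -
  have "expectation (\<lambda>\<omega>. \<bar>trunc (X 0 \<omega>)\<bar> ^ 3) = expectation (\<lambda>\<omega>. \<bar>X 0 \<omega>\<bar> ^ 3 * indicator {t. \<bar>t\<bar> < B} (X 0 \<omega>))"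
    by (intro Bochner_Integration.integral_cong) (auto simp: trunc_def indicator_def)
  then show ?thesis using B_pos by (simp add: M3_def)
qed

lemma L_nonneg: "0 \<le> L" unfolding L_def by (intro divide_nonneg_nonneg mult_nonneg_nonneg
  integral_nonneg_AE) auto

lemma M3_nonneg: "0 \<le> M3"
  unfolding M3_def using B_pos by (intro divide_nonneg_nonneg mult_nonneg_nonneg integral_nonneg_AE) auto

lemma L_le_1: "L \<le> 1"
proof -
  have "0 \<le> v * (1 - L)" unfolding expectation_trunc2[symmetric] by (intro integral_nonneg_AE) auto
  then show ?thesis using v_pos by (simp add: zero_le_mult_iff)
qed

text \<open>Lyapunov's inequality for the truncated summand, whose variance is
  \<open>v * (1 - L)\<close>. It prevents \<open>L + M3\<close> from being small when
  \<open>n\<close> is small.\<close>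

lemma M3_ge: "sqrt (1 - L) ^ 3 \<le> sqrt n * M3"
proof -
  have "sqrt (v * (1 - L)) ^ 3 \<le> expectation (\<lambda>\<omega>. \<bar>trunc (X 0 \<omega>)\<bar> ^ 3)"
    unfolding expectation_trunc2[symmetric] by (rule lyapunov_3_2[OF _ trunc_integrable trunc_integrable2])
      measurable
  then have "real n * sqrt (v * (1 - L)) ^ 3 \<le> M3 * B ^ 3"
    unfolding expectation_trunc3[symmetric] by (intro mult_left_mono) auto
  moreover have "B = sqrt n * sqrt v" by (simp add: B_def real_sqrt_mult)
  moreover have "real n = sqrt n * sqrt n" by simp
  ultimately have "sqrt n * sqrt n * (sqrt v ^ 3 * sqrt (1 - L) ^ 3) \<le> M3 * (sqrt n ^ 3 * sqrt v ^ 3)"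
    by (metis real_sqrt_mult power_mult_distrib)
  then have "(sqrt n * sqrt n * sqrt v ^ 3) * sqrt (1 - L) ^ 3 \<le> (sqrt n * sqrt n * sqrt v ^ 3) * (sqrt n * M3)"
    by (simp only: power3_eq_cube mult.assoc mult.left_commute mult.commute)
  then show ?thesis
    by (rule mult_left_le_imp_le) (use n_ge_1 v_pos in auto)
qed

text \<open>Chebyshev's inequality restricted to the tail: there the square is at least
  \<open>B^2 = n * v\<close>, and the tail has second moment \<open>v * L\<close>.\<close>

lemma tail_prob: "real n * prob {\<omega> \<in> space M. B \<le> \<bar>X 0 \<omega>\<bar>} \<le> L"
proof -
  have "B\<^sup>2 * prob {\<omega> \<in> space M. B \<le> \<bar>X 0 \<omega>\<bar>} = expectation (\<lambda>\<omega>. B\<^sup>2 * indicator {\<omega> \<in> space M. B \<le> \<bar>X 0 \<omega>\<bar>} \<omega>)"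
    by simp
  also have "\<dots> \<le> expectation (\<lambda>\<omega>. (X 0 \<omega>)\<^sup>2 * indicator {t. B \<le> \<bar>t\<bar>} (X 0 \<omega>))"
  proof (rule integral_mono[OF _ tail_integrable])
    have "B\<^sup>2 \<le> t\<^sup>2" if "B \<le> \<bar>t\<bar>" for t
      using that B_pos by (simp add: abs_le_square_iff[symmetric])
    then show "B\<^sup>2 * indicator {\<omega> \<in> space M. B \<le> \<bar>X 0 \<omega>\<bar>} \<omega> \<le> (X 0 \<omega>)\<^sup>2 * indicator {t. B \<le> \<bar>t\<bar>} (X 0 \<omega>)"
      if "\<omega> \<in> space M" for \<omega> using that by (simp add: indicator_def)
  qed (intro integrable_mult_right integrable_real_indicator; simp add: emeasure_eq_measure)
  also have "\<dots> = v * L" by (rule L_eq)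
  finally have "v * (real n * prob {\<omega> \<in> space M. B \<le> \<bar>X 0 \<omega>\<bar>}) \<le> v * L"
    by (simp add: B_sq mult.assoc mult.left_commute)
  then show ?thesis by (rule mult_left_le_imp_le) (rule v_pos)
qed

lemma truncation_prob:
  "prob {\<omega> \<in> space M. S \<omega> \<le> y} \<le> prob {\<omega> \<in> space M. (\<Sum>i<n. trunc (X i \<omega>)) \<le> y} + L"
proof -
  have [measurable]: "X i \<in> borel_measurable M" if "i < n" for i by (rule measX[OF that])
  have tm: "(\<lambda>\<omega>. \<Sum>i<n. trunc (X i \<omega>)) \<in> borel_measurable M" by (rule borel_measurable_sum) auto
  let ?A = "{\<omega> \<in> space M. (\<Sum>i<n. trunc (X i \<omega>)) \<le> y}"
  let ?T = "\<lambda>i. {\<omega> \<in> space M. B \<le> \<bar>X i \<omega>\<bar>}"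
  have A: "?A \<in> events" using tm by measurable
  have T: "?T i \<in> events" if "i < n" for i using that by measurable
  have "prob {\<omega> \<in> space M. S \<omega> \<le> y} \<le> prob (?A \<union> (\<Union>i<n. ?T i))"
  proof (rule finite_measure_mono)
    show "{\<omega> \<in> space M. S \<omega> \<le> y} \<subseteq> ?A \<union> (\<Union>i<n. ?T i)"
    proof
      fix \<omega> assume w: "\<omega> \<in> {\<omega> \<in> space M. S \<omega> \<le> y}"
      show "\<omega> \<in> ?A \<union> (\<Union>i<n. ?T i)"
      proof (cases "\<exists>i<n. B \<le> \<bar>X i \<omega>\<bar>")
        case False
        then have "(\<Sum>i<n. trunc (X i \<omega>)) = S \<omega>" unfolding S_def by (intro sum.cong) (auto simp: trunc_def)
        then show ?thesis using w by auto
      qed (use w in auto)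
    qed
    show "?A \<union> (\<Union>i<n. ?T i) \<in> events" using A T by auto
  qed
  also have "\<dots> \<le> prob ?A + prob (\<Union>i<n. ?T i)"
    using A T by (intro measure_Un_le) auto
  also have "prob (\<Union>i<n. ?T i) \<le> (\<Sum>i<n. prob (?T i))"
    using T by (intro finite_measure_subadditive_finite) auto
  also have "\<dots> = (\<Sum>i<n. prob (?T 0))"
  proof (rule sum.cong[OF refl])
    fix i assume i: "i \<in> {..<n}"
    have P: "measure (distr M borel Y) {t. B \<le> \<bar>t\<bar>} = prob {\<omega> \<in> space M. B \<le> \<bar>Y \<omega>\<bar>}"
      if [measurable]: "Y \<in> borel_measurable M" for Y
      by (subst measure_distr) (auto intro!: arg_cong[where f=prob])
    have "measure (distr M borel (X i)) {t. B \<le> \<bar>t\<bar>} = measure (distr M borel (X 0)) {t. B \<le> \<bar>t\<bar>}"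
      by (rule arg_cong[where f="\<lambda>D. measure D {t. B \<le> \<bar>t\<bar>}"]) (use i identX in blast)
    then show "prob (?T i) = prob (?T 0)"
      using P[OF X0_measurable] P[of "X i"] i by (simp add: measX)
  qed
  also have "\<dots> \<le> L" using tail_prob by simp
  finally show ?thesis by simp
qed

text \<open>Three losses: the Berry--Esseen bound for truncated summands normalised by their own
  deviation \<open>B * \<sigma>\<close>, the probability \<open>L\<close> that truncation changes
  the sum, and the rescaling of \<open>Phi\<close> from \<open>x / \<sigma>\<close> to
  \<open>x\<close>.\<close>

lemma bound_n_ge_3:
  assumes n: "n \<ge> 3" and L1: "L < 1"
  shows "prob {\<omega> \<in> space M. S \<omega> \<le> x * B} - Phi x
    \<le> 0.4786 * M3 / sqrt (1 - L) ^ 3 + L + 0.242 * (1 / sqrt (1 - L) - 1)"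
proof -
  have mX[measurable]: "X i \<in> borel_measurable M" if "i < n" for i by (rule measX[OF that])
  have tX: "(\<lambda>\<omega>. trunc (X i \<omega>)) \<in> borel_measurable M" if "i < n" for i using that by measurable
  have tm: "(\<lambda>\<omega>. \<Sum>i<n. trunc (X i \<omega>)) \<in> borel_measurable M" by (rule borel_measurable_sum) auto
  define \<sigma> where "\<sigma> = sqrt (1 - L)"
  have \<sigma>: "0 < \<sigma>" "\<sigma> \<le> 1" using L1 L_nonneg by (auto simp: \<sigma>_def)
  have b: "sqrt (real n * expectation (\<lambda>\<omega>. (trunc (X 0 \<omega>))\<^sup>2)) = B * \<sigma>"
    by (simp add: expectation_trunc2 B_def \<sigma>_def real_sqrt_mult)
  have ti: "indep_vars (\<lambda>_. borel) (\<lambda>i \<omega>. trunc (X i \<omega>)) {..<n}"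
    using indepX by (rule indep_vars_compose2) auto
  have tid: "distr M borel (\<lambda>\<omega>. trunc (X i \<omega>)) = distr M borel (\<lambda>\<omega>. trunc (X 0 \<omega>))" if i: "i < n" for i
  proof -
    have "distr M borel (\<lambda>\<omega>. trunc (X i \<omega>)) = distr (distr M borel (X i)) borel trunc"
      using mX[OF i] by (subst distr_distr) (auto simp: comp_def)
    also have "\<dots> = distr (distr M borel (X 0)) borel trunc" by (simp only: identX[OF i])
    also have "\<dots> = distr M borel (\<lambda>\<omega>. trunc (X 0 \<omega>))"
      by (subst distr_distr) (auto simp: comp_def)
    finally show ?thesis .
  qed
  have ts: "distr M borel (\<lambda>\<omega>. - trunc (X 0 \<omega>)) = distr M borel (\<lambda>\<omega>. trunc (X 0 \<omega>))"
  proof -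
    have "distr M borel (\<lambda>\<omega>. - trunc (X 0 \<omega>)) = distr (distr M borel (\<lambda>\<omega>. - X 0 \<omega>)) borel trunc"
      by (subst distr_distr) (auto simp: comp_def trunc_def intro!: arg_cong[where f="distr M borel"])
    also have "\<dots> = distr (distr M borel (X 0)) borel trunc" by (simp only: symmX)
    also have "\<dots> = distr M borel (\<lambda>\<omega>. trunc (X 0 \<omega>))"
      by (subst distr_distr) (auto simp: comp_def)
    finally show ?thesis .
  qed
  have tpos: "0 < expectation (\<lambda>\<omega>. (trunc (X 0 \<omega>))\<^sup>2)" using v_pos L1 by (simp add: expectation_trunc2)
  have "prob {\<omega> \<in> space M. (\<Sum>i<n. trunc (X i \<omega>)) \<le> (x / \<sigma>) * (B * \<sigma>)} - Phi (x / \<sigma>)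
      \<le> 0.4786 * (real n * expectation (\<lambda>\<omega>. \<bar>trunc (X 0 \<omega>)\<bar> ^ 3) / (B * \<sigma>) ^ 3)"
    unfolding b[symmetric]
    by (rule symmetric_berry_esseen[OF tX n ti tid ts trunc_integrable trunc_integrable2 tpos]; assumption)
  also have "(x / \<sigma>) * (B * \<sigma>) = x * B" using \<sigma> by simp
  also have "real n * expectation (\<lambda>\<omega>. \<bar>trunc (X 0 \<omega>)\<bar> ^ 3) / (B * \<sigma>) ^ 3 = M3 / \<sigma> ^ 3"
    using B_pos by (simp add: expectation_trunc3 power_mult_distrib)
  finally have 1: "prob {\<omega> \<in> space M. (\<Sum>i<n. trunc (X i \<omega>)) \<le> x * B} - Phi (x / \<sigma>) \<le> 0.4786 * (M3 / \<sigma> ^ 3)" .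
  have s1: "1 \<le> 1 / \<sigma>" using \<sigma> by simp
  \<comment> \<open>For negative \<open>x\<close> the division by \<open>\<sigma> <= 1\<close> moves
    to the left, so the rescaling even helps.\<close>
  have 2: "Phi (x / \<sigma>) - Phi x \<le> 0.242 * (1 / \<sigma> - 1)"
  proof (cases "0 \<le> x")
    case True
    then show ?thesis using Phi_scale_le[OF True s1] by simp
  next
    case False
    then have "Phi (x / \<sigma>) \<le> Phi x" using \<sigma> by (intro Phi_mono) (auto simp: field_simps)
    moreover have "0 \<le> 0.242 * (1 / \<sigma> - 1)" using s1 by simp
    ultimately show ?thesis by linarith
  qed
  have "prob {\<omega> \<in> space M. S \<omega> \<le> x * B} - Phi x \<le> 0.4786 * (M3 / \<sigma> ^ 3) + L + 0.242 * (1 / \<sigma> - 1)"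
    using truncation_prob[of "x * B"] 1 2 by linarith
  then show ?thesis by (simp add: \<sigma>_def)
qed

subsection \<open>One or two summands\<close>

text \<open>By symmetry, changing the sign of the second summand gives again an independent family
  with the same marginal, and the characteristic function of the sum depends only on that
  marginal.\<close>

lemma difference_distr:
  assumes n: "n = 2"
  shows "distr M borel (\<lambda>\<omega>. X 0 \<omega> - X 1 \<omega>) = distr M borel S"
proof -
  have X1[measurable]: "X 1 \<in> borel_measurable M" using n by (intro measX) auto
  then have [measurable]: "X (Suc 0) \<in> borel_measurable M" by simp
  define Y where "Y = (\<lambda>i \<omega>. if i = (1::nat) then - X i \<omega> else X i \<omega>)"
  have i1: "distr M borel (X 1) = distr M borel (X 0)" by (rule identX) (simp add: n)
  have indY: "indep_vars (\<lambda>_. borel) Y {..<n}"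
  proof -
    have "indep_vars (\<lambda>_. borel) (\<lambda>i \<omega>. (\<lambda>x. if i = (1::nat) then - x else x) (X i \<omega>)) {..<n}"
      using indepX by (rule indep_vars_compose2) auto
    then show ?thesis by (simp add: Y_def)
  qed
  have mY: "Y i \<in> borel_measurable M" if "i < n" for i using measX[OF that] by (simp add: Y_def)
  have Y0: "Y 0 = X 0" by (simp add: Y_def)
  have idY: "distr M borel (Y i) = distr M borel (Y 0)" if i: "i < n" for i
  proof (cases "i = 1")
    case True
    have "distr M borel (Y i) = distr (distr M borel (X 1)) borel uminus"
      unfolding True by (subst distr_distr) (auto simp: comp_def Y_def)
    also have "\<dots> = distr (distr M borel (X 0)) borel uminus" by (simp only: i1)
    also have "\<dots> = distr M borel (\<lambda>\<omega>. - X 0 \<omega>)" by (subst distr_distr) (auto simp: comp_def)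
    also have "\<dots> = distr M borel (Y 0)" by (simp only: symmX Y0)
    finally show ?thesis .
  next
    case False
    then show ?thesis using identX[OF i] by (simp add: Y_def)
  qed
  have sY: "distr M borel (\<lambda>\<omega>. - Y 0 \<omega>) = distr M borel (Y 0)" unfolding Y0 by (rule symmX)
  have d: "X 0 \<omega> - X 1 \<omega> = (\<Sum>i<n. Y i \<omega>)" for \<omega> by (simp add: n Y_def numeral_2_eq_2)
  have "char (distr M borel (\<lambda>\<omega>. X 0 \<omega> - X 1 \<omega>)) t = char (distr M borel S) t" for t
  proof -
    have "expectation (\<lambda>\<omega>. cos (t * (\<Sum>i<n. Y i \<omega>))) = expectation (\<lambda>\<omega>. cos (t * Y 0 \<omega>)) ^ n"
      by (rule sum_char(1)[OF mY n_ge_1 indY idY sY]; assumption)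
    moreover have "expectation (\<lambda>\<omega>. sin (t * (\<Sum>i<n. Y i \<omega>))) = 0"
      by (rule sum_char(2)[OF mY n_ge_1 indY idY sY]; assumption)
    moreover have "expectation (\<lambda>\<omega>. cos (t * S \<omega>)) = expectation (\<lambda>\<omega>. cos (t * X 0 \<omega>)) ^ n"
      unfolding S_def by (rule sum_char(1)[OF measX n_ge_1 indepX identX symmX]; assumption)
    moreover have "expectation (\<lambda>\<omega>. sin (t * S \<omega>)) = 0"
      unfolding S_def by (rule sum_char(2)[OF measX n_ge_1 indepX identX symmX]; assumption)
    moreover have "(\<lambda>\<omega>. X 0 \<omega> - X 1 \<omega>) \<in> borel_measurable M" by measurable
    ultimately show ?thesis by (simp add: char_distr_eq Y0 flip: d)
  qed
  then show ?thesis by (intro Levy_uniqueness) (auto intro!: real_distribution_distr ext)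
qed

text \<open>Since \<open>max \<bar>a + b\<bar> \<bar>a - b\<bar> = \<bar>a\<bar> + \<bar>b\<bar>\<close>, both the sum and the difference can be small only if
  both summands are.\<close>
lemma small_concentration:
  assumes n: "n \<le> 2"
  shows "2 * prob {\<omega> \<in> space M. \<bar>S \<omega>\<bar> \<le> y} \<le> 1 + (prob {\<omega> \<in> space M. \<bar>X 0 \<omega>\<bar> \<le> y})\<^sup>2"
proof (cases "n = 2")
  case False
  then have n1: "n = 1" using n n_ge_1 by simp
  have "S = X 0" by (rule ext, unfold S_def) (simp add: n1)
  then show ?thesis
    using zero_le_power2[of "1 - prob {\<omega> \<in> space M. \<bar>X 0 \<omega>\<bar> \<le> y}"] unfolding power2_diff by simp
next
  case True
  have X1[measurable]: "X 1 \<in> borel_measurable M" using True by (intro measX) auto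
  then have [measurable]: "X (Suc 0) \<in> borel_measurable M" by simp
  have P: "measure (distr M borel Y) {t. \<bar>t\<bar> \<le> y} = prob {\<omega> \<in> space M. \<bar>Y \<omega>\<bar> \<le> y}"
    if [measurable]: "Y \<in> borel_measurable M" for Y
    by (subst measure_distr) (auto intro!: arg_cong[where f=prob])
  have D: "prob {\<omega> \<in> space M. \<bar>X 0 \<omega> - X 1 \<omega>\<bar> \<le> y} = prob {\<omega> \<in> space M. \<bar>S \<omega>\<bar> \<le> y}"
  proof -
    have "prob {\<omega> \<in> space M. \<bar>X 0 \<omega> - X 1 \<omega>\<bar> \<le> y} = measure (distr M borel (\<lambda>\<omega>. X 0 \<omega> - X 1 \<omega>)) {t. \<bar>t\<bar> \<le> y}"
      by (rule P[symmetric]) measurable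
    also have "\<dots> = prob {\<omega> \<in> space M. \<bar>S \<omega>\<bar> \<le> y}"
      unfolding difference_distr[OF True] by (rule P[OF S_measurable])
    finally show ?thesis .
  qed
  have i1: "distr M borel (X 1) = distr M borel (X 0)" by (rule identX) (simp add: True)
  have p1: "prob {\<omega> \<in> space M. \<bar>X 1 \<omega>\<bar> \<le> y} = prob {\<omega> \<in> space M. \<bar>X 0 \<omega>\<bar> \<le> y}"
    using P[OF X0_measurable] P[OF X1] unfolding i1 by simp
  let ?E = "{\<omega> \<in> space M. \<bar>S \<omega>\<bar> \<le> y}" and ?F = "{\<omega> \<in> space M. \<bar>X 0 \<omega> - X 1 \<omega>\<bar> \<le> y}"
  let ?G = "{\<omega> \<in> space M. \<bar>X 0 \<omega>\<bar> \<le> y} \<inter> {\<omega> \<in> space M. \<bar>X 1 \<omega>\<bar> \<le> y}"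
  have S: "S \<omega> = X 0 \<omega> + X 1 \<omega>" for \<omega> unfolding S_def by (simp add: True numeral_2_eq_2)
  have "prob ?E + prob ?F = prob (?E \<union> ?F) + prob (?E \<inter> ?F)"
    by (subst measure_Un3) (auto simp: fmeasurable_eq_sets)
  also have "\<dots> \<le> 1 + prob ?G"
    by (intro add_mono prob_le_1 finite_measure_mono) (auto simp: S)
  also have "prob ?G = prob {\<omega> \<in> space M. \<bar>X 0 \<omega>\<bar> \<le> y} * prob {\<omega> \<in> space M. \<bar>X 1 \<omega>\<bar> \<le> y}"
  proof -
    have "prob (\<Inter>i\<in>{..<n}. X i -` {t. \<bar>t\<bar> \<le> y} \<inter> space M) = (\<Prod>i\<in>{..<n}. prob (X i -` {t. \<bar>t\<bar> \<le> y} \<inter> space M))"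
      using indepX by (rule indep_varsD) (auto simp: True lessThan_empty_iff)
    moreover have "(\<Inter>i\<in>{..<n}. X i -` {t. \<bar>t\<bar> \<le> y} \<inter> space M) = ?G"
      by (auto simp: True lessThan_Suc numeral_2_eq_2)
    moreover have "X i -` {t. \<bar>t\<bar> \<le> y} \<inter> space M = {\<omega> \<in> space M. \<bar>X i \<omega>\<bar> \<le> y}" for i by auto
    ultimately show ?thesis by (simp add: True numeral_2_eq_2)
  qed
  finally show ?thesis unfolding D p1 by (simp add: power2_eq_square)
qed

text \<open>For two summands the parallelogram law, together with the equal laws of sum and
  difference, yields the second moment without evaluating a mixed expectation.\<close>

lemma small_second_moment:
  assumes n: "n \<le> 2"
  shows "integrable M (\<lambda>\<omega>. (S \<omega>)\<^sup>2)" "expectation (\<lambda>\<omega>. (S \<omega>)\<^sup>2) = B\<^sup>2"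
proof -
  have "integrable M (\<lambda>\<omega>. (S \<omega>)\<^sup>2) \<and> expectation (\<lambda>\<omega>. (S \<omega>)\<^sup>2) = B\<^sup>2"
  proof (cases "n = 2")
    case False
    then have n1: "n = 1" using n n_ge_1 by simp
    have "S = X 0" by (rule ext, unfold S_def) (simp add: n1)
    moreover have "B\<^sup>2 = v" unfolding B_sq by (simp add: n1)
    ultimately show ?thesis using sqX by (simp_all add: v_def)
  next
    case True
    have X1[measurable]: "X 1 \<in> borel_measurable M" using True by (intro measX) auto
    then have [measurable]: "X (Suc 0) \<in> borel_measurable M" by simp
    have i1: "distr M borel (X 1) = distr M borel (X 0)" by (rule identX) (simp add: True)
    have sq1: "integrable M (\<lambda>\<omega>. (X 1 \<omega>)\<^sup>2)"
    proof -
      have "integrable (distr M borel (X 1)) (\<lambda>x. x\<^sup>2)"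
        unfolding i1 using sqX by (subst integrable_distr_eq) auto
      then show ?thesis by (subst (asm) integrable_distr_eq) auto
    qed
    have v1: "expectation (\<lambda>\<omega>. (X 1 \<omega>)\<^sup>2) = v"
      unfolding v_def using True by (intro expectation_ident) auto
    have S: "S \<omega> = X 0 \<omega> + X 1 \<omega>" for \<omega> unfolding S_def by (simp add: True numeral_2_eq_2)
    have par: "(X 0 \<omega> + X 1 \<omega>)\<^sup>2 + (X 0 \<omega> - X 1 \<omega>)\<^sup>2 = 2 * (X 0 \<omega>)\<^sup>2 + 2 * (X 1 \<omega>)\<^sup>2" for \<omega>
      by (simp add: power2_eq_square algebra_simps)
    have iS: "integrable M (\<lambda>\<omega>. (S \<omega>)\<^sup>2)"
    proof (rule Bochner_Integration.integrable_bound)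
      show "integrable M (\<lambda>\<omega>. 2 * (X 0 \<omega>)\<^sup>2 + 2 * (X 1 \<omega>)\<^sup>2)" using sqX sq1 by simp
      show "AE \<omega> in M. norm ((S \<omega>)\<^sup>2) \<le> norm (2 * (X 0 \<omega>)\<^sup>2 + 2 * (X 1 \<omega>)\<^sup>2)"
        unfolding S par[symmetric] by (intro AE_I2) simp
    qed measurable
    have iD: "integrable M (\<lambda>\<omega>. (X 0 \<omega> - X 1 \<omega>)\<^sup>2)"
    proof (rule Bochner_Integration.integrable_bound)
      show "integrable M (\<lambda>\<omega>. 2 * (X 0 \<omega>)\<^sup>2 + 2 * (X 1 \<omega>)\<^sup>2)" using sqX sq1 by simp
      show "AE \<omega> in M. norm ((X 0 \<omega> - X 1 \<omega>)\<^sup>2) \<le> norm (2 * (X 0 \<omega>)\<^sup>2 + 2 * (X 1 \<omega>)\<^sup>2)"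
        unfolding par[symmetric] by (intro AE_I2) simp
    qed measurable
    have D: "expectation (\<lambda>\<omega>. (X 0 \<omega> - X 1 \<omega>)\<^sup>2) = expectation (\<lambda>\<omega>. (S \<omega>)\<^sup>2)"
    proof -
      have "expectation (\<lambda>\<omega>. (X 0 \<omega> - X 1 \<omega>)\<^sup>2) = integral\<^sup>L (distr M borel (\<lambda>\<omega>. X 0 \<omega> - X 1 \<omega>)) (\<lambda>x. x\<^sup>2)"
        by (rule integral_distr[symmetric]) auto
      also have "\<dots> = integral\<^sup>L (distr M borel S) (\<lambda>x. x\<^sup>2)" by (simp only: difference_distr[OF True])
      also have "\<dots> = expectation (\<lambda>\<omega>. (S \<omega>)\<^sup>2)" by (rule integral_distr) auto
      finally show ?thesis .
    qed
    have "expectation (\<lambda>\<omega>. (S \<omega>)\<^sup>2) + expectation (\<lambda>\<omega>. (X 0 \<omega> - X 1 \<omega>)\<^sup>2)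
        = expectation (\<lambda>\<omega>. (S \<omega>)\<^sup>2 + (X 0 \<omega> - X 1 \<omega>)\<^sup>2)" using iS iD by simp
    also have "\<dots> = expectation (\<lambda>\<omega>. 2 * (X 0 \<omega>)\<^sup>2 + 2 * (X 1 \<omega>)\<^sup>2)" unfolding S par ..
    also have "\<dots> = 4 * v" using sqX sq1 v1 by (simp add: v_def)
    finally have "expectation (\<lambda>\<omega>. (S \<omega>)\<^sup>2) = B\<^sup>2" unfolding D B_sq by (simp add: True)
    with iS show ?thesis by auto
  qed
  then show "integrable M (\<lambda>\<omega>. (S \<omega>)\<^sup>2)" "expectation (\<lambda>\<omega>. (S \<omega>)\<^sup>2) = B\<^sup>2" by auto
qed

lemma small_chebyshev:
  assumes n: "n \<le> 2" and y: "y > 0"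
  shows "prob {\<omega> \<in> space M. y * B \<le> \<bar>S \<omega>\<bar>} \<le> 1 / y\<^sup>2"
proof -
  have "(y * B)\<^sup>2 * prob {\<omega> \<in> space M. y * B \<le> \<bar>S \<omega>\<bar>}
      = expectation (\<lambda>\<omega>. (y * B)\<^sup>2 * indicator {\<omega> \<in> space M. y * B \<le> \<bar>S \<omega>\<bar>} \<omega>)"
    by simp
  also have "\<dots> \<le> expectation (\<lambda>\<omega>. (S \<omega>)\<^sup>2)"
  proof (rule integral_mono[OF _ small_second_moment(1)[OF n]])
    have "(y * B)\<^sup>2 \<le> t\<^sup>2" if "y * B \<le> \<bar>t\<bar>" for t
      using that B_pos y by (simp add: abs_le_square_iff[symmetric] abs_mult)
    then show "(y * B)\<^sup>2 * indicator {\<omega> \<in> space M. y * B \<le> \<bar>S \<omega>\<bar>} \<omega> \<le> (S \<omega>)\<^sup>2"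
      if "\<omega> \<in> space M" for \<omega> by (simp add: indicator_def)
  qed (intro integrable_mult_right integrable_real_indicator; simp add: emeasure_eq_measure)
  also have "\<dots> = B\<^sup>2" by (rule small_second_moment(2)[OF n])
  finally show ?thesis using B_pos y by (simp add: power_mult_distrib field_simps)
qed

text \<open>Too much mass near \<open>0\<close> would make the truncated variance too small: the
  truncated square is at most \<open>B^2\<close>, and at most \<open>0.16 * B^2\<close> on the
  central event, whence \<open>0.84\<close>. With \<open>B^2 <= 2 * v\<close> this limits the
  mass.\<close>

lemma small_center_prob:
  assumes n: "n \<le> 2"
  shows "0.84 * prob {\<omega> \<in> space M. \<bar>X 0 \<omega>\<bar> \<le> 0.4 * B} \<le> (1 + L) / 2"
proof -
  let ?q = "prob {\<omega> \<in> space M. \<bar>X 0 \<omega>\<bar> \<le> 0.4 * B}"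
  have "v * (1 - L) = expectation (\<lambda>\<omega>. (trunc (X 0 \<omega>))\<^sup>2)" by (simp add: expectation_trunc2)
  also have "\<dots> \<le> expectation (\<lambda>\<omega>. B\<^sup>2 - 0.84 * B\<^sup>2 * indicator {\<omega> \<in> space M. \<bar>X 0 \<omega>\<bar> \<le> 0.4 * B} \<omega>)"
  proof (rule integral_mono[OF trunc_integrable2])
    have "(trunc t)\<^sup>2 \<le> B\<^sup>2" for t
      using B_pos by (auto simp: trunc_def abs_le_square_iff[symmetric])
    moreover have "(trunc t)\<^sup>2 \<le> (0.4 * B)\<^sup>2" if "\<bar>t\<bar> \<le> 0.4 * B" for t
      using that B_pos unfolding abs_le_square_iff[symmetric] by (auto simp: trunc_def)
    ultimately show "(trunc (X 0 \<omega>))\<^sup>2 \<le> B\<^sup>2 - 0.84 * B\<^sup>2 * indicator {\<omega> \<in> space M. \<bar>X 0 \<omega>\<bar> \<le> 0.4 * B} \<omega>"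
      for \<omega> by (fastforce simp: indicator_def power2_eq_square)
  qed (intro Bochner_Integration.integrable_diff integrable_const integrable_mult_right
    integrable_real_indicator; simp add: emeasure_eq_measure)
  also have "\<dots> = B\<^sup>2 * (1 - 0.84 * ?q)"
    by (subst Bochner_Integration.integral_diff) (auto simp: prob_space algebra_simps emeasure_eq_measure)
  finally have "v * (1 - L) \<le> v * (real n * (1 - 0.84 * ?q))" by (simp add: B_sq algebra_simps)
  then have "1 - L \<le> real n * (1 - 0.84 * ?q)" by (rule mult_left_le_imp_le) (rule v_pos)
  also have "\<dots> \<le> 2 * (1 - 0.84 * ?q)"
  proof (rule mult_right_mono)
    have "0 \<le> 1 - 0.84 * q" if "q \<le> 1" for q :: real using that by simp
    then show "0 \<le> 1 - 0.84 * ?q" using prob_le_1 by blast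
  qed (use n in simp)
  finally show ?thesis by simp
qed

text \<open>For \<open>x >= 0.4\<close> the value of \<open>Phi\<close> is large enough by itself,
  which gives \<open>0.3477 = 1 - 0.6523\<close>. For \<open>0 <= x < 0.4\<close> the concentration
  estimate limits the mass near the centre. For negative \<open>x\<close> half of Chebyshev's bound
  is weighed against \<open>Phi\<close>.\<close>

lemma bound_n_le_2:
  assumes n: "n \<le> 2" and p: "(1 + L) / 2 \<le> 0.84 * p" and d: "(1 + p\<^sup>2) / 4 \<le> \<delta>" "0.3477 \<le> \<delta>"
  shows "prob {\<omega> \<in> space M. S \<omega> \<le> x * B} - Phi x \<le> \<delta>"
proof -
  consider "0.4 \<le> x" | "0 \<le> x" "x < 0.4" | "x < 0" by linarith
  then show ?thesis
  proof cases
    case 1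
    have "0.6523 \<le> Phi x" using Phi_mono[OF 1] Phi_04_ge by (rule order_trans[rotated])
    then have "1 - Phi x \<le> 0.3477" by simp
    then show ?thesis using prob_le_1[of "{\<omega> \<in> space M. S \<omega> \<le> x * B}"] d(2) by linarith
  next
    case 2
    let ?q = "prob {\<omega> \<in> space M. \<bar>X 0 \<omega>\<bar> \<le> 0.4 * B}" and ?y = "0.4 * B"
    have q: "0 \<le> ?q" "?q \<le> p" using small_center_prob[OF n] p by auto
    have "?q\<^sup>2 \<le> p\<^sup>2" using q by (intro power_mono) auto
    then have c: "2 * prob {\<omega> \<in> space M. \<bar>S \<omega>\<bar> \<le> ?y} \<le> 1 + p\<^sup>2"
      using small_concentration[OF n, of ?y] by linarith
    have "prob {\<omega> \<in> space M. S \<omega> \<le> ?y} = prob ({\<omega> \<in> space M. S \<omega> < - ?y} \<union> {\<omega> \<in> space M. \<bar>S \<omega>\<bar> \<le> ?y})"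
      using B_pos by (intro arg_cong[where f=prob]) auto
    also have "\<dots> = prob {\<omega> \<in> space M. S \<omega> < - ?y} + prob {\<omega> \<in> space M. \<bar>S \<omega>\<bar> \<le> ?y}"
      by (rule finite_measure_Union) auto
    also have "prob {\<omega> \<in> space M. S \<omega> < - ?y} = 1 - prob {\<omega> \<in> space M. S \<omega> \<le> ?y}"
      using symmetric_prob_less[OF S_measurable S_symmetric, of "- ?y"] by simp
    \<comment> \<open>By symmetry the probability occurs on both sides; solving gives
      \<open>1 / 2\<close> plus half the mass of the central interval.\<close>
    finally have s0: "prob {\<omega> \<in> space M. S \<omega> \<le> ?y} = 1 - prob {\<omega> \<in> space M. S \<omega> \<le> ?y}
      + prob {\<omega> \<in> space M. \<bar>S \<omega>\<bar> \<le> ?y}" .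
    have s: "prob {\<omega> \<in> space M. S \<omega> \<le> ?y} \<le> 1 / 2 + (1 + p\<^sup>2) / 4"
    proof -
      have "a \<le> 1 / 2 + d / 4" if "a = 1 - a + b" "2 * b \<le> d" for a b d :: real using that by simp
      from this[OF s0 c] show ?thesis .
    qed
    have "prob {\<omega> \<in> space M. S \<omega> \<le> x * B} \<le> prob {\<omega> \<in> space M. S \<omega> \<le> ?y}"
    proof (rule finite_measure_mono)
      have "x * B \<le> ?y" using 2 B_pos by (intro mult_right_mono) auto
      then show "{\<omega> \<in> space M. S \<omega> \<le> x * B} \<subseteq> {\<omega> \<in> space M. S \<omega> \<le> ?y}" by auto
    qed measurable
    moreover have "1 / 2 \<le> Phi x" using Phi_mono[OF 2(1)] by (simp add: Phi_0)
    ultimately show ?thesis using s d(1) by linarith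
  next
    case 3
    define y where "y = - x"
    have y: "0 < y" "x = - y" using 3 by (auto simp: y_def)
    let ?P = "prob {\<omega> \<in> space M. S \<omega> \<le> x * B}" and ?Q = "prob {\<omega> \<in> space M. y * B \<le> \<bar>S \<omega>\<bar>}"
    have "x * B < 0" using 3 B_pos by (simp add: mult_neg_pos)
    from symmetric_prob_neg_le_half[OF S_measurable S_symmetric this]
    have PQ: "2 * ?P = ?Q" by (simp add: y_def)
    have Q: "?Q \<le> 1" "?Q \<le> 1 / y\<^sup>2" using small_chebyshev[OF n y(1)] by auto
    have Px: "Phi x = 1 - Phi y" by (simp add: y(2) Phi_minus)
    have "?P + Phi y - 1 \<le> 0.3477"
    proof -
      consider "y \<le> 1" | "1 \<le> y" "y \<le> 2" | "2 \<le> y" by linarith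
      then show ?thesis
      proof cases
        case 1
        have "Phi y \<le> 0.8425" using Phi_mono[OF 1] Phi_1_le by (rule order_trans)
        moreover have "2 * ?P \<le> 1" using PQ Q(1) by linarith
        ultimately show ?thesis by simp
      next
        case 2
        have py: "Phi y \<le> 0.8425 + 0.242 * (y - 1)"
        proof -
          have "Phi y - Phi 1 \<le> 0.242 * (y - 1)" using Phi_scale_le[of 1 y] 2 by simp
          then show ?thesis using Phi_1_le by linarith
        qed
        \<comment> \<open>The slope \<open>0.484 = 2 * 0.242\<close> is chosen so that the decrease
          of the halved Chebyshev bound cancels the increase of the bound for \<open>Phi y\<close>,
          leaving the value at \<open>y = 1\<close>.\<close>
        have "0 \<le> (y - 1) * (y + 1 - 0.484 * y\<^sup>2)"
        proof (rule mult_nonneg_nonneg)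
          have "y\<^sup>2 \<le> 2\<^sup>2" using 2 by (intro power_mono) auto
          moreover have "0 \<le> y + 1 - 0.484 * z" if "z \<le> 2\<^sup>2" for z using that 2 by simp
          ultimately show "0 \<le> y + 1 - 0.484 * y\<^sup>2" by blast
        qed (use 2 in simp)
        then have "1 \<le> y\<^sup>2 * (1 - 0.484 * (y - 1))" by (simp add: power2_eq_square algebra_simps)
        then have "1 / y\<^sup>2 \<le> 1 - 0.484 * (y - 1)" using y by (simp add: divide_le_eq mult.commute)
        then have "2 * ?P \<le> 1 - 0.484 * (y - 1)" using PQ Q(2) by linarith
        then show ?thesis using py by simp
      next
        case 3
        have "1 / y\<^sup>2 \<le> 1 / 2\<^sup>2" using 3 by (intro divide_left_mono power_mono) auto
        then have "2 * ?P \<le> 1 / 4" using PQ Q(2) by simp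
        then show ?thesis using Phi_bounds(2)[of y] by simp
      qed
    qed
    then show ?thesis using d(2) Px by simp
  qed
qed

end

section \<open>The constants\<close>

text \<open>Here \<open>a\<close> bounds the coefficient of \<open>m\<close>, and \<open>b\<close>
  that of \<open>L\<close> in the rescaling term, since
  \<open>1 / q - 1 = L / (q * (1 + q))\<close>. What remains is
  \<open>a * m + (1 + b) * L <= c * (L + m)\<close>; as \<open>a <= c\<close>, its worst case is
  \<open>m = g * L\<close>, and this is the last hypothesis.\<close>

lemma truncated_bound_le_linear:
  fixes L m a b c g s :: real
  assumes L: "0 < L" "L < 1" and m: "0 \<le> m" "g * L \<le> m" and s: "0 < s" "s\<^sup>2 \<le> 1 - L"
    and a: "0.4786 \<le> a * s ^ 3" "a \<le> c" and b: "0.242 \<le> b * (s * (1 + s))" and abc: "1 + b \<le> c + (c - a) * g"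
  shows "0.4786 * m / sqrt (1 - L) ^ 3 + L + 0.242 * (1 / sqrt (1 - L) - 1) \<le> c * (L + m)"
proof -
  define q where "q = sqrt (1 - L)"
  have q: "s \<le> q" "0 < q" "q\<^sup>2 = 1 - L" using s L by (auto simp: q_def real_le_rsqrt)
  have "0 < a * s ^ 3" using a(1) by simp
  then have a0: "0 \<le> a" using s zero_less_mult_pos2[of a "s ^ 3"] by simp
  have "a * s ^ 3 \<le> a * q ^ 3" using q s a0 by (intro mult_left_mono power_mono) auto
  then have "0.4786 \<le> a * q ^ 3" using a(1) by linarith
  then have "0.4786 * m \<le> a * q ^ 3 * m" using m(1) by (rule mult_right_mono)
  then have 1: "0.4786 * m / q ^ 3 \<le> a * m" using q by (simp add: divide_le_eq mult_ac)
  have "0 < b * (s * (1 + s))" using b by simp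
  then have b0: "0 \<le> b" using s zero_less_mult_pos2[of b "s * (1 + s)"] by simp
  have "b * (s * (1 + s)) \<le> b * (q * (1 + q))" using q s b0 by (intro mult_left_mono mult_mono) auto
  then have bq: "0.242 \<le> b * (q * (1 + q))" using b by linarith
  have e: "1 / q - 1 = L / (q * (1 + q))"
  proof -
    have "L = (1 - q) * (1 + q)" using q(3) by (simp add: power2_eq_square algebra_simps)
    moreover have "1 + q \<noteq> 0" using q(2) by simp
    ultimately show ?thesis using q(2) by (simp add: diff_divide_distrib)
  qed
  have "0.242 * L \<le> b * (q * (1 + q)) * L" using bq L by (intro mult_right_mono) auto
  then have 2: "0.242 * (1 / q - 1) \<le> b * L" unfolding e using q by (simp add: divide_le_eq mult_ac)
  have "(1 + b - c) * L \<le> (c - a) * g * L" using abc L by (intro mult_right_mono) auto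
  also have "\<dots> \<le> (c - a) * m" unfolding mult.assoc using m a(2) by (intro mult_left_mono) auto
  finally have "a * m + L + b * L \<le> c * (L + m)" by (simp add: algebra_simps)
  then show ?thesis using 1 2 unfolding q_def by linarith
qed

context iid_symmetric begin

text \<open>With \<open>s = sqrt (1 - L)\<close> the sum is at least about
  \<open>1 - s^2 + s^3 / sqrt 2\<close>. Tangents of \<open>s^3\<close> as a function of
  \<open>s^2\<close> make this linear: contact at \<open>0.943\<close>, the approximate minimiser,
  for the uniform bound, and at \<open>1\<close> for the bound that is sharp when \<open>L\<close>
  is close to \<open>0\<close>.\<close>

lemma small_moments_ge:
  assumes n: "n \<le> 2"
  shows "0.7 \<le> L + M3" "0.7071 - 0.061 * L \<le> L + M3"
proof -
  define s where "s = sqrt (1 - L)"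
  have s: "0 \<le> s" "L = 1 - s\<^sup>2" using L_le_1 by (auto simp: s_def)
  have "sqrt n \<le> 1.41422" using n by (intro real_le_lsqrt) (auto simp: power2_eq_square)
  then have "sqrt n * M3 \<le> 1.41422 * M3" using M3_nonneg by (rule mult_right_mono)
  then have s3: "s ^ 3 \<le> 1.41422 * M3" using M3_ge by (simp add: s_def)
  have sos: "0 \<le> s ^ 3 - 3 / 2 * r * s\<^sup>2 + r ^ 3 / 2" if "0 \<le> r" for r
  proof -
    have "0 \<le> (s - r)\<^sup>2 * (s + r / 2)" using s that by simp
    then show ?thesis by (simp add: power2_eq_square power3_eq_cube algebra_simps)
  qed
  have e: "0.7 \<le> L + m" if "z \<le> 1.41422 * m" "0 \<le> z - 3 / 2 * 0.943 * w + 0.943 ^ 3 / 2" "L = 1 - w" "0 \<le> m"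
    "0 \<le> w" for z w m
    using that by (simp add: power3_eq_cube)
  show "0.7 \<le> L + M3" by (rule e[OF s3 sos s(2) M3_nonneg]) auto
  have e: "0.7071 - 0.061 * L \<le> L + m" if "z \<le> 1.41422 * m" "0 \<le> z - 3 / 2 * 1 * w + 1 ^ 3 / 2" "L = 1 - w"
    "0 \<le> m" "0 \<le> w" "0 \<le> L" for z w m
    using that by (simp add: field_simps)
  show "0.7071 - 0.061 * L \<le> L + M3" by (rule e[OF s3 sos s(2) M3_nonneg _ L_nonneg]) auto
qed

text \<open>The trivial bound \<open>1 / 2\<close> settles the case \<open>c * (L + M3) \<ge> 1 / 2\<close>; otherwise \<open>L \<le> 1 / (2 * c * (1 + g))\<close>, so the
  truncation changes the variance only slightly and its lower bound \<open>s\<^sup>2\<close> is explicit.\<close>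
lemma kolmogorov_bound:
  assumes L0: "0 < L" and g: "0 \<le> g" "g * L \<le> M3" and c: "0 < c"
    and s: "0 < s" "s\<^sup>2 \<le> 1 - 1 / (2 * c * (1 + g))"
    and a: "0.4786 \<le> a * s ^ 3" "a \<le> c" and b: "0.242 \<le> b * (s * (1 + s))" and abc: "1 + b \<le> c + (c - a) * g"
    and small: "n \<le> 2 \<Longrightarrow> L \<le> 1 / (2 * c * (1 + g)) \<Longrightarrow> c * (L + M3) < 1 / 2 \<Longrightarrow>
      \<exists>p. (1 + L) / 2 \<le> 0.84 * p \<and> (1 + p\<^sup>2) / 4 \<le> c * (L + M3) \<and> 0.3477 \<le> c * (L + M3)"
  shows "prob {\<omega> \<in> space M. S \<omega> \<le> x * B} - Phi x \<le> c * (L + M3)"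
proof (cases "c * (L + M3) < 1 / 2")
  case False
  then show ?thesis using half_bound[of x] by linarith
next
  case True
  have "c * (L * (1 + g)) \<le> c * (L + M3)" using g c by (intro mult_left_mono) (auto simp: algebra_simps)
  then have "2 * (c * (L * (1 + g))) \<le> 1" using True by linarith
  then have "L * (2 * c * (1 + g)) \<le> 1" by (simp add: algebra_simps)
  then have L1: "L \<le> 1 / (2 * c * (1 + g))" using g c by (simp add: le_divide_eq)
  show ?thesis
  proof (cases "n \<le> 2")
    case n: True
    obtain p where "(1 + L) / 2 \<le> 0.84 * p" "(1 + p\<^sup>2) / 4 \<le> c * (L + M3)" "0.3477 \<le> c * (L + M3)"
      using small[OF n L1 True] by blast
    then show ?thesis by (rule bound_n_le_2[OF n])
  next
    case False
    have sL: "s\<^sup>2 \<le> 1 - L" using s(2) L1 by linarith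
    moreover have "0 < s\<^sup>2" using s by simp
    ultimately have L2: "L < 1" by linarith
    have "prob {\<omega> \<in> space M. S \<omega> \<le> x * B} - Phi x
        \<le> 0.4786 * M3 / sqrt (1 - L) ^ 3 + L + 0.242 * (1 / sqrt (1 - L) - 1)"
      using False L2 by (intro bound_n_ge_3) auto
    also have "\<dots> \<le> c * (L + M3)"
      by (rule truncated_bound_le_linear[OF L0 L2 M3_nonneg g(2) s(1) sL a b abc])
    finally show ?thesis .
  qed
qed

text \<open>In each row \<open>s\<close> is \<open>sqrt (1 - 1 / (2 * c * (1 + g)))\<close> rounded
  down, while \<open>a\<close> and \<open>b\<close> are \<open>0.4786 / s^3\<close> and
  \<open>0.242 / (s * (1 + s))\<close> rounded up. In the row \<open>g = 100\<close> the final
  comparison \<open>1.12195 <= 1.1223\<close> leaves almost no slack.\<close>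

lemma kolmogorov_bound_cases:
  assumes L0: "0 < L" and g: "g * L \<le> M3"
    and gc: "(g, c) \<in> {(0, 1.2388), (2, 1.0373), (5, 0.7915), (10, 0.6591), (100, 0.4923)}"
  shows "prob {\<omega> \<in> space M. S \<omega> \<le> x * B} - Phi x \<le> c * (L + M3)"
proof -
  \<comment> \<open>The premises are contradictory: \<open>L + M3 >= 0.7\<close> and
    \<open>c >= 0.75\<close> give more than \<open>1 / 2\<close>. Hence small \<open>n\<close> needs
    work only in the last two rows.\<close>
  have vac: "\<exists>p. (1 + L) / 2 \<le> 0.84 * p \<and> (1 + p\<^sup>2) / 4 \<le> c * (L + M3) \<and> 0.3477 \<le> c * (L + M3)"
    if "n \<le> 2" "c * (L + M3) < 1 / 2" "0.75 \<le> c" for c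
  proof -
    have "0.75 * 0.7 \<le> c * (L + M3)" using small_moments_ge(1)[OF that(1)] that(3) by (intro mult_mono) auto
    then show ?thesis using that(2) by simp
  qed
  from gc consider "g = 0" "c = 1.2388" | "g = 2" "c = 1.0373" | "g = 5" "c = 0.7915"
    | "g = 10" "c = 0.6591" | "g = 100" "c = 0.4923" by auto
  then show ?thesis
  proof cases
    case 1
    show ?thesis
      unfolding 1(2)
    proof (rule kolmogorov_bound[OF L0 _ g[unfolded 1(1)], where s="0.7722" and a="1.0395" and b="0.1769"])
      show "\<exists>p. (1 + L) / 2 \<le> 0.84 * p \<and> (1 + p\<^sup>2) / 4 \<le> 1.2388 * (L + M3) \<and> 0.3477 \<le> 1.2388 * (L + M3)"
        if "n \<le> 2" "1.2388 * (L + M3) < 1 / 2"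
        by (rule vac[OF that]) simp
    qed (simp_all add: power2_eq_square power3_eq_cube)
  next
    case 2
    show ?thesis
      unfolding 2(2)
    proof (rule kolmogorov_bound[OF L0 _ g[unfolded 2(1)], where s="0.9161" and a="0.6226" and b="0.138"])
      show "\<exists>p. (1 + L) / 2 \<le> 0.84 * p \<and> (1 + p\<^sup>2) / 4 \<le> 1.0373 * (L + M3) \<and> 0.3477 \<le> 1.0373 * (L + M3)"
        if "n \<le> 2" "1.0373 * (L + M3) < 1 / 2"
        by (rule vac[OF that]) simp
    qed (simp_all add: power2_eq_square power3_eq_cube)
  next
    case 3
    show ?thesis
      unfolding 3(2)
    proof (rule kolmogorov_bound[OF L0 _ g[unfolded 3(1)], where s="0.9458" and a="0.5658" and b="0.1316"])
      show "\<exists>p. (1 + L) / 2 \<le> 0.84 * p \<and> (1 + p\<^sup>2) / 4 \<le> 0.7915 * (L + M3) \<and> 0.3477 \<le> 0.7915 * (L + M3)"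
        if "n \<le> 2" "0.7915 * (L + M3) < 1 / 2"
        by (rule vac[OF that]) simp
    qed (simp_all add: power2_eq_square power3_eq_cube)
  next
    case 4
    show ?thesis
      unfolding 4(2)
    proof (rule kolmogorov_bound[OF L0 _ g[unfolded 4(1)], where s="0.9648" and a="0.533" and b="0.1277"])
      show "\<exists>p. (1 + L) / 2 \<le> 0.84 * p \<and> (1 + p\<^sup>2) / 4 \<le> 0.6591 * (L + M3) \<and> 0.3477 \<le> 0.6591 * (L + M3)"
        if n: "n \<le> 2" and L: "L \<le> 1 / (2 * 0.6591 * (1 + 10))"
      proof (intro exI conjI)
        have "0.6591 * 0.7 \<le> 0.6591 * (L + M3)" using small_moments_ge(1)[OF n] by (intro mult_left_mono) auto
        then show "(1 + 0.64\<^sup>2) / 4 \<le> 0.6591 * (L + M3)" "0.3477 \<le> 0.6591 * (L + M3)"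
          by (simp_all add: power2_eq_square)
        show "(1 + L) / 2 \<le> 0.84 * 0.64" using L by simp
      qed
    qed (simp_all add: power2_eq_square power3_eq_cube)
  next
    case 5
    show ?thesis
      unfolding 5(2)
    proof (rule kolmogorov_bound[OF L0 _ g[unfolded 5(1)], where s="0.9949" and a="0.486" and b="0.12195"])
      show "\<exists>p. (1 + L) / 2 \<le> 0.84 * p \<and> (1 + p\<^sup>2) / 4 \<le> 0.4923 * (L + M3) \<and> 0.3477 \<le> 0.4923 * (L + M3)"
        if n: "n \<le> 2" and L: "L \<le> 1 / (2 * 0.4923 * (1 + 100))"
      proof (intro exI conjI)
        \<comment> \<open>The uniform bound \<open>0.7\<close> would give only
          \<open>0.3446\<close>, short of the required \<open>0.3477\<close>; the refined bound
          profits from \<open>L\<close> being about \<open>0.01\<close> at most.\<close>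
        have "0.70648 \<le> r" if "0.7071 - 0.061 * l \<le> r" "l \<le> 1 / (2 * 0.4923 * (1 + 100))" for l r :: real
          using that by simp
        from this[OF small_moments_ge(2)[OF n] L] have "0.4923 * 0.70648 \<le> 0.4923 * (L + M3)"
          by (intro mult_left_mono) auto
        then show "(1 + 0.6014\<^sup>2) / 4 \<le> 0.4923 * (L + M3)" "0.3477 \<le> 0.4923 * (L + M3)"
          by (simp_all add: power2_eq_square)
        show "(1 + L) / 2 \<le> 0.84 * 0.6014" using L by simp
      qed
    qed (simp_all add: power2_eq_square power3_eq_cube)
  qed
qed

section \<open>Identification with the quantities of the statement\<close>

lemma Bsq_eq: "Bsq M X n = B\<^sup>2"
proof -
  have "Bsq M X n = (\<Sum>i<n. v)"
    unfolding Bsq_def v_def by (intro sum.cong refl expectation_ident) auto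
  then show ?thesis by (simp add: B_sq)
qed

lemma Bn_eq: "Bn M X n = B"
  using B_pos by (simp add: Bn_def Bsq_eq)

lemma Ln_eq: "Ln M X n 1 = L"
proof -
  have "(\<Sum>i<n. expectation (\<lambda>\<omega>. (X i \<omega>)\<^sup>2 * indicator {t. B \<le> \<bar>t\<bar>} (X i \<omega>)))
      = (\<Sum>i<n. expectation (\<lambda>\<omega>. (X 0 \<omega>)\<^sup>2 * indicator {t. B \<le> \<bar>t\<bar>} (X 0 \<omega>)))"
    by (intro sum.cong refl expectation_ident) auto
  then show ?thesis by (simp add: Ln_def Bn_eq Bsq_eq L_def)
qed

lemma Mn_eq: "Mn M X n 1 = M3"
proof -
  have "(\<Sum>i<n. expectation (\<lambda>\<omega>. \<bar>X i \<omega>\<bar> ^ 3 * indicator {t. \<bar>t\<bar> < B} (X i \<omega>)))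
      = (\<Sum>i<n. expectation (\<lambda>\<omega>. \<bar>X 0 \<omega>\<bar> ^ 3 * indicator {t. \<bar>t\<bar> < B} (X 0 \<omega>)))"
    by (intro sum.cong refl expectation_ident) auto
  then show ?thesis by (simp add: Mn_def Bn_eq M3_def)
qed

lemma Delta_le:
  assumes L0: "0 < L" and g: "g * L \<le> M3"
    and gc: "(g, c) \<in> {(0, 1.2388), (2, 1.0373), (5, 0.7915), (10, 0.6591), (100, 0.4923)}"
  shows "Delta M X n \<le> c * (L + M3)"
  unfolding Delta_def
proof (rule cSUP_least)
  have "Sn X n = S" by (rule ext) (simp add: Sn_def S_def)
  then show "\<bar>prob {\<omega> \<in> space M. Sn X n \<omega> < x * Bn M X n} - Phi x\<bar> \<le> c * (L + M3)" for x
    using symmetric_two_sided[OF S_measurable S_symmetric kolmogorov_bound_cases[OF assms], of x]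
      by (simp add: Bn_eq)
qed simp

end

theorem theorem4:
  fixes M :: "'a measure" and X :: "nat \<Rightarrow> 'a \<Rightarrow> real" and n :: nat
  assumes "prob_space M"
    and "n \<ge> 1"
    and meas: "\<And>i. i < n \<Longrightarrow> X i \<in> borel_measurable M"
    and indep: "prob_space.indep_vars M (\<lambda>_. borel) X {..<n}"
    and ident: "\<And>i. i < n \<Longrightarrow> distr M borel (X i) = distr M borel (X 0)"
    and symm: "distr M borel (\<lambda>\<omega>. - X 0 \<omega>) = distr M borel (X 0)"
    and finvar: "integrable M (\<lambda>\<omega>. (X 0 \<omega>)\<^sup>2)"
    and posvar: "integral\<^sup>L M (\<lambda>\<omega>. (X 0 \<omega>)\<^sup>2) > 0"
    and Lpos: "Ln M X n 1 > 0"
  shows "\<forall>(\<gamma>0, c) \<in> set [(0, 1.5645), (0.1, 1.5534), (0.5, 1.4018), (1, 1.2388),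
                          (2, 1.0373), (5, 0.7915), (10, 0.6591), (100, 0.4923)].
           Mn M X n 1 / Ln M X n 1 \<ge> \<gamma>0 \<longrightarrow>
             Delta M X n \<le> (1 + Mn M X n 1 / Ln M X n 1) * c * Ln M X n 1
             \<and> (1 + Mn M X n 1 / Ln M X n 1) * c * Ln M X n 1 = c * (Ln M X n 1 + Mn M X n 1)"
proof -
  interpret prob_space M by fact
  interpret iid_symmetric M X n
    by unfold_locales (fact assms(2) meas indep finvar posvar symm | rule ident, assumption)+
  have L0: "0 < L" using Lpos by (simp only: Ln_eq)
  have R0: "0 \<le> L + M3" using L0 M3_nonneg by simp
  define \<gamma> where "\<gamma> = M3 / L"
  have m: "M3 = \<gamma> * L" using L0 by (simp add: \<gamma>_def)
  have scaled: "(1 + \<gamma>) * c * L = c * (L + M3)" for c by (simp add: m algebra_simps)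
  have le: "Delta M X n \<le> c * (L + M3)"
    if "g \<le> \<gamma>" "c' \<le> c" "(g, c') \<in> {(0, 1.2388), (2, 1.0373), (5, 0.7915), (10, 0.6591), (100, 0.4923)}" for g c' c
  proof -
    have "g * L \<le> M3" unfolding m using that(1) L0 by (intro mult_right_mono) auto
    then have "Delta M X n \<le> c' * (L + M3)" using that(3) by (rule Delta_le[OF L0])
    also have "\<dots> \<le> c * (L + M3)" using that(2) R0 by (rule mult_right_mono)
    finally show ?thesis .
  qed
  have \<gamma>0: "0 \<le> \<gamma>" using L0 M3_nonneg by (simp add: \<gamma>_def)
  \<comment> \<open>The four rows with constants from \<open>1.2388\<close> upwards are all obtained
    from the case \<open>g = 0\<close>.\<close>
  have "Delta M X n \<le> c * (L + M3)" if "1.2388 \<le> c" for c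
    by (rule le[OF \<gamma>0 that]) simp
  from this[of "1.5645"] this[of "1.5534"] this[of "1.4018"] this[of "1.2388"]
  have "Delta M X n \<le> 1.5645 * (L + M3)" "Delta M X n \<le> 1.5534 * (L + M3)"
    "Delta M X n \<le> 1.4018 * (L + M3)" "Delta M X n \<le> 1.2388 * (L + M3)" by simp_all
  moreover have "2 \<le> \<gamma> \<Longrightarrow> Delta M X n \<le> 1.0373 * (L + M3)" "5 \<le> \<gamma> \<Longrightarrow> Delta M X n \<le> 0.7915 * (L + M3)"
    "10 \<le> \<gamma> \<Longrightarrow> Delta M X n \<le> 0.6591 * (L + M3)" "100 \<le> \<gamma> \<Longrightarrow> Delta M X n \<le> 0.4923 * (L + M3)"
    by (rule le[OF _ order_refl], assumption, simp)+
  ultimately show ?thesis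
    unfolding Ln_eq Mn_eq \<gamma>_def[symmetric] scaled by simp
qed

end
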